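(* Let $L=L_K(E)$ be the Leavitt path algebra of an arbitrary graph $E$ over an arbitrary field $K$, and let $I$ be an ideal of $L$ that is an irredundant intersection of finitely many prime-power ideals of $L$. Then the ideals in the intersection are uniquely determined. That is, if $I=I_1\cap\cdots\cap I_m=J_1\cap\cdots\cap J_n$ ($m,n\ge1$) are two irredundant intersections, with all $I_i$ and $J_j$ prime-power ideals of $L$, then $m=n$ and there is a permutation $\sigma$ of $\{1,\dots,m\}$ such that $I_i=J_{\sigma(i)}$ for all $i$.
   Context: A graph $E=(E^0,E^1,r,s)$ is a directed graph: a nonempty set $E^0$ of vertices, a set $E^1$ of edges, and range and source maps $r,s:E^1\to E^0$ (no finiteness or countability assumptions). A vertex $v$ is regular if $s^{-1}(v)$ is finite and nonempty. For a field $K$, the Leavitt path algebra $L_K(E)$ is the (associative, not necessarily unital) $K$-algebra generated by $\{v\mid v\in E^0\}\cup\{e,e^*\mid e\in E^1\}$ subject to: $vw=\delta_{v,w}v$ for $v,w\in E^0$; $s(e)e=er(e)=e$ and $r(e)e^*=e^*s(e)=e^*$ for $e\in E^1$; $e^*f=\delta_{e,f}r(e)$ for $e,f\in E^1$; and $v=\sum_{e\in s^{-1}(v)}ee^*$ for every regular $v\in E^0$. "Ideal" means two-sided ideal, and the product $IJ$ of ideals is the set of finite sums of products $ab$ with $a\in I$, $b\in J$. A prime ideal is a proper ideal $P$ such that $IJ\subseteq P$ implies $I\subseteq P$ or $J\subseteq P$ for all ideals $I,J$. A prime-power ideal is an ideal of the form $P^r$ with $P$ a prime ideal and $r$ a positive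 integer. An intersection $\bigcap_{i\in Y}S_i$ of a nonempty collection of sets is irredundant if either $|Y|=1$ or $\bigcap_{i\in Y\setminus\{j\}}S_i\not\subseteq S_j$ for all $j\in Y$. *)

theory Defs
  imports
    "HOL-Library.Poly_Mapping"
    "HOL-Algebra.QuotRing"
    "HOL-Algebra.Ideal_Product"
    "HOL-Combinatorics.Permutations"
    "Graph_Theory.Digraph"
begin

hide_const (open) Multiset.mult

section \<open>The free algebra on a set of generators\<close>

text \<open>
  Words form a monoid under concatenation, so that finitely supported functions from words to a
  field, with the convolution product of \<^theory>\<open>HOL-Library.Poly_Mapping\<close>, are the
  noncommutative polynomials.
\<close>

datatype 'g gen_word = Word (letters: "'g list")

instantiation gen_word :: (type) monoid_add
begin

definition zero_gen_word :: "'a gen_word" where "0 = Word []"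

definition plus_gen_word :: "'a gen_word \<Rightarrow> 'a gen_word \<Rightarrow> 'a gen_word" where
  "u + w = Word (letters u @ letters w)"

instance
  by standard (simp_all add: zero_gen_word_def plus_gen_word_def)

end

definition gen :: "'g \<Rightarrow> 'g gen_word \<Rightarrow>\<^sub>0 'k::field" where
  "gen x = Poly_Mapping.single (Word [x]) 1"

text \<open>
  The free associative algebra without unit on the generators \<open>X\<close>: the empty word is excluded.
  The record type of rings demands a \<open>one\<close> field; it is a dummy here and in the quotients below,
  and neither ideals nor their products depend on it.
\<close>

definition free_algebra :: "'g set \<Rightarrow> ('g gen_word \<Rightarrow>\<^sub>0 'k::field) ring" where
  "free_algebra X =
     \<lparr>carrier = {p. \<forall>w \<in> Poly_Mapping.keys p. w \<noteq> 0 \<and> set (letters w) \<subseteq> X},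
      mult = (*), one = undefined, zero = 0, add = (+)\<rparr>"

text \<open>
  The algebra ideal generated by \<open>S\<close>. As the free algebra has no unit, closure under scalars has to
  be required separately.
\<close>

inductive_set free_algebra_ideal ::
  "'g set \<Rightarrow> ('g gen_word \<Rightarrow>\<^sub>0 'k::field) set \<Rightarrow> ('g gen_word \<Rightarrow>\<^sub>0 'k) set"
  for X :: "'g set" and S :: "('g gen_word \<Rightarrow>\<^sub>0 'k) set"
where
  base: "p \<in> S \<Longrightarrow> p \<in> free_algebra_ideal X S"
| zero: "0 \<in> free_algebra_ideal X S"
| add: "p \<in> free_algebra_ideal X S \<Longrightarrow> q \<in> free_algebra_ideal X S
    \<Longrightarrow> p + q \<in> free_algebra_ideal X S"
| scale: "p \<in> free_algebra_ideal X S \<Longrightarrow> Poly_Mapping.single 0 c * p \<in> free_algebra_ideal X S"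
| lmult: "p \<in> free_algebra_ideal X S \<Longrightarrow> a \<in> carrier (free_algebra X)
    \<Longrightarrow> a * p \<in> free_algebra_ideal X S"
| rmult: "p \<in> free_algebra_ideal X S \<Longrightarrow> a \<in> carrier (free_algebra X)
    \<Longrightarrow> p * a \<in> free_algebra_ideal X S"

section \<open>Leavitt path algebras\<close>

text \<open>The source of an edge is its \<open>tail\<close>, the range its \<open>head\<close>; \<open>Ghost e\<close> is the generator
  written \<open>e\<close> with a star.\<close>

datatype ('v, 'e) lpa_gen = Vert 'v | Edge 'e | Ghost 'e

definition lpa_gens :: "('v, 'e) pre_digraph \<Rightarrow> ('v, 'e) lpa_gen set" where
  "lpa_gens E = Vert ` verts E \<union> Edge ` arcs E \<union> Ghost ` arcs E"

definition regular_vertex :: "('v, 'e) pre_digraph \<Rightarrow> 'v \<Rightarrow> bool" where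
  "regular_vertex E v \<longleftrightarrow> v \<in> verts E \<and> finite (out_arcs E v) \<and> out_arcs E v \<noteq> {}"

definition lpa_relators ::
  "('v, 'e) pre_digraph \<Rightarrow> (('v, 'e) lpa_gen gen_word \<Rightarrow>\<^sub>0 'k::field) set" where
  "lpa_relators E =
     {gen (Vert v) * gen (Vert w) - (if v = w then gen (Vert v) else 0) | v w.
        v \<in> verts E \<and> w \<in> verts E}
   \<union> {gen (Vert (tail E e)) * gen (Edge e) - gen (Edge e) | e. e \<in> arcs E}
   \<union> {gen (Edge e) * gen (Vert (head E e)) - gen (Edge e) | e. e \<in> arcs E}
   \<union> {gen (Vert (head E e)) * gen (Ghost e) - gen (Ghost e) | e. e \<in> arcs E}
   \<union> {gen (Ghost e) * gen (Vert (tail E e)) - gen (Ghost e) | e. e \<in> arcs E}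
   \<union> {gen (Ghost e) * gen (Edge f) - (if e = f then gen (Vert (head E e)) else 0) | e f.
        e \<in> arcs E \<and> f \<in> arcs E}
   \<union> {gen (Vert v) - (\<Sum>e \<in> out_arcs E v. gen (Edge e) * gen (Ghost e)) | v.
        regular_vertex E v}"

definition leavitt_path_algebra ::
  "('v, 'e) pre_digraph \<Rightarrow> (('v, 'e) lpa_gen gen_word \<Rightarrow>\<^sub>0 'k::field) set ring" where
  "leavitt_path_algebra E =
     free_algebra (lpa_gens E) Quot free_algebra_ideal (lpa_gens E) (lpa_relators E)"

section \<open>Ideals in rings without unit\<close>

text \<open>
  The library's \<open>ideal\<close> and \<open>primeideal\<close> presuppose a unital (for \<open>primeideal\<close> even commutative)
  ring. The library's product \<open>ideal_prod\<close>, the set of finite sums of products, does not.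
\<close>

definition two_sided_ideal :: "('a, 'b) ring_scheme \<Rightarrow> 'a set \<Rightarrow> bool" where
  "two_sided_ideal R I \<longleftrightarrow> additive_subgroup I R \<and>
     (\<forall>a \<in> I. \<forall>x \<in> carrier R. x \<otimes>\<^bsub>R\<^esub> a \<in> I \<and> a \<otimes>\<^bsub>R\<^esub> x \<in> I)"

definition prime_ideal :: "('a, 'b) ring_scheme \<Rightarrow> 'a set \<Rightarrow> bool" where
  "prime_ideal R P \<longleftrightarrow> two_sided_ideal R P \<and> P \<noteq> carrier R \<and>
     (\<forall>I J. two_sided_ideal R I \<longrightarrow> two_sided_ideal R J \<longrightarrow>
        I \<cdot>\<^bsub>R\<^esub> J \<subseteq> P \<longrightarrow> I \<subseteq> P \<or> J \<subseteq> P)"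

text \<open>The value at exponent \<open>0\<close> is a convention; only positive exponents are used.\<close>

fun ideal_power :: "('a, 'b) ring_scheme \<Rightarrow> 'a set \<Rightarrow> nat \<Rightarrow> 'a set" where
  "ideal_power R P 0 = carrier R"
| "ideal_power R P (Suc 0) = P"
| "ideal_power R P (Suc (Suc n)) = ideal_power R P (Suc n) \<cdot>\<^bsub>R\<^esub> P"

definition prime_power_ideal :: "('a, 'b) ring_scheme \<Rightarrow> 'a set \<Rightarrow> bool" where
  "prime_power_ideal R I \<longleftrightarrow> (\<exists>P r. prime_ideal R P \<and> r \<ge> 1 \<and> I = ideal_power R P r)"

definition irredundant :: "'i set \<Rightarrow> ('i \<Rightarrow> 'a set) \<Rightarrow> bool" where
  "irredundant Y S \<longleftrightarrow> card Y = 1 \<or> (\<forall>j \<in> Y. \<not> (\<Inter>i \<in> Y - {j}. S i) \<subseteq> S j)"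

end

theory Submission
  imports
    Defs
    "HOL-Computational_Algebra.Polynomial"
    "HOL-Library.Sublist"
    "Graph_Theory.Arc_Walk"
begin

text \<open>
  Everything follows from one property of the ring \<open>L = leavitt_path_algebra E\<close>: a prime ideal \<open>P\<close> that is
  properly contained in an ideal \<open>Q\<close> satisfies \<open>P = P Q\<close> (lemma \<open>leavitt_path_algebra_prime_absorbing\<close>).

  \<^bold>\<open>From the property to uniqueness.\<close> Iterating \<open>P = P Q\<close> gives \<open>P \<subseteq> Q\<^sup>r\<close> for every \<open>r\<close>. Hence in an
  irredundant intersection of prime powers the primes are pairwise incomparable, and the primes of two
  intersections with the same value \<open>A\<close> agree, because both are the minimal primes over \<open>A\<close>. The
  exponents are recovered because powers of a prime are primary in the following sense: if
  \<open>P\<^sup>s Y \<subseteq> P\<^sup>r\<close> and \<open>Y\<close> is not contained in \<open>P\<close>, then \<open>P + Y\<close> properly contains \<open>P\<close>, so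
  \<open>P\<^sup>t = P\<^sup>t (P + Y) \<subseteq> P\<^sup>t\<^sup>+\<^sup>1 + P\<^sup>t Y\<close> pushes \<open>P\<^sup>s\<close> into \<open>P\<^sup>r\<close> one power at a time. This applies with \<open>Y\<close> the
  intersection of the remaining components (\<open>prime_power_primary\<close>, \<open>irredundant_unique\<close>).

  \<^bold>\<open>The property for Leavitt path algebras.\<close> Suppose \<open>x\<close> lies in \<open>P\<close> but not in \<open>Z = P Q\<close>. Multiplying \<open>x\<close> on
  the right removes its ghost edges without falling into \<open>Z\<close> (\<open>ghost_elimination\<close>): otherwise an
  idempotent \<open>v - \<Sum> e e\<^sup>*\<close> would have to lie in \<open>P\<close>, and idempotents of \<open>P\<close> lie in \<open>P\<^sup>2 \<subseteq> Z\<close>. One is left with a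
  combination \<open>p\<close> of real paths that end at a vertex \<open>w\<close>, with \<open>p \<in> P\<close> and \<open>p \<notin> Z\<close>. Multiplication on the left by the
  ghost of a shortest path of \<open>p\<close> yields an element \<open>k w + (closed paths at w)\<close> of \<open>P\<close> with \<open>k \<noteq> 0\<close>
  (\<open>psum_reduce\<close>). Such an element forces \<open>w \<in> Q\<close>, whence \<open>p = p w \<in> P Q = Z\<close>, a contradiction.

  It remains to see why \<open>w \<in> Q\<close>, which is where primeness enters. If \<open>w \<notin> P\<close>, an element
  \<open>k w + (closed paths at w)\<close> of \<open>P\<close> with as few terms as possible shows that all closed paths at \<open>w\<close> are
  powers of a single one, \<open>c\<close>. Modulo \<open>P\<close> the corner \<open>w L w\<close> then consists of Laurent polynomials in \<open>c\<close>. The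
  polynomials that vanish at \<open>c\<close> modulo \<open>P\<close> form a nonzero prime, hence maximal, ideal of the polynomial ring,
  while those whose value at \<open>c\<close> lies in \<open>Q\<close> form a strictly larger ideal, which therefore contains \<open>1\<close>; the
  value of \<open>1\<close> at \<open>c\<close> is \<open>w\<close> (\<open>corner_vertex_in_larger_ideal\<close>).

  These computations take place in the ring of all noncommutative polynomials with unit. The ideals of \<open>L\<close> are in
  bijection with certain ideals of that ring (\<open>hat\<close>), and equations in \<open>L\<close> become congruences there.
\<close>

section \<open>Congruences\<close>

text \<open>
  Ideals absorb every element of the type, so that computing modulo an ideal creates no membership
  obligations.
\<close>

definition alg_ideal :: "'a::ring_1 set \<Rightarrow> bool" where
  "alg_ideal I \<longleftrightarrow> 0 \<in> I \<and> (\<forall>x \<in> I. \<forall>y \<in> I. x + y \<in> I) \<and> (\<forall>x \<in> I. \<forall>a. a * x \<in> I \<and> x * a \<in> I)"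

lemma alg_ideal_zero: "alg_ideal I \<Longrightarrow> 0 \<in> I"
  and alg_ideal_add: "alg_ideal I \<Longrightarrow> x \<in> I \<Longrightarrow> y \<in> I \<Longrightarrow> x + y \<in> I"
  and alg_ideal_lmult: "alg_ideal I \<Longrightarrow> x \<in> I \<Longrightarrow> a * x \<in> I"
  and alg_ideal_rmult: "alg_ideal I \<Longrightarrow> x \<in> I \<Longrightarrow> x * a \<in> I"
  by (auto simp: alg_ideal_def)

lemma alg_ideal_uminus: "alg_ideal I \<Longrightarrow> x \<in> I \<Longrightarrow> - x \<in> I"
  using alg_ideal_lmult[of I x "- 1"] by simp

lemma alg_ideal_diff: "alg_ideal I \<Longrightarrow> x \<in> I \<Longrightarrow> y \<in> I \<Longrightarrow> x - y \<in> I"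
  using alg_ideal_add[of I x "- y"] alg_ideal_uminus[of I y] by simp

lemma alg_ideal_sum: "alg_ideal I \<Longrightarrow> (\<And>i. i \<in> A \<Longrightarrow> f i \<in> I) \<Longrightarrow> sum f A \<in> I"
  by (induction A rule: infinite_finite_induct) (auto simp: alg_ideal_zero alg_ideal_add)

definition cg :: "'a::ring_1 \<Rightarrow> 'a set \<Rightarrow> 'a \<Rightarrow> bool" (\<open>(_ \<simeq>\<^bsub>_\<^esub> _)\<close> [51, 0, 51] 50) where
  "x \<simeq>\<^bsub>I\<^esub> y \<longleftrightarrow> x - y \<in> I"

lemma cg_refl: "alg_ideal I \<Longrightarrow> x \<simeq>\<^bsub>I\<^esub> x"
  by (simp add: cg_def alg_ideal_zero)

lemma cg_sym: "alg_ideal I \<Longrightarrow> x \<simeq>\<^bsub>I\<^esub> y \<Longrightarrow> y \<simeq>\<^bsub>I\<^esub> x"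
  unfolding cg_def using alg_ideal_uminus by fastforce

lemma cg_trans: "alg_ideal I \<Longrightarrow> x \<simeq>\<^bsub>I\<^esub> y \<Longrightarrow> y \<simeq>\<^bsub>I\<^esub> z \<Longrightarrow> x \<simeq>\<^bsub>I\<^esub> z"
  unfolding cg_def using alg_ideal_add[of I "x - y" "y - z"] by simp

lemma cg_add: "alg_ideal I \<Longrightarrow> x \<simeq>\<^bsub>I\<^esub> y \<Longrightarrow> u \<simeq>\<^bsub>I\<^esub> v \<Longrightarrow> x + u \<simeq>\<^bsub>I\<^esub> y + v"
  unfolding cg_def using alg_ideal_add[of I "x - y" "u - v"] by (simp add: algebra_simps)

lemma cg_diff: "alg_ideal I \<Longrightarrow> x \<simeq>\<^bsub>I\<^esub> y \<Longrightarrow> u \<simeq>\<^bsub>I\<^esub> v \<Longrightarrow> x - u \<simeq>\<^bsub>I\<^esub> y - v"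
  unfolding cg_def using alg_ideal_diff[of I "x - y" "u - v"] by (simp add: algebra_simps)

lemma cg_lmult: "alg_ideal I \<Longrightarrow> x \<simeq>\<^bsub>I\<^esub> y \<Longrightarrow> a * x \<simeq>\<^bsub>I\<^esub> a * y"
  unfolding cg_def using alg_ideal_lmult[of I "x - y" a] by (simp add: algebra_simps)

lemma cg_rmult: "alg_ideal I \<Longrightarrow> x \<simeq>\<^bsub>I\<^esub> y \<Longrightarrow> x * a \<simeq>\<^bsub>I\<^esub> y * a"
  unfolding cg_def using alg_ideal_rmult[of I "x - y" a] by (simp add: algebra_simps)

lemma cg_sum: "alg_ideal I \<Longrightarrow> (\<And>i. i \<in> A \<Longrightarrow> f i \<simeq>\<^bsub>I\<^esub> g i) \<Longrightarrow> sum f A \<simeq>\<^bsub>I\<^esub> sum g A"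
  unfolding cg_def sum_subtractf[symmetric] by (rule alg_ideal_sum)

lemma cg_mem: "alg_ideal I \<Longrightarrow> x \<simeq>\<^bsub>I\<^esub> y \<Longrightarrow> x \<in> I \<longleftrightarrow> y \<in> I"
  unfolding cg_def
  using alg_ideal_add[of I "x - y" y] alg_ideal_diff[of I x "x - y"] by auto

lemma cg_zero: "x \<simeq>\<^bsub>I\<^esub> 0 \<longleftrightarrow> x \<in> I"
  by (simp add: cg_def)

lemma cg_mono: "I \<subseteq> J \<Longrightarrow> x \<simeq>\<^bsub>I\<^esub> y \<Longrightarrow> x \<simeq>\<^bsub>J\<^esub> y"
  by (auto simp: cg_def)

section \<open>Combinations of paths\<close>

text \<open>
  The ambient ring \<open>'a\<close> is a unital algebra over \<open>'k\<close>, whose scalars are embedded by \<open>sc\<close>. The Leavitt path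
  algebra appears as the quotient by \<open>N\<close> of the ideal \<open>M\<close>, which is spanned modulo \<open>N\<close> by the nonempty words in the
  generators. Its ideals correspond to the ideals of \<open>'a\<close> between \<open>N\<close> and \<open>M\<close>.
\<close>

locale lpa_presentation = wf_digraph E for E :: "('v, 'e) pre_digraph" +
  fixes sc :: "'k::field \<Rightarrow> 'a::ring_1" and vt :: "'v \<Rightarrow> 'a" and ed gh :: "'e \<Rightarrow> 'a"
    and N M :: "'a set"
  assumes sc_add: "sc (a + b) = sc a + sc b"
    and sc_mult: "sc (a * b) = sc a * sc b"
    and sc_one: "sc 1 = 1"
    and sc_comm: "sc a * x = x * sc a"
    and N_ideal: "alg_ideal N"
    and M_ideal: "alg_ideal M"
    and vt_M: "v \<in> verts E \<Longrightarrow> vt v \<in> M"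
    and vt_vt: "v \<in> verts E \<Longrightarrow> w \<in> verts E \<Longrightarrow> vt v * vt w \<simeq>\<^bsub>N\<^esub> (if v = w then vt v else 0)"
    and vt_ed: "e \<in> arcs E \<Longrightarrow> vt (tail E e) * ed e \<simeq>\<^bsub>N\<^esub> ed e"
    and ed_vt: "e \<in> arcs E \<Longrightarrow> ed e * vt (head E e) \<simeq>\<^bsub>N\<^esub> ed e"
    and vt_gh: "e \<in> arcs E \<Longrightarrow> vt (head E e) * gh e \<simeq>\<^bsub>N\<^esub> gh e"
    and gh_vt: "e \<in> arcs E \<Longrightarrow> gh e * vt (tail E e) \<simeq>\<^bsub>N\<^esub> gh e"
    and gh_ed: "e \<in> arcs E \<Longrightarrow> f \<in> arcs E \<Longrightarrow>
      gh e * ed f \<simeq>\<^bsub>N\<^esub> (if e = f then vt (head E e) else 0)"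
    and M_span: "x \<in> M \<Longrightarrow> \<exists>ls. (\<forall>(k, w) \<in> set ls. w \<noteq> [] \<and> set w \<subseteq> lpa_gens E) \<and>
      x \<simeq>\<^bsub>N\<^esub> (\<Sum>(k, w)\<leftarrow>ls. sc k * prod_list (map (case_lpa_gen vt ed gh) w))"
begin

declare awalkE'[rule del]
declare awalk_append_iff[simp del]

lemma awalk_append: "awalk u (p @ q) v \<longleftrightarrow> (\<exists>x. awalk u p x \<and> awalk x q v)"
  using awalk_append_iff awalk_appendI by blast

lemma sc_zero [simp]: "sc 0 = 0"
  using sc_add[of 0 0] by simp

lemmas Nrefl = cg_refl[OF N_ideal]
lemmas Nsym = cg_sym[OF N_ideal]
lemmas Ntrans [trans] = cg_trans[OF N_ideal]
lemmas Nadd = cg_add[OF N_ideal]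
lemmas Ndiff = cg_diff[OF N_ideal]
lemmas Nlmult = cg_lmult[OF N_ideal]
lemmas Nrmult = cg_rmult[OF N_ideal]
lemmas Nsum = cg_sum[OF N_ideal]

text \<open>
  \<open>pe \<alpha>\<close> is the path \<open>\<alpha>\<close> as an element of the algebra and \<open>pg \<alpha>\<close> its ghost \<open>\<alpha>\<^sup>*\<close>. Both are \<open>1\<close> for the empty
  list, so the vertex at which a path starts or ends is multiplied on explicitly.
\<close>

definition pe :: "'e list \<Rightarrow> 'a" where "pe \<alpha> = prod_list (map ed \<alpha>)"
definition pg :: "'e list \<Rightarrow> 'a" where "pg \<alpha> = prod_list (map gh (rev \<alpha>))"

lemma pe_simps [simp]: "pe [] = 1" "pe (e # \<alpha>) = ed e * pe \<alpha>" "pe (\<alpha> @ \<beta>) = pe \<alpha> * pe \<beta>"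
  and pg_simps [simp]: "pg [] = 1" "pg (e # \<alpha>) = pg \<alpha> * gh e" "pg (\<alpha> @ \<beta>) = pg \<beta> * pg \<alpha>"
  by (simp_all add: pe_def pg_def)

lemma vt_idem: "v \<in> verts E \<Longrightarrow> vt v * vt v \<simeq>\<^bsub>N\<^esub> vt v"
  using vt_vt[of v v] by simp

lemma sc_left: "a * (sc k * x) = sc k * (a * x)"
  by (metis mult.assoc sc_comm)

lemma awalk_suffix:
  assumes "awalk u (\<alpha> @ \<beta>) v" "awalk u \<alpha> w" shows "awalk w \<beta> v"
  using assms awalk_ends unfolding awalk_append by blast

lemma vt_pe:
  assumes "awalk u \<alpha> v"
  shows "vt u * (pe \<alpha> * vt v) \<simeq>\<^bsub>N\<^esub> pe \<alpha> * vt v"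
proof (cases \<alpha>)
  case Nil
  then show ?thesis using assms vt_idem by (auto simp: awalk_Nil_iff)
next
  case (Cons e \<beta>)
  then have "vt u * ed e \<simeq>\<^bsub>N\<^esub> ed e" using assms vt_ed by (auto simp: awalk_Cons_iff)
  from Nrmult[OF this, of "pe \<beta> * vt v"] show ?thesis by (simp add: Cons mult.assoc)
qed

lemma pg_vt:
  assumes "awalk u \<beta> v"
  shows "vt v * pg \<beta> * vt u \<simeq>\<^bsub>N\<^esub> vt v * pg \<beta>"
proof (cases \<beta>)
  case Nil
  then show ?thesis using assms vt_idem by (auto simp: awalk_Nil_iff)
next
  case (Cons e \<gamma>)
  then have "gh e * vt u \<simeq>\<^bsub>N\<^esub> gh e" using assms gh_vt by (auto simp: awalk_Cons_iff)
  from Nlmult[OF this, of "vt v * pg \<gamma>"] show ?thesis by (simp add: Cons mult.assoc)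
qed

lemma pe_vt_pe:
  assumes "awalk u \<alpha> v"
  shows "pe \<beta> * vt u * (pe \<alpha> * vt v) \<simeq>\<^bsub>N\<^esub> pe (\<beta> @ \<alpha>) * vt v"
  using Nlmult[OF vt_pe[OF assms], of "pe \<beta>"] by (simp add: mult.assoc)

lemma awalk_verts_ends:
  assumes "awalk u \<alpha> v" shows "u \<in> verts E" "v \<in> verts E"
  using assms by (auto intro: awalk_hd_in_verts awalk_last_in_verts)

text \<open>
  The basic cancellation rule: \<open>\<alpha>\<^sup>* \<beta>\<close> is the rest of \<open>\<beta>\<close> if \<open>\<alpha>\<close> is an initial part of \<open>\<beta>\<close>, and vanishes otherwise. The
  condition \<open>u = u'\<close> matters only for empty \<open>\<alpha>\<close>, which is a prefix of every list.
\<close>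

lemma pg_pe:
  assumes "awalk u \<alpha> v" "awalk u' \<beta> v'" "length \<alpha> \<le> length \<beta>"
  shows "vt v * pg \<alpha> * (pe \<beta> * vt v') \<simeq>\<^bsub>N\<^esub>
    (if prefix \<alpha> \<beta> \<and> u = u' then pe (drop (length \<alpha>) \<beta>) * vt v' else 0)"
  using assms
proof (induction \<alpha> arbitrary: u u' \<beta>)
  case Nil
  then have [simp]: "v = u" and u: "u \<in> verts E" "u' \<in> verts E"
    by (auto simp: awalk_Nil_iff dest: awalk_verts_ends)
  show ?case
  proof (cases "u = u'")
    case True
    then show ?thesis using vt_pe[OF Nil.prems(2)] by simp
  next
    case False
    have "vt u * (pe \<beta> * vt v') \<simeq>\<^bsub>N\<^esub> vt u * (vt u' * (pe \<beta> * vt v'))"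
      by (rule Nlmult, rule Nsym, rule vt_pe[OF Nil.prems(2)])
    also have "vt u * (vt u' * (pe \<beta> * vt v')) \<simeq>\<^bsub>N\<^esub> 0 * (pe \<beta> * vt v')"
      unfolding mult.assoc[symmetric, of "vt u"] using Nrmult vt_vt[OF u] False by presburger
    finally show ?thesis using False by simp
  qed
next
  case (Cons e \<alpha>)
  then obtain f \<gamma> where \<beta>: "\<beta> = f # \<gamma>" by (cases \<beta>) auto
  have e: "e \<in> arcs E" "u = tail E e" "awalk (head E e) \<alpha> v"
    and f: "f \<in> arcs E" "u' = tail E f" "awalk (head E f) \<gamma> v'"
    using Cons.prems by (auto simp: \<beta> awalk_Cons_iff)
  have "vt v * pg (e # \<alpha>) * (pe \<beta> * vt v') = vt v * pg \<alpha> * ((gh e * ed f) * (pe \<gamma> * vt v'))"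
    by (simp add: \<beta> mult.assoc)
  also have "\<dots> \<simeq>\<^bsub>N\<^esub> vt v * pg \<alpha> * ((if e = f then vt (head E e) else 0) * (pe \<gamma> * vt v'))"
    by (intro Nlmult Nrmult gh_ed e f)
  finally have 1: "vt v * pg (e # \<alpha>) * (pe \<beta> * vt v') \<simeq>\<^bsub>N\<^esub>
    vt v * pg \<alpha> * ((if e = f then vt (head E e) else 0) * (pe \<gamma> * vt v'))" .
  show ?case
  proof (cases "e = f")
    case True
    note 1
    also have "vt v * pg \<alpha> * ((if e = f then vt (head E e) else 0) * (pe \<gamma> * vt v')) \<simeq>\<^bsub>N\<^esub>
        vt v * pg \<alpha> * (pe \<gamma> * vt v')"
      using Nlmult[OF vt_pe[OF f(3)]] True by simp
    also have "\<dots> \<simeq>\<^bsub>N\<^esub> (if prefix \<alpha> \<gamma> \<and> head E e = head E f then pe (drop (length \<alpha>) \<gamma>) * vt v' else 0)"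
      using Cons.prems(3) by (intro Cons.IH e f) (simp add: \<beta>)
    finally show ?thesis using True e f by (cases "prefix \<alpha> \<gamma>") (simp_all add: \<beta>)
  next
    case False
    then show ?thesis using 1 by (simp add: \<beta>)
  qed
qed

lemma pg_pe_same:
  assumes "awalk u \<alpha> v"
  shows "vt v * pg \<alpha> * (pe \<alpha> * vt v) \<simeq>\<^bsub>N\<^esub> vt v"
  using pg_pe[OF assms assms] by simp

text \<open>
  Formal combinations are lists of coefficients and paths, in which a path may occur repeatedly. Addition is then
  concatenation, and the length of the list is a measure for induction and minimality arguments.
\<close>

definition psum :: "'v \<Rightarrow> ('k \<times> 'e list) list \<Rightarrow> 'a" where
  "psum v xs = (\<Sum>(k, \<alpha>)\<leftarrow>xs. sc k * (pe \<alpha> * vt v))"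

definition paths_to :: "'v \<Rightarrow> ('k \<times> 'e list) list \<Rightarrow> bool" where
  "paths_to v xs \<longleftrightarrow> (\<forall>(k, \<alpha>) \<in> set xs. \<exists>u. awalk u \<alpha> v)"

definition loops_at :: "'v \<Rightarrow> ('k \<times> 'e list) list \<Rightarrow> bool" where
  "loops_at v xs \<longleftrightarrow> (\<forall>(k, \<gamma>) \<in> set xs. \<gamma> \<noteq> [] \<and> awalk v \<gamma> v)"

definition vertex_plus_loops :: "'v \<Rightarrow> 'k \<Rightarrow> ('k \<times> 'e list) list \<Rightarrow> 'a" where
  "vertex_plus_loops v k ys = sc k * vt v + psum v ys"

lemma psum_simps [simp]:
  "psum v [] = 0" "psum v ((k, \<alpha>) # xs) = sc k * (pe \<alpha> * vt v) + psum v xs"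
  "psum v (xs @ ys) = psum v xs + psum v ys"
  by (simp_all add: psum_def)

lemma psum_partition: "psum v xs = psum v (filter Q xs) + psum v (filter (\<lambda>x. \<not> Q x) xs)"
  by (induction xs) auto

lemma psum_const:
  assumes "\<forall>(k, \<beta>) \<in> set xs. \<beta> = \<alpha>"
  shows "psum v xs = sc (sum_list (map fst xs)) * (pe \<alpha> * vt v)"
  using assms by (induction xs) (auto simp: sc_add algebra_simps)

lemma strip_prefix:
  assumes "awalk u \<alpha> v" "\<forall>(k, \<beta>) \<in> set xs. (\<exists>u. awalk u \<beta> v) \<and> \<beta> \<noteq> \<alpha> \<and> length \<alpha> \<le> length \<beta>"
  shows "\<exists>ys. loops_at v ys \<and> vt v * pg \<alpha> * psum v xs \<simeq>\<^bsub>N\<^esub> psum v ys"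
  using assms(2)
proof (induction xs)
  case Nil
  have "loops_at v []" by (simp add: loops_at_def)
  then show ?case by (intro exI[of _ "[]"]) (simp add: Nrefl)
next
  case (Cons x xs)
  obtain k \<beta> where x: "x = (k, \<beta>)" by force
  then obtain u' where \<beta>: "awalk u' \<beta> v" "\<beta> \<noteq> \<alpha>" "length \<alpha> \<le> length \<beta>" using Cons.prems by auto
  obtain ys where ys: "loops_at v ys" "vt v * pg \<alpha> * psum v xs \<simeq>\<^bsub>N\<^esub> psum v ys"
    using Cons by auto
  have "vt v * pg \<alpha> * psum v (x # xs)
      = sc k * (vt v * pg \<alpha> * (pe \<beta> * vt v)) + vt v * pg \<alpha> * psum v xs"
    by (simp add: x distrib_left sc_left)
  also have "\<dots> \<simeq>\<^bsub>N\<^esub> sc k * (if prefix \<alpha> \<beta> \<and> u = u' then pe (drop (length \<alpha>) \<beta>) * vt v else 0) + psum v ys"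
    by (intro Nadd Nlmult pg_pe assms(1) \<beta> ys)
  finally have *: "vt v * pg \<alpha> * psum v (x # xs) \<simeq>\<^bsub>N\<^esub> \<dots>" .
  show ?case
  proof (cases "prefix \<alpha> \<beta> \<and> u = u'")
    case True
    then obtain \<gamma> where \<gamma>: "\<beta> = \<alpha> @ \<gamma>" by (auto simp: prefix_def)
    have "awalk v \<gamma> v"
      using awalk_suffix[of u \<alpha> \<gamma>] \<beta>(1) assms(1) True by (simp add: \<gamma>)
    with \<gamma> \<beta>(2) ys(1) have "loops_at v ((k, \<gamma>) # ys)" by (auto simp: loops_at_def)
    with * True \<gamma> show ?thesis by (intro exI[of _ "(k, \<gamma>) # ys"]) simp
  next
    case False
    have "sc k * (if prefix \<alpha> \<beta> \<and> u = u' then pe (drop (length \<alpha>) \<beta>) * vt v else 0) + psum v ys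
        = psum v ys"
      using False by auto
    with * ys(1) show ?thesis by metis
  qed
qed


text \<open>
  Multiply by the ghost of a shortest path \<open>\<alpha>\<close> of the combination: \<open>\<alpha>\<close> itself becomes the vertex \<open>v\<close>, and every other
  path, being at least as long and different from \<open>\<alpha>\<close>, becomes \<open>0\<close> or a nontrivial closed path. If the coefficients
  of \<open>\<alpha>\<close> add up to \<open>0\<close>, its occurrences are dropped and the argument is repeated.
\<close>

lemma psum_reduce:
  assumes "paths_to v xs" "v \<in> verts E"
  shows "psum v xs \<in> N \<or>
    (\<exists>a k ys. k \<noteq> 0 \<and> loops_at v ys \<and> a * psum v xs \<simeq>\<^bsub>N\<^esub> vertex_plus_loops v k ys)"
  using assms(1)
proof (induction "length xs" arbitrary: xs rule: less_induct)
  case less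
  show ?case
  proof (cases "xs = []")
    case True
    then show ?thesis using N_ideal by (simp add: alg_ideal_zero)
  next
    case False
    define l where "l = (LEAST n. \<exists>x \<in> set xs. length (snd x) = n)"
    have "\<exists>x \<in> set xs. length (snd x) = l" unfolding l_def
      by (rule LeastI_ex) (use False in \<open>auto simp: neq_Nil_conv\<close>)
    then obtain k0 \<alpha> where \<alpha>: "(k0, \<alpha>) \<in> set xs" "length \<alpha> = l" by force
    have min: "length \<alpha> \<le> length \<beta>" if "(k, \<beta>) \<in> set xs" for k \<beta>
      unfolding \<alpha> l_def by (rule Least_le) (use that in force)
    obtain u where u: "awalk u \<alpha> v" using less.prems \<alpha>(1) by (auto simp: paths_to_def)
    define A where "A = filter (\<lambda>x. snd x = \<alpha>) xs"
    define B where "B = filter (\<lambda>x. snd x \<noteq> \<alpha>) xs"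
    define k where "k = sum_list (map fst A)"
    have AB: "psum v xs = sc k * (pe \<alpha> * vt v) + psum v B"
      unfolding k_def A_def B_def
      by (subst psum_partition[of _ _ "\<lambda>x. snd x = \<alpha>"], subst psum_const[of _ \<alpha>]) auto
    show ?thesis
    proof (cases "k = 0")
      case True
      have "length B < length xs" unfolding B_def by (rule length_filter_less[OF \<alpha>(1)]) simp
      moreover have "paths_to v B" using less.prems by (auto simp: paths_to_def B_def)
      ultimately show ?thesis using less.hyps[of B] by (simp add: AB True)
    next
      case False
      have "\<forall>(k, \<beta>) \<in> set B. (\<exists>u. awalk u \<beta> v) \<and> \<beta> \<noteq> \<alpha> \<and> length \<alpha> \<le> length \<beta>"
        using less.prems min by (auto simp: B_def paths_to_def)
      from strip_prefix[OF u this] obtain ys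
        where ys: "loops_at v ys" "vt v * pg \<alpha> * psum v B \<simeq>\<^bsub>N\<^esub> psum v ys" by blast
      have "vt v * pg \<alpha> * psum v xs = sc k * (vt v * pg \<alpha> * (pe \<alpha> * vt v)) + vt v * pg \<alpha> * psum v B"
        by (simp add: AB distrib_left sc_left)
      also have "\<dots> \<simeq>\<^bsub>N\<^esub> sc k * vt v + psum v ys"
        by (intro Nadd Nlmult pg_pe_same[OF u] ys)
      finally have "vt v * pg \<alpha> * psum v xs \<simeq>\<^bsub>N\<^esub> vertex_plus_loops v k ys" by (simp add: vertex_plus_loops_def)
      with False ys(1) show ?thesis by blast
    qed
  qed
qed

text \<open>
  The closed paths \<open>\<delta>\<close> with \<open>\<gamma> \<tau> = \<tau> \<delta>\<close>, that is, the nonzero products \<open>\<tau>\<^sup>* \<gamma> \<tau>\<close>. A path \<open>\<gamma>\<close> without such a \<open>\<delta>\<close>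
  disappears, which is what shortens the list.
\<close>

definition conj_loops :: "'e list \<Rightarrow> ('k \<times> 'e list) list \<Rightarrow> ('k \<times> 'e list) list" where
  "conj_loops \<tau> ys = map (\<lambda>(k, \<gamma>). (k, drop (length \<tau>) (\<gamma> @ \<tau>)))
     (filter (\<lambda>(k, \<gamma>). prefix \<tau> (\<gamma> @ \<tau>)) ys)"

lemma loops_at_conj:
  assumes "awalk w \<tau> v" "loops_at w ys"
  shows "loops_at v (conj_loops \<tau> ys)"
  unfolding loops_at_def
proof clarify
  fix k \<delta> assume "(k, \<delta>) \<in> set (conj_loops \<tau> ys)"
  then obtain \<gamma> where \<gamma>: "(k, \<gamma>) \<in> set ys" "prefix \<tau> (\<gamma> @ \<tau>)" "\<delta> = drop (length \<tau>) (\<gamma> @ \<tau>)"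
    by (auto simp: conj_loops_def)
  then have eq: "\<gamma> @ \<tau> = \<tau> @ \<delta>" by (metis append_eq_conv_conj prefix_def)
  have ne: "\<gamma> \<noteq> []" "awalk w \<gamma> w" using \<gamma>(1) assms(2) by (auto simp: loops_at_def)
  have "awalk w (\<tau> @ \<delta>) v" using ne(2) assms(1) eq[symmetric] awalk_append by metis
  then have "awalk v \<delta> v" using awalk_suffix assms(1) by blast
  moreover have "length \<delta> = length \<gamma>" using arg_cong[OF eq, of length] by simp
  ultimately show "\<delta> \<noteq> [] \<and> awalk v \<delta> v" using ne(1) by auto
qed

lemma conj_psum:
  assumes "awalk w \<tau> v" "loops_at w ys"
  shows "vt v * pg \<tau> * psum w ys * (pe \<tau> * vt v) \<simeq>\<^bsub>N\<^esub> psum v (conj_loops \<tau> ys)"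
  using assms(2)
proof (induction ys)
  case Nil
  then show ?case by (simp add: conj_loops_def Nrefl)
next
  case (Cons y ys)
  obtain k \<gamma> where y: "y = (k, \<gamma>)" by force
  have \<gamma>: "awalk w \<gamma> w" and ys: "loops_at w ys" using Cons.prems by (auto simp: loops_at_def y)
  have \<gamma>\<tau>: "awalk w (\<gamma> @ \<tau>) v" using \<gamma> assms(1) awalk_append by blast
  have "vt v * pg \<tau> * psum w (y # ys) * (pe \<tau> * vt v)
      = sc k * (vt v * pg \<tau> * (pe \<gamma> * vt w * (pe \<tau> * vt v))) + vt v * pg \<tau> * psum w ys * (pe \<tau> * vt v)"
    by (simp add: y distrib_left distrib_right sc_left mult.assoc)
  also have "\<dots> \<simeq>\<^bsub>N\<^esub> sc k * (vt v * pg \<tau> * (pe (\<gamma> @ \<tau>) * vt v)) + psum v (conj_loops \<tau> ys)"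
    by (intro Nadd Nlmult pe_vt_pe assms(1) Cons.IH ys)
  also have "\<dots> \<simeq>\<^bsub>N\<^esub> sc k * (if prefix \<tau> (\<gamma> @ \<tau>) \<and> w = w then pe (drop (length \<tau>) (\<gamma> @ \<tau>)) * vt v else 0)
       + psum v (conj_loops \<tau> ys)"
    by (intro Nadd Nlmult pg_pe[OF assms(1) \<gamma>\<tau>] Nrefl) simp
  also have "\<dots> = psum v (conj_loops \<tau> (y # ys))"
    by (auto simp: conj_loops_def y simp del: drop_append pe_simps(3))
  finally show ?case .
qed

lemma conj_vertex_plus_loops:
  assumes "awalk w \<tau> v" "loops_at w ys"
  shows "vt v * pg \<tau> * vertex_plus_loops w k ys * (pe \<tau> * vt v) \<simeq>\<^bsub>N\<^esub> vertex_plus_loops v k (conj_loops \<tau> ys)"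
proof -
  have "vt v * pg \<tau> * vertex_plus_loops w k ys * (pe \<tau> * vt v)
      = sc k * (vt v * pg \<tau> * (vt w * (pe \<tau> * vt v))) + vt v * pg \<tau> * psum w ys * (pe \<tau> * vt v)"
    by (simp add: vertex_plus_loops_def distrib_left distrib_right sc_left mult.assoc)
  also have "\<dots> \<simeq>\<^bsub>N\<^esub> sc k * (vt v * pg \<tau> * (pe \<tau> * vt v)) + psum v (conj_loops \<tau> ys)"
    by (intro Nadd Nlmult vt_pe conj_psum assms)
  also have "\<dots> \<simeq>\<^bsub>N\<^esub> sc k * vt v + psum v (conj_loops \<tau> ys)"
    by (intro Nadd Nlmult pg_pe_same[OF assms(1)] Nrefl)
  finally show ?thesis by (simp add: vertex_plus_loops_def)
qed

section \<open>Elimination of ghost edges\<close>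

inductive_set gspan :: "nat \<Rightarrow> 'a set" for n where
  base: "x \<in> N \<Longrightarrow> x \<in> gspan n"
| step: "x \<in> gspan n \<Longrightarrow> awalk u \<alpha> v \<Longrightarrow> awalk w \<beta> v \<Longrightarrow> length \<beta> \<le> n \<Longrightarrow>
    sc k * (pe \<alpha> * vt v * pg \<beta>) + x \<in> gspan n"

lemma gspan_add: "x \<in> gspan n \<Longrightarrow> y \<in> gspan n \<Longrightarrow> x + y \<in> gspan n"
proof (induction x rule: gspan.induct)
  case (base x)
  from base(2,1) show ?case
  proof (induction y rule: gspan.induct)
    case (base y)
    then show ?case using N_ideal by (intro gspan.base alg_ideal_add)
  next
    case (step y u \<alpha> v w \<beta> k)
    then show ?case using gspan.step[of "x + y" n u \<alpha> v w \<beta> k] by (simp add: add.left_commute)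
  qed
next
  case (step x u \<alpha> v w \<beta> k)
  then show ?case using gspan.step[of "x + y" n u \<alpha> v w \<beta> k] by (simp add: add.assoc)
qed

lemma gspan_cg: "x \<simeq>\<^bsub>N\<^esub> y \<Longrightarrow> y \<in> gspan n \<Longrightarrow> x \<in> gspan n"
  using gspan_add[of "x - y" n y] gspan.base by (simp add: cg_def)

lemma gspan_monomial:
  assumes "awalk u \<alpha> v" "awalk w \<beta> v" "length \<beta> \<le> n"
  shows "pe \<alpha> * vt v * pg \<beta> \<in> gspan n"
  using gspan.step[OF gspan.base[OF alg_ideal_zero[OF N_ideal]] assms, of 1] by (simp add: sc_one)

lemma gspan_zero: "0 \<in> gspan n"
  using gspan.base alg_ideal_zero[OF N_ideal] by blast

lemma gspan_scale: "x \<in> gspan n \<Longrightarrow> sc c * x \<in> gspan n"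
proof (induction rule: gspan.induct)
  case (base x)
  then show ?case using N_ideal by (intro gspan.base alg_ideal_lmult)
next
  case (step x u \<alpha> v w \<beta> k)
  then show ?case using gspan.step[of "sc c * x" n u \<alpha> v w \<beta> "c * k"]
    by (simp add: distrib_left sc_mult mult.assoc)
qed

lemma gspan_mono: "x \<in> gspan n \<Longrightarrow> n \<le> m \<Longrightarrow> x \<in> gspan m"
  by (induction rule: gspan.induct) (auto intro: gspan.intros)

lemma gspan_rmult:
  assumes "x \<in> gspan n"
    and "\<And>u \<alpha> v w \<beta>. awalk u \<alpha> v \<Longrightarrow> awalk w \<beta> v \<Longrightarrow> length \<beta> \<le> n \<Longrightarrow> pe \<alpha> * vt v * pg \<beta> * y \<in> gspan m"
  shows "x * y \<in> gspan m"
  using assms(1)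
proof (induction rule: gspan.induct)
  case (base x)
  then show ?case using N_ideal by (intro gspan.base alg_ideal_rmult)
next
  case (step x u \<alpha> v w \<beta> k)
  have "sc k * (pe \<alpha> * vt v * pg \<beta> * y) + x * y \<in> gspan m"
    by (intro gspan_add gspan_scale assms(2)[OF step(2,3,4)] step.IH)
  then show ?case by (simp add: distrib_right mult.assoc)
qed

lemma monomial_vt:
  assumes "awalk w \<beta> v" "x \<in> verts E"
  shows "vt v * pg \<beta> * vt x \<simeq>\<^bsub>N\<^esub> (if w = x then vt v * pg \<beta> else 0)"
proof -
  have "vt v * pg \<beta> * vt x \<simeq>\<^bsub>N\<^esub> vt v * pg \<beta> * vt w * vt x"
    by (rule Nrmult, rule Nsym, rule pg_vt[OF assms(1)])
  also have "vt v * pg \<beta> * vt w * vt x = vt v * pg \<beta> * (vt w * vt x)" by (simp add: mult.assoc)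
  also have "\<dots> \<simeq>\<^bsub>N\<^esub> vt v * pg \<beta> * (if w = x then vt w else 0)"
    by (intro Nlmult vt_vt awalk_verts_ends[OF assms(1)] assms)
  also have "\<dots> \<simeq>\<^bsub>N\<^esub> (if w = x then vt v * pg \<beta> else 0)"
    using pg_vt[OF assms(1)] Nrefl by auto
  finally show ?thesis .
qed

lemma gspan_vt:
  assumes "x \<in> gspan n" "y \<in> verts E" shows "x * vt y \<in> gspan n"
proof (rule gspan_rmult[OF assms(1)])
  fix u \<alpha> v w \<beta> assume *: "awalk u \<alpha> v" "awalk w \<beta> v" "length \<beta> \<le> n"
  have "pe \<alpha> * (vt v * pg \<beta> * vt y) \<simeq>\<^bsub>N\<^esub> pe \<alpha> * (if w = y then vt v * pg \<beta> else 0)"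
    by (intro Nlmult monomial_vt *(2) assms)
  moreover have "pe \<alpha> * (if w = y then vt v * pg \<beta> else 0) \<in> gspan n"
    using gspan_monomial[OF *] gspan_zero by (simp add: mult.assoc)
  ultimately show "pe \<alpha> * vt v * pg \<beta> * vt y \<in> gspan n" using gspan_cg by (simp add: mult.assoc)
qed

lemma vt_ed_if:
  assumes "v \<in> verts E" "e \<in> arcs E"
  shows "vt v * ed e \<simeq>\<^bsub>N\<^esub> (if tail E e = v then ed e * vt (head E e) else 0)"
proof -
  have "vt v * ed e \<simeq>\<^bsub>N\<^esub> vt v * (vt (tail E e) * ed e)"
    by (rule Nlmult, rule Nsym, rule vt_ed[OF assms(2)])
  also have "vt v * (vt (tail E e) * ed e) = vt v * vt (tail E e) * ed e" by (simp add: mult.assoc)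
  also have "\<dots> \<simeq>\<^bsub>N\<^esub> (if v = tail E e then vt v else 0) * ed e"
    by (intro Nrmult vt_vt assms tail_in_verts)
  also have "\<dots> \<simeq>\<^bsub>N\<^esub> (if tail E e = v then ed e * vt (head E e) else 0)"
    using Ntrans[OF vt_ed[OF assms(2)] Nsym[OF ed_vt[OF assms(2)]]] Nrefl by auto
  finally show ?thesis .
qed

text \<open>
  An edge on the right cancels the first edge of \<open>\<beta>\<close>, lowering the ghost length. If \<open>\<beta>\<close> is empty, the edge is
  appended to the real path instead, which is why the truncated bound \<open>n - 1\<close> is right for \<open>n = 0\<close> too.
\<close>

lemma gspan_ed:
  assumes "x \<in> gspan n" "e \<in> arcs E" shows "x * ed e \<in> gspan (n - 1)"
proof (rule gspan_rmult[OF assms(1)])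
  fix u \<alpha> v w \<beta> assume *: "awalk u \<alpha> v" "awalk w \<beta> v" "length \<beta> \<le> n"
  show "pe \<alpha> * vt v * pg \<beta> * ed e \<in> gspan (n - 1)"
  proof (cases \<beta>)
    case Nil
    have "pe \<alpha> * (vt v * ed e) \<simeq>\<^bsub>N\<^esub> pe \<alpha> * (if tail E e = v then ed e * vt (head E e) else 0)"
      by (intro Nlmult vt_ed_if assms awalk_verts_ends(2)[OF *(1)])
    moreover have "pe \<alpha> * (if tail E e = v then ed e * vt (head E e) else 0) \<in> gspan (n - 1)"
    proof (cases "tail E e = v")
      case True
      have "awalk u (\<alpha> @ [e]) (head E e)" "awalk (head E e) [] (head E e)"
        using * assms True unfolding awalk_append by (auto simp: awalk_Cons_iff awalk_Nil_iff)
      from gspan_monomial[OF this] show ?thesis using True by (simp add: mult.assoc)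
    qed (simp add: gspan_zero)
    ultimately show ?thesis using gspan_cg Nil by (simp add: mult.assoc)
  next
    case (Cons f \<gamma>)
    have f: "f \<in> arcs E" "awalk (head E f) \<gamma> v" using * by (auto simp: Cons awalk_Cons_iff)
    have "pe \<alpha> * (vt v * pg \<gamma> * (gh f * ed e)) \<simeq>\<^bsub>N\<^esub> pe \<alpha> * (vt v * pg \<gamma> * (if f = e then vt (head E f) else 0))"
      by (intro Nlmult gh_ed assms f)
    also have "\<dots> \<simeq>\<^bsub>N\<^esub> pe \<alpha> * (if f = e then vt v * pg \<gamma> else 0)"
      using pg_vt[OF f(2)] by (intro Nlmult) (auto simp: Nrefl)
    finally have 1: "pe \<alpha> * vt v * pg \<beta> * ed e \<simeq>\<^bsub>N\<^esub> pe \<alpha> * (if f = e then vt v * pg \<gamma> else 0)"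
      by (simp add: Cons mult.assoc)
    have "pe \<alpha> * vt v * pg \<gamma> \<in> gspan (n - 1)"
      by (rule gspan_monomial[OF *(1) f(2)]) (use *(3) in \<open>simp add: Cons\<close>)
    then have "pe \<alpha> * (if f = e then vt v * pg \<gamma> else 0) \<in> gspan (n - 1)"
      by (simp add: mult.assoc gspan_zero)
    with 1 show ?thesis using gspan_cg by blast
  qed
qed

lemma gspan_gh:
  assumes "x \<in> gspan n" "e \<in> arcs E" shows "x * gh e \<in> gspan (Suc n)"
proof (rule gspan_rmult[OF assms(1)])
  fix u \<alpha> v w \<beta> assume *: "awalk u \<alpha> v" "awalk w \<beta> v" "length \<beta> \<le> n"
  have "pe \<alpha> * (vt v * pg \<beta> * gh e) \<simeq>\<^bsub>N\<^esub> pe \<alpha> * (vt v * pg \<beta> * (vt (head E e) * gh e))"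
    by (rule Nlmult, rule Nlmult, rule Nsym, rule vt_gh[OF assms(2)])
  also have "\<dots> = pe \<alpha> * (vt v * pg \<beta> * vt (head E e)) * gh e" by (simp add: mult.assoc)
  also have "\<dots> \<simeq>\<^bsub>N\<^esub> pe \<alpha> * (if w = head E e then vt v * pg \<beta> else 0) * gh e"
    by (intro Nlmult Nrmult monomial_vt *(2) head_in_verts assms)
  finally have 1: "pe \<alpha> * vt v * pg \<beta> * gh e \<simeq>\<^bsub>N\<^esub> pe \<alpha> * (if w = head E e then vt v * pg \<beta> else 0) * gh e"
    by (simp add: mult.assoc)
  have "pe \<alpha> * (if w = head E e then vt v * pg \<beta> else 0) * gh e \<in> gspan (Suc n)"
  proof (cases "w = head E e")
    case True
    then have "awalk (tail E e) (e # \<beta>) v" using * assms by (simp add: awalk_Cons_iff)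
    from gspan_monomial[OF *(1) this] *(3) True show ?thesis by (simp add: mult.assoc)
  qed (simp add: gspan_zero)
  with 1 show "pe \<alpha> * vt v * pg \<beta> * gh e \<in> gspan (Suc n)" using gspan_cg by blast
qed

text \<open>
  The letters of a word are multiplied on from the left to the right; each of them keeps the span of
  monomials \<open>\<alpha> \<beta>\<^sup>*\<close> stable, at the cost of a larger bound on the ghost length.
\<close>

lemma word_in_gspan:
  assumes "w \<noteq> []" "set w \<subseteq> lpa_gens E"
  shows "\<exists>n. prod_list (map (case_lpa_gen vt ed gh) w) \<in> gspan n"
  using assms
proof (induction w rule: rev_nonempty_induct)
  case (single g)
  then consider v where "g = Vert v" "v \<in> verts E" | e where "g = Edge e" "e \<in> arcs E"
    | e where "g = Ghost e" "e \<in> arcs E"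
    by (auto simp: lpa_gens_def)
  then show ?case
  proof cases
    case 1
    then show ?thesis using gspan_monomial[of v "[]" v v "[]" 0] by (auto simp: awalk_Nil_iff)
  next
    case 2
    then have "pe [e] * vt (head E e) * pg [] \<in> gspan 0"
      by (intro gspan_monomial) (auto simp: awalk_Nil_iff awalk_Cons_iff)
    then show ?thesis using gspan_cg[OF Nsym[OF ed_vt]] 2 by auto
  next
    case 3
    then have "pe [] * vt (head E e) * pg [e] \<in> gspan 1"
      by (intro gspan_monomial[of "head E e" _ _ "tail E e"]) (auto simp: awalk_Nil_iff awalk_Cons_iff)
    then show ?thesis using gspan_cg[OF Nsym[OF vt_gh]] 3 by auto
  qed
next
  case (snoc g w)
  then obtain n where n: "prod_list (map (case_lpa_gen vt ed gh) w) \<in> gspan n" by auto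
  from snoc consider v where "g = Vert v" "v \<in> verts E" | e where "g = Edge e" "e \<in> arcs E"
    | e where "g = Ghost e" "e \<in> arcs E"
    by (auto simp: lpa_gens_def)
  then show ?case
    by cases (use gspan_vt[OF n] gspan_ed[OF n] gspan_gh[OF n] in auto)
qed

lemma M_gspan:
  assumes "x \<in> M" shows "\<exists>n. x \<in> gspan n"
proof -
  obtain ls where ls: "\<forall>(k, w) \<in> set ls. w \<noteq> [] \<and> set w \<subseteq> lpa_gens E"
    "x \<simeq>\<^bsub>N\<^esub> (\<Sum>(k, w)\<leftarrow>ls. sc k * prod_list (map (case_lpa_gen vt ed gh) w))"
    using M_span[OF assms] by blast
  from ls(1) have "\<exists>n. (\<Sum>(k, w)\<leftarrow>ls. sc k * prod_list (map (case_lpa_gen vt ed gh) w)) \<in> gspan n"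
  proof (induction ls)
    case (Cons l ls)
    obtain k w where l: "l = (k, w)" by force
    obtain n where n: "(\<Sum>(k, w)\<leftarrow>ls. sc k * prod_list (map (case_lpa_gen vt ed gh) w)) \<in> gspan n"
      using Cons by auto
    obtain m where m: "prod_list (map (case_lpa_gen vt ed gh) w) \<in> gspan m"
      using word_in_gspan[of w] Cons.prems l by auto
    have "sc k * prod_list (map (case_lpa_gen vt ed gh) w) \<in> gspan (max m n)"
      by (rule gspan_scale, rule gspan_mono[OF m]) simp
    from gspan_add[OF this gspan_mono[OF n, of "max m n"]] show ?case by (auto simp: l)
  qed (use gspan_zero in auto)
  then show ?thesis using gspan_cg ls(2) by blast
qed

end

context lpa_presentation begin

text \<open>
  The sum of the vertices at which the ghost paths of \<open>x\<close> start acts as a right unit. Admitting all larger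
  sets \<open>V\<close> lets the induction treat two summands at once.
\<close>

lemma gspan_local_unit:
  assumes "x \<in> gspan n"
  shows "\<exists>V0. finite V0 \<and> V0 \<subseteq> verts E \<and>
    (\<forall>V. finite V \<longrightarrow> V0 \<subseteq> V \<longrightarrow> V \<subseteq> verts E \<longrightarrow> x * sum vt V \<simeq>\<^bsub>N\<^esub> x)"
  using assms
proof (induction rule: gspan.induct)
  case (base x)
  then have "x * sum vt V \<simeq>\<^bsub>N\<^esub> x" for V
    unfolding cg_def using N_ideal by (intro alg_ideal_diff alg_ideal_rmult)
  then show ?case by (intro exI[of _ "{}"]) simp
next
  case (step x u \<alpha> v w \<beta> k)
  obtain V0 where V0: "finite V0" "V0 \<subseteq> verts E"
    "\<And>V. finite V \<Longrightarrow> V0 \<subseteq> V \<Longrightarrow> V \<subseteq> verts E \<Longrightarrow> x * sum vt V \<simeq>\<^bsub>N\<^esub> x" using step.IH by blast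
  have "(sc k * (pe \<alpha> * vt v * pg \<beta>) + x) * sum vt V \<simeq>\<^bsub>N\<^esub> sc k * (pe \<alpha> * vt v * pg \<beta>) + x"
    if V: "finite V" "insert w V0 \<subseteq> V" "V \<subseteq> verts E" for V
  proof -
    have "vt v * pg \<beta> * sum vt V = (\<Sum>y\<in>V. vt v * pg \<beta> * vt y)" by (simp add: sum_distrib_left)
    also have "\<dots> \<simeq>\<^bsub>N\<^esub> (\<Sum>y\<in>V. if w = y then vt v * pg \<beta> else 0)"
      using V by (intro Nsum monomial_vt step.hyps) auto
    also have "\<dots> = vt v * pg \<beta>" using V by simp
    finally have 1: "vt v * pg \<beta> * sum vt V \<simeq>\<^bsub>N\<^esub> vt v * pg \<beta>" .
    have "(sc k * (pe \<alpha> * vt v * pg \<beta>) + x) * sum vt V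
        = sc k * (pe \<alpha> * (vt v * pg \<beta> * sum vt V)) + x * sum vt V"
      by (simp add: distrib_right mult.assoc)
    also have "\<dots> \<simeq>\<^bsub>N\<^esub> sc k * (pe \<alpha> * (vt v * pg \<beta>)) + x"
      using V by (intro Nadd Nlmult 1 V0(3)) auto
    finally show ?thesis by (simp add: mult.assoc)
  qed
  then show ?case using V0 awalk_verts_ends[OF step(3)] by (intro exI[of _ "insert w V0"]) auto
qed

lemma gspan_0_vt:
  assumes "x \<in> gspan 0" "y \<in> verts E"
  shows "\<exists>xs. paths_to y xs \<and> x * vt y \<simeq>\<^bsub>N\<^esub> psum y xs"
  using assms(1)
proof (induction rule: gspan.induct)
  case (base x)
  then have "x * vt y \<simeq>\<^bsub>N\<^esub> psum y []" by (simp add: cg_zero alg_ideal_rmult[OF N_ideal])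
  then show ?case by (intro exI[of _ "[]"]) (simp add: paths_to_def)
next
  case (step x u \<alpha> v w \<beta> k)
  obtain xs where xs: "paths_to y xs" "x * vt y \<simeq>\<^bsub>N\<^esub> psum y xs" using step.IH by blast
  have [simp]: "\<beta> = []" using step by simp
  have "(sc k * (pe \<alpha> * vt v * pg \<beta>) + x) * vt y = sc k * (pe \<alpha> * (vt v * vt y)) + x * vt y"
    by (simp add: distrib_right mult.assoc)
  also have "\<dots> \<simeq>\<^bsub>N\<^esub> sc k * (pe \<alpha> * (if v = y then vt v else 0)) + psum y xs"
    using awalk_verts_ends[OF step(2)] assms by (intro Nadd Nlmult vt_vt xs)
  also have "\<dots> = psum y ((if v = y then [(k, \<alpha>)] else []) @ xs)" by simp
  finally show ?case
    using xs step(2) by (intro exI[of _ "(if v = y then [(k, \<alpha>)] else []) @ xs"]) (auto simp: paths_to_def)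
qed

text \<open>
  Modulo \<open>N\<close> an idempotent. It measures how far the edges in \<open>F\<close> are from exhausting \<open>v\<close>. It kills every edge
  of \<open>F\<close> from the left and every ghost of such an edge from the right.
\<close>

definition defect :: "'v \<Rightarrow> 'e set \<Rightarrow> 'a" where
  "defect v F = vt v - (\<Sum>e\<in>F. ed e * gh e)"

context
  fixes v F
  assumes v: "v \<in> verts E" and F: "finite F" "F \<subseteq> out_arcs E v"
begin

lemma vt_defect:
  assumes "y \<in> verts E"
  shows "vt y * defect v F \<simeq>\<^bsub>N\<^esub> (if y = v then defect v F else 0)"
proof -
  have "vt y * defect v F = vt y * vt v - (\<Sum>e\<in>F. vt y * ed e * gh e)"
    by (simp add: defect_def right_diff_distrib sum_distrib_left mult.assoc)
  also have "\<dots> \<simeq>\<^bsub>N\<^esub> (if y = v then vt y else 0) - (\<Sum>e\<in>F. (if y = v then ed e else 0) * gh e)"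
  proof (intro Ndiff Nsum vt_vt assms v Nrmult)
    fix e assume "e \<in> F"
    then have e: "e \<in> arcs E" "tail E e = v" using F by auto
    then show "vt y * ed e \<simeq>\<^bsub>N\<^esub> (if y = v then ed e else 0)"
      using vt_ed_if[OF assms e(1)] vt_ed[OF e(1)] by auto
  qed
  also have "\<dots> = (if y = v then defect v F else 0)" by (simp add: defect_def)
  finally show ?thesis .
qed

lemma gh_defect:
  assumes "e \<in> arcs E" "tail E e \<noteq> v \<or> e \<in> F"
  shows "gh e * defect v F \<simeq>\<^bsub>N\<^esub> 0"
proof (cases "e \<in> F")
  case True
  then have tl: "tail E e = v" using F by auto
  have "gh e * defect v F = gh e * vt v - (\<Sum>f\<in>F. gh e * ed f * gh f)"
    by (simp add: defect_def right_diff_distrib sum_distrib_left mult.assoc)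
  also have "\<dots> \<simeq>\<^bsub>N\<^esub> gh e - (\<Sum>f\<in>F. (if e = f then vt (head E e) else 0) * gh f)"
    using gh_vt[OF assms(1)] tl F by (intro Ndiff Nsum Nrmult gh_ed assms) auto
  also have "(\<Sum>f\<in>F. (if e = f then vt (head E e) else 0) * gh f) = vt (head E e) * gh e"
  proof -
    have "(\<Sum>f\<in>F. (if e = f then vt (head E e) else 0) * gh f) = (\<Sum>f\<in>F. if e = f then vt (head E e) * gh f else 0)"
      by (rule sum.cong) auto
    then show ?thesis using True F(1) by simp
  qed
  also have "gh e - vt (head E e) * gh e \<simeq>\<^bsub>N\<^esub> gh e - gh e"
    by (intro Ndiff Nrefl vt_gh assms)
  finally show ?thesis by simp
next
  case False
  then have tl: "tail E e \<noteq> v" using assms by blast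
  have "gh e * defect v F \<simeq>\<^bsub>N\<^esub> gh e * vt (tail E e) * defect v F"
    by (rule Nrmult, rule Nsym, rule gh_vt, fact)
  also have "gh e * vt (tail E e) * defect v F = gh e * (vt (tail E e) * defect v F)" by (simp add: mult.assoc)
  also have "\<dots> \<simeq>\<^bsub>N\<^esub> gh e * 0"
    using Nlmult[OF vt_defect[of "tail E e"]] tl assms(1) by simp
  finally show ?thesis by simp
qed

lemma defect_vt: "defect v F * vt v \<simeq>\<^bsub>N\<^esub> defect v F"
proof -
  have "defect v F * vt v = vt v * vt v - (\<Sum>e\<in>F. ed e * (gh e * vt v))"
    by (simp add: defect_def left_diff_distrib sum_distrib_right mult.assoc)
  also have "\<dots> \<simeq>\<^bsub>N\<^esub> vt v - (\<Sum>e\<in>F. ed e * gh e)"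
  proof (intro Ndiff Nsum Nlmult vt_idem v)
    fix e assume "e \<in> F"
    then have "e \<in> arcs E" "tail E e = v" using F by auto
    then show "gh e * vt v \<simeq>\<^bsub>N\<^esub> gh e" using gh_vt by metis
  qed
  finally show ?thesis by (simp add: defect_def)
qed

lemma defect_ed:
  assumes "e \<in> F"
  shows "defect v F * ed e \<simeq>\<^bsub>N\<^esub> 0"
proof -
  have e: "e \<in> arcs E" "tail E e = v" using assms F by auto
  have "defect v F * ed e = vt v * ed e - (\<Sum>f\<in>F. ed f * (gh f * ed e))"
    by (simp add: defect_def left_diff_distrib sum_distrib_right mult.assoc)
  also have "\<dots> \<simeq>\<^bsub>N\<^esub> ed e - (\<Sum>f\<in>F. ed f * (if f = e then vt (head E f) else 0))"
    using vt_ed[OF e(1)] e(2) F by (intro Ndiff Nsum Nlmult gh_ed e) auto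
  also have "(\<Sum>f\<in>F. ed f * (if f = e then vt (head E f) else 0)) = (\<Sum>f\<in>F. if f = e then ed f * vt (head E f) else 0)"
    by (rule sum.cong) auto
  also have "\<dots> = ed e * vt (head E e)" using assms F(1) by simp
  also have "ed e - ed e * vt (head E e) \<simeq>\<^bsub>N\<^esub> ed e - ed e" by (intro Ndiff Nrefl ed_vt e)
  finally show ?thesis by simp
qed

lemma defect_idem: "defect v F * defect v F \<simeq>\<^bsub>N\<^esub> defect v F"
proof -
  have "defect v F * defect v F = defect v F * vt v - (\<Sum>e\<in>F. defect v F * ed e * gh e)"
    by (subst (2) defect_def) (simp add: right_diff_distrib sum_distrib_left mult.assoc)
  also have "\<dots> \<simeq>\<^bsub>N\<^esub> defect v F - (\<Sum>e\<in>F. 0 * gh e)"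
    by (intro Ndiff Nsum Nrmult defect_vt defect_ed)
  finally show ?thesis by simp
qed

lemma defect_vertex_plus_loops:
  assumes "loops_at v ys" "\<forall>(k, \<gamma>) \<in> set ys. hd \<gamma> \<in> F"
  shows "defect v F * vertex_plus_loops v k ys \<simeq>\<^bsub>N\<^esub> sc k * defect v F"
proof -
  have "defect v F * psum v ys \<simeq>\<^bsub>N\<^esub> 0"
    using assms
  proof (induction ys)
    case (Cons y ys)
    obtain l \<gamma> where y: "y = (l, \<gamma>)" by force
    then obtain e \<delta> where \<gamma>: "\<gamma> = e # \<delta>" "e \<in> F"
      using Cons.prems by (cases \<gamma>) (auto simp: loops_at_def)
    have "defect v F * psum v (y # ys) = sc l * ((defect v F * ed e) * (pe \<delta> * vt v)) + defect v F * psum v ys"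
      by (simp add: y \<gamma> distrib_left sc_left mult.assoc)
    also have "\<dots> \<simeq>\<^bsub>N\<^esub> sc l * (0 * (pe \<delta> * vt v)) + 0"
      using Cons by (intro Nadd Nlmult Nrmult defect_ed \<gamma>) (auto simp: loops_at_def)
    finally show ?case by simp
  qed (simp add: Nrefl)
  then have "sc k * (defect v F * vt v) + defect v F * psum v ys \<simeq>\<^bsub>N\<^esub> sc k * defect v F + 0"
    by (intro Nadd Nlmult defect_vt)
  then show ?thesis by (simp add: vertex_plus_loops_def distrib_left sc_left)
qed

end

text \<open>
  Once \<open>F\<close> contains the first edges of all ghost paths of \<open>x\<close> that start at \<open>y\<close>, multiplying by the defect
  removes all monomials with a nontrivial ghost part.
\<close>

lemma gspan_defect:
  assumes "x \<in> gspan n" "y \<in> verts E"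
  shows "\<exists>xs F0. paths_to y xs \<and> finite F0 \<and> F0 \<subseteq> out_arcs E y \<and>
    (\<forall>F. finite F \<longrightarrow> F0 \<subseteq> F \<longrightarrow> F \<subseteq> out_arcs E y \<longrightarrow>
      x * defect y F \<simeq>\<^bsub>N\<^esub> psum y xs * defect y F)"
  using assms(1)
proof (induction rule: gspan.induct)
  case (base x)
  then have "x * defect y F \<simeq>\<^bsub>N\<^esub> psum y [] * defect y F" for F
    by (simp add: cg_zero alg_ideal_rmult[OF N_ideal])
  then show ?case by (intro exI[of _ "[]"] exI[of _ "{}"]) (simp add: paths_to_def)
next
  case (step x u \<alpha> v w \<beta> k)
  obtain xs F0 where xs: "paths_to y xs" and F0: "finite F0" "F0 \<subseteq> out_arcs E y"
    and IH: "\<And>F. finite F \<Longrightarrow> F0 \<subseteq> F \<Longrightarrow> F \<subseteq> out_arcs E y \<Longrightarrow>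
      x * defect y F \<simeq>\<^bsub>N\<^esub> psum y xs * defect y F" using step.IH by blast
  define zs where "zs = (if \<beta> = [] \<and> v = y then [(k, \<alpha>)] else [])"
  define F1 where "F1 = (if \<beta> \<noteq> [] \<and> tail E (hd \<beta>) = y then {hd \<beta>} else {})"
  have zs: "paths_to y zs" using step(2) by (auto simp: zs_def paths_to_def)
  have F1: "finite F1" "F1 \<subseteq> out_arcs E y"
    using step(3) by (cases \<beta>; auto simp: F1_def awalk_Cons_iff)+
  have "sc k * (pe \<alpha> * vt v * pg \<beta>) * defect y F \<simeq>\<^bsub>N\<^esub> psum y zs * defect y F"
    if F: "finite F" "F1 \<subseteq> F" "F \<subseteq> out_arcs E y" for F
  proof (cases \<beta>)
    case Nil
    have 1: "sc k * (pe \<alpha> * (vt v * defect y F)) \<simeq>\<^bsub>N\<^esub> sc k * (pe \<alpha> * (if v = y then defect y F else 0))"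
      using awalk_verts_ends[OF step(2)] by (intro Nlmult vt_defect F assms)
    have 2: "sc k * (pe \<alpha> * (if v = y then defect y F else 0)) \<simeq>\<^bsub>N\<^esub> psum y zs * defect y F"
    proof (cases "v = y")
      case True
      have "sc k * (pe \<alpha> * defect y F) \<simeq>\<^bsub>N\<^esub> sc k * (pe \<alpha> * (vt y * defect y F))"
        by (rule Nlmult, rule Nlmult, rule Nsym) (use vt_defect[OF assms(2) F(1,3) assms(2)] in simp)
      then show ?thesis by (simp add: zs_def Nil True mult.assoc)
    qed (simp add: zs_def Nrefl)
    show ?thesis using Ntrans[OF 1 2] by (simp add: Nil mult.assoc)
  next
    case (Cons f \<gamma>)
    have "sc k * (pe \<alpha> * (vt v * (pg \<gamma> * (gh f * defect y F)))) \<simeq>\<^bsub>N\<^esub> sc k * (pe \<alpha> * (vt v * (pg \<gamma> * 0)))"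
      using step(3) F(2) by (intro Nlmult gh_defect F assms) (auto simp: Cons F1_def awalk_Cons_iff)
    then show ?thesis by (simp add: Cons zs_def mult.assoc)
  qed
  note 1 = this
  have "(sc k * (pe \<alpha> * vt v * pg \<beta>) + x) * defect y F \<simeq>\<^bsub>N\<^esub> psum y (zs @ xs) * defect y F"
    if F: "finite F" "F0 \<union> F1 \<subseteq> F" "F \<subseteq> out_arcs E y" for F
    using Nadd[OF 1 IH, of F F] F by (simp add: distrib_right)
  then show ?case using xs zs F0 F1
    by (intro exI[of _ "zs @ xs"] exI[of _ "F0 \<union> F1"]) (auto simp: paths_to_def)
qed

text \<open>
  Induction on the ghost length. If \<open>x e \<notin> Z\<close> for some edge \<open>e\<close> starting at a vertex \<open>v\<close> with \<open>x v \<notin> Z\<close>, then \<open>x e\<close> has a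
  shorter ghost part. If there is no such edge, then modulo \<open>Z\<close> the vertex \<open>v\<close> may be replaced by a defect \<open>u\<close>, for which
  \<open>x u\<close> agrees with \<open>p u\<close> for a combination \<open>p\<close> of real paths. Reducing \<open>p\<close> to \<open>k v + (closed paths)\<close> and
  enlarging \<open>F\<close> by the first edges of these closed paths turns \<open>p u \<in> P\<close> into \<open>k u \<in> P\<close>. Then
  \<open>p u = (p u) u\<close> is a product of two elements of \<open>P\<close> and lies in \<open>Z\<close>, a contradiction.
\<close>

lemma ghost_elimination:
  assumes Z: "alg_ideal Z" "N \<subseteq> Z" and P: "alg_ideal P" "Z \<subseteq> P"
    and sq: "\<And>x y. x \<in> P \<Longrightarrow> y \<in> P \<Longrightarrow> x * y \<in> Z"
    and x: "x \<in> gspan n" "x \<in> P" "x \<notin> Z"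
  shows "\<exists>a v xs. v \<in> verts E \<and> paths_to v xs \<and> x * a \<simeq>\<^bsub>N\<^esub> psum v xs \<and> x * a \<notin> Z"
  using x
proof (induction n arbitrary: x)
  have NZ: "p \<in> Z \<longleftrightarrow> q \<in> Z" if "p \<simeq>\<^bsub>N\<^esub> q" for p q
    using cg_mem[OF Z(1) cg_mono[OF Z(2) that]] .
  have NP: "p \<in> P \<longleftrightarrow> q \<in> P" if "p \<simeq>\<^bsub>N\<^esub> q" for p q
    using cg_mem[OF P(1) cg_mono[OF _ that]] Z(2) P(2) by blast
  have vertex: "\<exists>v \<in> verts E. x * vt v \<notin> Z" if x: "x \<in> gspan n" "x \<notin> Z" for x n
  proof (rule ccontr)
    assume *: "\<not> ?thesis"
    obtain V where V: "V \<subseteq> verts E" "x * sum vt V \<simeq>\<^bsub>N\<^esub> x" using gspan_local_unit[OF x(1)] by blast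
    have "x * sum vt V \<in> Z"
      unfolding sum_distrib_left using V * by (intro alg_ideal_sum Z) auto
    with NZ[OF V(2)] x(2) show False by blast
  qed
  {
    case 0
    obtain v where v: "v \<in> verts E" "x * vt v \<notin> Z" using vertex 0 by blast
    with gspan_0_vt[OF 0(1) v(1)] show ?case by blast
  next
    case (Suc n)
    obtain v where v: "v \<in> verts E" "x * vt v \<notin> Z" using vertex Suc.prems by blast
    show ?case
    proof (cases "\<exists>e \<in> out_arcs E v. x * ed e \<notin> Z")
      case True
      then obtain e where e: "e \<in> arcs E" "x * ed e \<notin> Z" by auto
      have "x * ed e \<in> gspan n" using gspan_ed[OF Suc.prems(1) e(1)] by simp
      moreover have "x * ed e \<in> P" using Suc.prems P alg_ideal_rmult by blast
      ultimately show ?thesis using Suc.IH[of "x * ed e"] e(2) by (auto simp: mult.assoc)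
    next
      case False
      obtain xs F0 where xs: "paths_to v xs" and F0: "finite F0" "F0 \<subseteq> out_arcs E v"
        and approx: "\<And>F. finite F \<Longrightarrow> F0 \<subseteq> F \<Longrightarrow> F \<subseteq> out_arcs E v \<Longrightarrow>
          x * defect v F \<simeq>\<^bsub>N\<^esub> psum v xs * defect v F"
        using gspan_defect[OF Suc.prems(1) v(1)] by blast
      have not_Z: "psum v xs * defect v F \<notin> Z" if F: "finite F" "F0 \<subseteq> F" "F \<subseteq> out_arcs E v" for F
      proof
        assume "psum v xs * defect v F \<in> Z"
        then have 1: "x * defect v F \<in> Z" using NZ[OF approx[OF F]] by blast
        have 2: "(\<Sum>e\<in>F. x * ed e * gh e) \<in> Z"
          by (rule alg_ideal_sum[OF Z(1)], rule alg_ideal_rmult[OF Z(1)]) (use False F in blast)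
        have "x * vt v = x * defect v F + (\<Sum>e\<in>F. x * ed e * gh e)"
          by (simp add: defect_def right_diff_distrib sum_distrib_left mult.assoc)
        with alg_ideal_add[OF Z(1) 1 2] v(2) show False by simp
      qed
      have "psum v xs \<notin> N"
        using not_Z[OF F0(1) order_refl F0(2)] Z alg_ideal_rmult by blast
      then obtain a k ys where k: "k \<noteq> 0" and ys: "loops_at v ys"
        and a: "a * psum v xs \<simeq>\<^bsub>N\<^esub> vertex_plus_loops v k ys"
        using psum_reduce[OF xs v(1)] by blast
      \<comment> \<open>Enlarging \<open>F0\<close> is harmless, since \<open>approx\<close> and \<open>not_Z\<close> hold for all larger sets.\<close>
      define F where "F = F0 \<union> (\<lambda>(k, \<gamma>). hd \<gamma>) ` set ys"
      have hd: "hd \<gamma> \<in> out_arcs E v" if "(l, \<gamma>) \<in> set ys" for l \<gamma>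
        using ys that by (cases \<gamma>) (auto simp: loops_at_def awalk_Cons_iff)
      then have F: "finite F" "F0 \<subseteq> F" "F \<subseteq> out_arcs E v" using F0 by (auto simp: F_def)
      have hdF: "\<forall>(k, \<gamma>) \<in> set ys. hd \<gamma> \<in> F" by (auto simp: F_def)
      let ?u = "defect v F"
      have pP: "psum v xs * ?u \<in> P"
        using NP[OF approx[OF F]] Suc.prems(2) P(1) alg_ideal_rmult by blast
      have "?u * (a * psum v xs) * ?u \<simeq>\<^bsub>N\<^esub> ?u * vertex_plus_loops v k ys * ?u"
        by (intro Nlmult Nrmult a)
      also have "\<dots> \<simeq>\<^bsub>N\<^esub> sc k * ?u * ?u"
        by (intro Nrmult defect_vertex_plus_loops v F ys hdF)
      also have "sc k * ?u * ?u = sc k * (?u * ?u)" by (simp add: mult.assoc)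
      also have "\<dots> \<simeq>\<^bsub>N\<^esub> sc k * ?u" by (intro Nlmult defect_idem v F)
      finally have "?u * (a * psum v xs) * ?u \<simeq>\<^bsub>N\<^esub> sc k * ?u" .
      moreover have "?u * (a * psum v xs) * ?u \<in> P"
        using alg_ideal_lmult[OF P(1) pP, of "?u * a"] by (simp add: mult.assoc)
      ultimately have "sc k * ?u \<in> P" using NP by blast
      then have "sc (1 / k) * (sc k * ?u) \<in> P" using P(1) alg_ideal_lmult by blast
      then have "?u \<in> P" using k by (simp add: mult.assoc[symmetric] sc_mult[symmetric] sc_one)
      then have "psum v xs * ?u * ?u \<in> Z" using sq pP by blast
      then have "psum v xs * (?u * ?u) \<in> Z" by (simp add: mult.assoc)
      then have "psum v xs * ?u \<in> Z" using NZ[OF Nlmult[OF defect_idem[OF v(1) F(1,3)]]] by blast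
      with not_Z[OF F] show ?thesis by blast
    qed
  }
qed

section \<open>Values of polynomials\<close>

text \<open>
  The value of a polynomial at an element of the noncommutative ring \<open>'a\<close>. As the scalars are central, this
  is a ring homomorphism.
\<close>

definition ev :: "'a \<Rightarrow> 'k poly \<Rightarrow> 'a" where
  "ev x p = fold_coeffs (\<lambda>a y. sc a + x * y) p 0"

lemma ev_0 [simp]: "ev x 0 = 0"
  by (simp add: ev_def)

lemma ev_pCons [simp]: "ev x (pCons a p) = sc a + x * ev x p"
  by (cases "p = 0 \<and> a = 0") (auto simp: ev_def)

lemma ev_1 [simp]: "ev x 1 = 1"
  by (simp add: one_pCons sc_one)

lemma ev_add: "ev x (p + q) = ev x p + ev x q"
  by (induction p q rule: poly_induct2) (auto simp: sc_add algebra_simps)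

lemma ev_smult: "ev x (smult a p) = sc a * ev x p"
  by (induction p) (auto simp: sc_mult distrib_left sc_left)

lemma ev_mult: "ev x (p * q) = ev x p * ev x q"
  by (induction p) (auto simp: ev_add ev_smult algebra_simps)

lemma ev_monom: "ev x (monom 1 n) = x ^ n"
  by (induction n) (auto simp: monom_Suc monom_0 sc_one)

end

text \<open>
  Nonzero prime ideals of \<open>K[X]\<close> are maximal: a nonzero element \<open>g\<close> of least degree generates \<open>q\<close>. It divides a
  nonzero element \<open>d = g e\<close> of least degree in \<open>p\<close>, and since \<open>g \<notin> p\<close>, primeness puts \<open>e\<close> into \<open>p\<close>, so that \<open>g\<close> is constant.
\<close>

lemma prime_poly_ideal_maximal:
  fixes p q :: "'k::field poly set"
  assumes p: "\<And>a b. a \<in> p \<Longrightarrow> b * a \<in> p" "\<And>a b. a * b \<in> p \<Longrightarrow> a \<in> p \<or> b \<in> p"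
    and q: "\<And>a b. a \<in> q \<Longrightarrow> b \<in> q \<Longrightarrow> a + b \<in> q" "\<And>a b. a \<in> q \<Longrightarrow> b * a \<in> q"
    and pq: "p \<subset> q" and f: "f \<in> p" "f \<noteq> 0"
  shows "1 \<in> q"
proof -
  define minimal where "minimal s d \<longleftrightarrow> d \<in> s \<and> d \<noteq> 0 \<and> (\<forall>e \<in> s. e \<noteq> 0 \<longrightarrow> degree d \<le> degree e)"
    for s and d :: "'k poly"
  have ex: "\<exists>d. minimal s d" if "e \<in> s" "e \<noteq> 0" for s e
    using ex_has_least_nat[of "\<lambda>d. d \<in> s \<and> d \<noteq> 0" e degree] that by (auto simp: minimal_def)
  obtain d where d: "minimal p d" using ex[OF f] by blast
  obtain g where g: "minimal q g" using ex[of f q] f pq by blast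
  have gq: "g \<in> q" "g \<noteq> 0" using g by (auto simp: minimal_def)
  have div: "g dvd a" if a: "a \<in> q" for a
  proof (rule ccontr)
    assume "\<not> g dvd a"
    then have r: "a mod g \<noteq> 0" by (simp add: mod_eq_0_iff_dvd)
    have "a mod g = a + (- (a div g)) * g" by (simp add: minus_div_mult_eq_mod[symmetric])
    then have "a mod g \<in> q" using q a gq by metis
    then have "degree g \<le> degree (a mod g)" using g r by (auto simp: minimal_def)
    then show False using degree_mod_less[of g a] gq r by auto
  qed
  have "g \<notin> p"
  proof
    assume "g \<in> p"
    have "q \<subseteq> p"
    proof
      fix a assume "a \<in> q"
      then obtain b where "a = b * g" using div by (auto simp: dvd_def mult.commute)
      then show "a \<in> p" using p(1)[OF \<open>g \<in> p\<close>] by simp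
    qed
    then show False using pq by blast
  qed
  obtain e where e: "d = g * e" using div[of d] d pq by (auto simp: minimal_def dvd_def)
  then have "e \<in> p" using p(2)[of g e] d \<open>g \<notin> p\<close> by (auto simp: minimal_def)
  moreover have "e \<noteq> 0" using d e by (auto simp: minimal_def)
  ultimately have "degree d \<le> degree e" using d by (auto simp: minimal_def)
  then have "degree g = 0" using e \<open>e \<noteq> 0\<close> gq(2) by (simp add: degree_mult_eq)
  then obtain c where "g = [:c:]" by (metis degree_eq_zeroE)
  with gq(2) have "1 = [:1 / c:] * g" by (simp add: one_pCons)
  then show ?thesis using q(2)[OF gq(1)] by metis
qed

section \<open>The corner at a vertex of a nongraded prime\<close>

lemma length_concat_replicate: "\<gamma> \<noteq> [] \<Longrightarrow> n \<le> length (concat (replicate n \<gamma>))"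
  by (induction n) (auto simp: Suc_le_eq neq_Nil_conv)

text \<open>
  A word that is an initial part of its own translate by \<open>\<gamma>\<close> is an initial part of \<open>\<gamma> \<gamma> \<gamma> \<dots>\<close>.
\<close>

lemma prefix_concat_replicate:
  assumes "\<gamma> \<noteq> []" "prefix \<tau> (\<gamma> @ \<tau>)" "length \<tau> \<le> n"
  shows "prefix \<tau> (concat (replicate n \<gamma>))"
proof -
  have "prefix \<tau> (concat (replicate m \<gamma>) @ \<tau>)" for m
  proof (induction m)
    case (Suc m)
    have "prefix (\<gamma> @ \<tau>) (\<gamma> @ concat (replicate m \<gamma>) @ \<tau>)" using Suc by simp
    then show ?case using prefix_order.trans[OF assms(2)] by simp
  qed simp
  moreover have "length \<tau> \<le> length (concat (replicate n \<gamma>))"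
    using length_concat_replicate[OF assms(1), of n] assms(3) by simp
  ultimately show ?thesis by (metis prefix_length_prefix prefixI)
qed

locale lpa_prime = lpa_presentation E sc vt ed gh N M
  for E :: "('v, 'e) pre_digraph" and sc :: "'k::field \<Rightarrow> 'a::ring_1" and vt ed gh N M +
  fixes P
  assumes P_ideal: "alg_ideal P" and N_P: "N \<subseteq> P" and P_M: "P \<subseteq> M"
    and P_prime: "x \<in> M \<Longrightarrow> y \<in> M \<Longrightarrow> (\<And>a. x * a * y \<in> P) \<Longrightarrow> x \<in> P \<or> y \<in> P"
begin

lemmas Prefl = cg_refl[OF P_ideal]
lemmas Psym = cg_sym[OF P_ideal]
lemmas Ptrans [trans] = cg_trans[OF P_ideal]
lemmas Padd = cg_add[OF P_ideal]
lemmas Plmult = cg_lmult[OF P_ideal]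
lemmas Prmult = cg_rmult[OF P_ideal]
lemmas Pmem = cg_mem[OF P_ideal]

lemma N_imp_P: "x \<simeq>\<^bsub>N\<^esub> y \<Longrightarrow> x \<simeq>\<^bsub>P\<^esub> y"
  using cg_mono[OF N_P] .

lemma sc_mem_P: "sc k * x \<in> P \<Longrightarrow> k \<noteq> 0 \<Longrightarrow> x \<in> P"
  using alg_ideal_lmult[OF P_ideal, of "sc k * x" "sc (1 / k)"]
  by (simp add: mult.assoc[symmetric] sc_mult[symmetric] sc_one)

end

text \<open>
  An element of \<open>P\<close> of the form \<open>k w + (closed paths at w)\<close> with \<open>k \<noteq> 0\<close> and the least number of closed paths. Minimality
  takes the place of a study of exits: a closed path at \<open>w\<close> that branched off would, by conjugation, produce
  a shorter element of this kind.
\<close>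

locale exitless_corner = lpa_prime E sc vt ed gh N M P
  for E :: "('v, 'e) pre_digraph" and sc :: "'k::field \<Rightarrow> 'a::ring_1" and vt ed gh N M P +
  fixes w k0 ys0
  assumes w: "w \<in> verts E" "vt w \<notin> P" and k0: "k0 \<noteq> 0"
    and ys0: "loops_at w ys0" "vertex_plus_loops w k0 ys0 \<in> P"
    and minimal: "k \<noteq> 0 \<Longrightarrow> loops_at w ys \<Longrightarrow> vertex_plus_loops w k ys \<in> P \<Longrightarrow> length ys0 \<le> length ys"
begin

lemma conj_loops_P:
  assumes "awalk w \<tau> v"
  shows "vertex_plus_loops v k0 (conj_loops \<tau> ys0) \<in> P"
  using Pmem[OF N_imp_P[OF conj_vertex_plus_loops[OF assms ys0(1), of k0]]] ys0(2) P_ideal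
    alg_ideal_lmult alg_ideal_rmult by blast

text \<open>
  Any of the closed paths of the minimal element will do.
\<close>

definition period where "period = snd (hd ys0)"

lemma ys0_nonempty: "ys0 \<noteq> []"
  using ys0(2) sc_mem_P[OF _ k0, of "vt w"] w(2) by (auto simp: vertex_plus_loops_def)

lemma period: "period \<noteq> []" "awalk w period w"
proof -
  have "(fst (hd ys0), period) \<in> set ys0" using ys0_nonempty by (simp add: period_def)
  then show "period \<noteq> []" "awalk w period w" using ys0(1) unfolding loops_at_def by blast+
qed

text \<open>
  Conjugation by \<open>\<tau>\<close> gives another element of \<open>P\<close> of the same form. By minimality no closed path is lost,
  in particular not the chosen one.
\<close>

lemma loop_prefix:
  assumes "awalk w \<tau> w"
  shows "prefix \<tau> (period @ \<tau>)"
proof (rule ccontr)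
  assume *: "\<not> ?thesis"
  have "length (conj_loops \<tau> ys0) < length ys0"
    unfolding conj_loops_def length_map
    by (rule length_filter_less[of "hd ys0"]) (use * ys0_nonempty in \<open>auto simp: period_def split: prod.splits\<close>)
  moreover have "length ys0 \<le> length (conj_loops \<tau> ys0)"
    using minimal[OF k0 loops_at_conj[OF assms ys0(1)] conj_loops_P[OF assms]] .
  ultimately show False by simp
qed

text \<open>
  Both closed paths are initial parts of one infinite periodic path.
\<close>

lemma loops_comparable:
  assumes "awalk w \<sigma> w" "awalk w \<tau> w" "length \<sigma> \<le> length \<tau>"
  shows "prefix \<sigma> \<tau>"
  using prefix_concat_replicate[OF period(1) loop_prefix[OF assms(1)] assms(3)]
    prefix_concat_replicate[OF period(1) loop_prefix[OF assms(2)] order_refl] assms(3)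
    prefix_length_prefix by blast

text \<open>
  The shortest closed path. By comparability it is an initial part of every nontrivial closed path at \<open>w\<close>, so that
  all of them are powers of it.
\<close>

definition c where "c = (ARG_MIN length \<gamma>. \<gamma> \<noteq> [] \<and> awalk w \<gamma> w)"

lemma c: "c \<noteq> []" "awalk w c w" and c_min: "\<gamma> \<noteq> [] \<Longrightarrow> awalk w \<gamma> w \<Longrightarrow> length c \<le> length \<gamma>"
  using arg_min_nat_lemma[of "\<lambda>\<gamma>. \<gamma> \<noteq> [] \<and> awalk w \<gamma> w" period length] period unfolding c_def by blast+

lemma loop_power:
  assumes "awalk w \<tau> w"
  shows "\<exists>n. \<tau> = concat (replicate n c)"
  using assms
proof (induction "length \<tau>" arbitrary: \<tau> rule: less_induct)
  case less
  show ?case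
  proof (cases "\<tau> = []")
    case True
    then show ?thesis by (intro exI[of _ 0]) simp
  next
    case False
    then obtain \<delta> where \<delta>: "\<tau> = c @ \<delta>"
      using loops_comparable[OF c(2) less.prems c_min] less.prems by (auto simp: prefix_def)
    then have "awalk w \<delta> w" using less.prems awalk_suffix c(2) by blast
    moreover have "length \<delta> < length \<tau>" using \<delta> c(1) by simp
    ultimately obtain n where "\<delta> = concat (replicate n c)" using less.hyps by blast
    then show ?thesis using \<delta> by (intro exI[of _ "Suc n"]) simp
  qed
qed

lemma awalk_power: "awalk w (concat (replicate n c)) w"
  by (induction n) (use w c awalk_append in \<open>auto simp: awalk_Nil_iff\<close>)

definition C where "C = pe c * vt w"
definition C' where "C' = vt w * pg c"

lemma vt_C: "vt w * C \<simeq>\<^bsub>N\<^esub> C"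
  unfolding C_def by (rule vt_pe[OF c(2)])

lemma C_vt: "C * vt w \<simeq>\<^bsub>N\<^esub> C"
  using Nlmult[OF vt_idem[OF w(1)], of "pe c"] by (simp add: C_def mult.assoc)

lemma C'_vt: "C' * vt w \<simeq>\<^bsub>N\<^esub> C'"
  unfolding C'_def by (rule pg_vt[OF c(2)])

lemma ev_vt: "vt w * ev C p \<simeq>\<^bsub>N\<^esub> ev C p * vt w"
proof (induction p)
  case (pCons a p)
  have "vt w * ev C (pCons a p) = sc a * vt w + vt w * C * ev C p"
    by (simp add: distrib_left sc_comm mult.assoc)
  also have "\<dots> \<simeq>\<^bsub>N\<^esub> sc a * vt w + C * vt w * ev C p"
    by (intro Nadd Nrefl Nrmult) (rule Ntrans[OF vt_C Nsym[OF C_vt]])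
  also have "\<dots> = sc a * vt w + C * (vt w * ev C p)" by (simp add: mult.assoc)
  also have "\<dots> \<simeq>\<^bsub>N\<^esub> sc a * vt w + C * (ev C p * vt w)"
    by (intro Nadd Nrefl Nlmult pCons.IH)
  finally show ?case by (simp add: distrib_right mult.assoc)
qed (simp add: Nrefl)

lemma vt_power: "vt w * C ^ n \<simeq>\<^bsub>N\<^esub> C ^ n * vt w"
  using ev_vt[of "monom 1 n"] by (simp add: ev_monom)

lemma pe_power: "pe (concat (replicate n c)) * vt w \<simeq>\<^bsub>N\<^esub> vt w * C ^ n"
proof (induction n)
  case (Suc n)
  have "pe (concat (replicate (Suc n) c)) * vt w = pe c * (pe (concat (replicate n c)) * vt w)"
    by (simp add: mult.assoc)
  also have "\<dots> \<simeq>\<^bsub>N\<^esub> pe c * (vt w * C ^ n)" by (intro Nlmult Suc.IH)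
  also have "\<dots> = C * C ^ n" by (simp add: C_def mult.assoc)
  also have "\<dots> \<simeq>\<^bsub>N\<^esub> vt w * C * C ^ n" by (intro Nrmult Nsym[OF vt_C])
  finally show ?case by (simp add: mult.assoc)
qed (simp add: Nrefl)

text \<open>
  The difference \<open>w - c c\<^sup>*\<close> kills every power \<open>c\<^sup>n\<close> with \<open>n \<ge> 1\<close>, so it turns the given element of \<open>P\<close> into a
  nonzero multiple of \<open>w - c c\<^sup>*\<close>.
\<close>

lemma C_C': "C * C' \<simeq>\<^bsub>P\<^esub> vt w"
proof -
  let ?d = "vt w - C * C'"
  have dC: "?d * C \<simeq>\<^bsub>N\<^esub> 0"
  proof -
    have "C' * C \<simeq>\<^bsub>N\<^esub> vt w" unfolding C_def C'_def by (rule pg_pe_same[OF c(2)])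
    then have "C * (C' * C) \<simeq>\<^bsub>N\<^esub> C" by (rule Ntrans[OF Nlmult C_vt])
    from Ndiff[OF vt_C this] show ?thesis by (simp add: left_diff_distrib mult.assoc)
  qed
  have dpsum: "?d * psum w ys \<simeq>\<^bsub>N\<^esub> 0" if "loops_at w ys" for ys
    using that
  proof (induction ys)
    case (Cons y ys)
    obtain l \<gamma> where y: "y = (l, \<gamma>)" by force
    then have \<gamma>: "\<gamma> \<noteq> []" "awalk w \<gamma> w" and ys: "loops_at w ys"
      using Cons.prems by (auto simp: loops_at_def)
    obtain n where n: "\<gamma> = concat (replicate n c)" using loop_power[OF \<gamma>(2)] by blast
    then obtain m where m: "n = Suc m" using \<gamma>(1) by (cases n) auto
    have 1: "vt w * C ^ n \<simeq>\<^bsub>N\<^esub> C * C ^ m"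
      using Nrmult[OF vt_C, of "C ^ m"] by (simp add: m mult.assoc)
    have "pe \<gamma> * vt w \<simeq>\<^bsub>N\<^esub> C * C ^ m"
      using Ntrans[OF pe_power[of n] 1] by (simp only: n)
    then have "?d * (pe \<gamma> * vt w) \<simeq>\<^bsub>N\<^esub> ?d * (C * C ^ m)" by (rule Nlmult)
    also have "?d * (C * C ^ m) = ?d * C * C ^ m" by (simp add: mult.assoc)
    also have "\<dots> \<simeq>\<^bsub>N\<^esub> 0 * C ^ m" by (intro Nrmult dC)
    finally have "sc l * (?d * (pe \<gamma> * vt w)) + ?d * psum w ys \<simeq>\<^bsub>N\<^esub> sc l * (0 * C ^ m) + 0"
      by (intro Nadd Nlmult Cons.IH ys)
    then show ?case by (simp add: y distrib_left sc_left)
  qed (simp add: Nrefl)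
  have "?d * vt w \<simeq>\<^bsub>N\<^esub> ?d"
    using Ndiff[OF vt_idem[OF w(1)] Nlmult[OF C'_vt, of C]] by (simp add: left_diff_distrib mult.assoc)
  from Nadd[OF Nlmult[OF this] dpsum[OF ys0(1)]]
  have "?d * vertex_plus_loops w k0 ys0 \<simeq>\<^bsub>N\<^esub> sc k0 * ?d"
    by (simp add: vertex_plus_loops_def distrib_left sc_left)
  then have "sc k0 * ?d \<in> P"
    using Pmem[OF N_imp_P] alg_ideal_lmult[OF P_ideal ys0(2)] by blast
  then have "?d \<in> P" using sc_mem_P k0 by blast
  then show ?thesis using Psym by (simp add: cg_def[symmetric])
qed

lemma power_cancel: "vt w * C ^ n * C' ^ n \<simeq>\<^bsub>P\<^esub> vt w"
proof (induction n)
  case 0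
  then show ?case by (simp add: Prefl)
next
  case (Suc n)
  have "vt w * C ^ Suc n * C' ^ Suc n = vt w * C ^ n * (C * C') * C' ^ n"
    by (simp add: power_Suc2[of C] mult.assoc del: power_Suc) (simp add: mult.assoc)
  also have "\<dots> \<simeq>\<^bsub>P\<^esub> vt w * C ^ n * vt w * C' ^ n" by (intro Prmult Plmult C_C')
  also have "\<dots> \<simeq>\<^bsub>P\<^esub> vt w * (vt w * C ^ n) * C' ^ n"
    unfolding mult.assoc[of "vt w" "C ^ n" "vt w"]
    by (intro Prmult Plmult N_imp_P Nsym[OF vt_power])
  also have "\<dots> = vt w * vt w * C ^ n * C' ^ n" by (simp add: mult.assoc)
  also have "\<dots> \<simeq>\<^bsub>P\<^esub> vt w * C ^ n * C' ^ n" by (intro Prmult N_imp_P vt_idem w)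
  also note Suc.IH
  finally show ?case .
qed

text \<open>
  Modulo \<open>P\<close> the element \<open>c\<close> is invertible in the corner at \<open>w\<close>, so denominators may be cleared before membership in
  \<open>P\<close> is tested.
\<close>

lemma power_cancel_P:
  assumes "x * vt w \<simeq>\<^bsub>N\<^esub> x" "x * C ^ n \<in> P"
  shows "x \<in> P"
proof -
  have "x * vt w \<simeq>\<^bsub>P\<^esub> x * (vt w * C ^ n * C' ^ n)" by (intro Plmult Psym[OF power_cancel])
  also have "\<dots> = x * vt w * (C ^ n * C' ^ n)" by (simp add: mult.assoc)
  also have "\<dots> \<simeq>\<^bsub>P\<^esub> x * (C ^ n * C' ^ n)" by (intro Prmult N_imp_P assms)
  also have "\<dots> = x * C ^ n * C' ^ n" by (simp add: mult.assoc)
  finally have "x * vt w \<in> P" using Pmem alg_ideal_rmult[OF P_ideal assms(2)] by blast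
  then show ?thesis using Pmem[OF N_imp_P[OF assms(1)]] by blast
qed

text \<open>
  If no conjugate of the closed paths by \<open>\<beta>\<close> survived, conjugation of the minimal element would leave a
  nonzero multiple of \<open>v\<close> in \<open>P\<close>. For a survivor \<open>\<gamma>\<close>, the path \<open>\<beta>\<close> is an
  initial part of a power of \<open>\<gamma>\<close>, and \<open>\<gamma>\<close> is itself a power of \<open>c\<close>.
\<close>

lemma walk_extends_to_power:
  assumes "awalk w \<beta> v" "vt v \<notin> P"
  shows "\<exists>n. prefix \<beta> (concat (replicate n c))"
proof -
  have "conj_loops \<beta> ys0 \<noteq> []"
    using conj_loops_P[OF assms(1)] sc_mem_P[OF _ k0, of "vt v"] assms(2) by (auto simp: vertex_plus_loops_def)
  then obtain k \<gamma> where \<gamma>: "(k, \<gamma>) \<in> set ys0" "prefix \<beta> (\<gamma> @ \<beta>)"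
    by (auto simp: conj_loops_def filter_empty_conv)
  then have \<gamma>': "\<gamma> \<noteq> []" "awalk w \<gamma> w" using ys0(1) by (auto simp: loops_at_def)
  have "awalk w (concat (replicate m \<gamma>)) w" for m
    by (induction m) (use w \<gamma>' awalk_append in \<open>auto simp: awalk_Nil_iff\<close>)
  then show ?thesis
    using loop_power prefix_concat_replicate[OF \<gamma>'(1) \<gamma>(2) order_refl] by metis
qed

text \<open>
  For \<open>v \<notin> P\<close> and \<open>\<beta>\<close> starting at \<open>w\<close>, some power \<open>c\<^sup>n = \<beta> \<delta>\<close> absorbs \<open>\<beta>\<^sup>*\<close>, and what remains is a path \<open>\<alpha> \<delta>\<close> that
  ends at \<open>w\<close>. It is a power of \<open>c\<close> if it starts at \<open>w\<close> too, and is killed by \<open>w\<close> otherwise.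
\<close>

lemma monomial_corner:
  assumes "awalk u \<alpha> v" "awalk x \<beta> v"
  shows "\<exists>n h. vt w * (pe \<alpha> * vt v * pg \<beta>) * C ^ n \<simeq>\<^bsub>P\<^esub> vt w * ev C h"
proof -
  consider "vt v \<in> P" | "x \<noteq> w" | "vt v \<notin> P" "x = w" by blast
  then show ?thesis
  proof cases
    case 1
    then have "vt w * (pe \<alpha> * vt v * pg \<beta>) * C ^ 0 \<in> P"
      using P_ideal by (simp add: alg_ideal_lmult alg_ideal_rmult)
    then show ?thesis by (intro exI[of _ 0]) (simp add: cg_zero)
  next
    case 2
    have "vt v * pg \<beta> * C \<simeq>\<^bsub>N\<^esub> vt v * pg \<beta> * (vt w * C)" by (intro Nlmult Nsym[OF vt_C])
    also have "\<dots> = vt v * pg \<beta> * vt w * C" by (simp add: mult.assoc)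
    also have "\<dots> \<simeq>\<^bsub>N\<^esub> 0 * C" using monomial_vt[OF assms(2) w(1)] 2 by (intro Nrmult) simp
    finally have "vt w * (pe \<alpha> * (vt v * pg \<beta> * C)) \<simeq>\<^bsub>N\<^esub> vt w * (pe \<alpha> * (0 * C))" by (intro Nlmult)
    then show ?thesis
      by (intro exI[of _ 1] exI[of _ 0]) (simp add: N_imp_P mult.assoc)
  next
    case 3
    obtain n \<delta> where n: "concat (replicate n c) = \<beta> @ \<delta>"
      using walk_extends_to_power assms 3 by (metis prefix_def)
    have \<beta>\<delta>: "awalk w (\<beta> @ \<delta>) w" using awalk_power[of n] n by simp
    then have \<delta>: "awalk v \<delta> w" using awalk_suffix assms(2) 3 by blast
    have "vt v * pg \<beta> * C ^ n \<simeq>\<^bsub>N\<^esub> vt v * pg \<beta> * vt w * C ^ n"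
      by (rule Nrmult, rule Nsym) (use pg_vt[OF assms(2)] 3 in simp)
    also have "\<dots> = vt v * pg \<beta> * (vt w * C ^ n)" by (simp add: mult.assoc)
    also have "\<dots> \<simeq>\<^bsub>N\<^esub> vt v * pg \<beta> * (pe (\<beta> @ \<delta>) * vt w)"
      using Nsym[OF pe_power[of n]] by (intro Nlmult) (simp add: n del: pe_simps)
    also have "\<dots> \<simeq>\<^bsub>N\<^esub> pe \<delta> * vt w"
      using pg_pe[OF assms(2) \<beta>\<delta>] 3 by simp
    finally have "vt w * (pe \<alpha> * (vt v * pg \<beta> * C ^ n)) \<simeq>\<^bsub>N\<^esub> vt w * (pe \<alpha> * (pe \<delta> * vt w))"
      by (intro Nlmult)
    then have 1: "vt w * (pe \<alpha> * vt v * pg \<beta>) * C ^ n \<simeq>\<^bsub>N\<^esub> vt w * (pe (\<alpha> @ \<delta>) * vt w)"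
      by (simp add: mult.assoc)
    have \<alpha>\<delta>: "awalk u (\<alpha> @ \<delta>) w" using assms(1) \<delta> awalk_append by blast
    have "\<exists>h. vt w * (pe (\<alpha> @ \<delta>) * vt w) \<simeq>\<^bsub>N\<^esub> vt w * ev C h"
    proof (cases "u = w")
      case True
      then obtain m where "\<alpha> @ \<delta> = concat (replicate m c)" using loop_power \<alpha>\<delta> by blast
      then have "vt w * (pe (\<alpha> @ \<delta>) * vt w) \<simeq>\<^bsub>N\<^esub> vt w * (vt w * C ^ m)"
        using Nlmult[OF pe_power[of m]] by simp
      also have "\<dots> = vt w * vt w * C ^ m" by (simp add: mult.assoc)
      also have "\<dots> \<simeq>\<^bsub>N\<^esub> vt w * C ^ m" by (intro Nrmult vt_idem w)
      finally show ?thesis by (intro exI[of _ "monom 1 m"]) (simp add: ev_monom)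
    next
      case False
      have "awalk w [] w" using w by (simp add: awalk_Nil_iff)
      from pg_pe[OF this \<alpha>\<delta>] False show ?thesis by (intro exI[of _ 0]) simp
    qed
    then show ?thesis using 1 Ntrans N_imp_P by blast
  qed
qed

lemma ev_power: "ev C p * C ^ n = ev C (p * monom 1 n)"
  by (simp add: ev_mult ev_monom)

text \<open>
  Modulo \<open>P\<close> the corner at \<open>w\<close> consists of Laurent polynomials in \<open>c\<close>; a power of \<open>c\<close> clears the denominator.
\<close>

lemma corner_polynomial:
  assumes "x \<in> M"
  shows "\<exists>n h. vt w * x * C ^ n \<simeq>\<^bsub>P\<^esub> vt w * ev C h"
proof -
  obtain m where "x \<in> gspan m" using M_gspan[OF assms] by blast
  then show ?thesis
  proof (induction rule: gspan.induct)
    case (base x)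
    then have "vt w * x * C ^ 0 \<in> P"
      using P_ideal N_P by (auto intro: alg_ideal_lmult)
    then show ?case by (intro exI[of _ 0]) (simp add: cg_zero)
  next
    case (step x u \<alpha> v w' \<beta> k)
    obtain n h where x: "vt w * x * C ^ n \<simeq>\<^bsub>P\<^esub> vt w * ev C h" using step.IH by blast
    obtain n' h' where y: "vt w * (pe \<alpha> * vt v * pg \<beta>) * C ^ n' \<simeq>\<^bsub>P\<^esub> vt w * ev C h'"
      using monomial_corner step.hyps by blast
    have lhs: "vt w * (sc k * (pe \<alpha> * vt v * pg \<beta>) + x) * C ^ (n + n')
        = sc k * (vt w * (pe \<alpha> * vt v * pg \<beta>) * C ^ n' * C ^ n) + vt w * x * C ^ n * C ^ n'"
      by (simp add: distrib_left distrib_right sc_left mult.assoc power_add[symmetric] add.commute)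
    have rhs: "sc k * (vt w * ev C h' * C ^ n) + vt w * ev C h * C ^ n'
        = vt w * ev C (smult k (h' * monom 1 n) + h * monom 1 n')"
      by (simp only: mult.assoc ev_power ev_add ev_smult distrib_left sc_left[of "vt w"])
    have "sc k * (vt w * (pe \<alpha> * vt v * pg \<beta>) * C ^ n' * C ^ n) + vt w * x * C ^ n * C ^ n'
        \<simeq>\<^bsub>P\<^esub> sc k * (vt w * ev C h' * C ^ n) + vt w * ev C h * C ^ n'"
      by (rule Padd, rule Plmult, rule Prmult, rule y, rule Prmult, rule x)
    then show ?case unfolding lhs[symmetric] rhs by (intro exI)
  qed
qed

lemma vt_ev_vt: "vt w * ev C p * vt w \<simeq>\<^bsub>N\<^esub> vt w * ev C p"
proof -
  have "vt w * ev C p * vt w = vt w * (ev C p * vt w)" by (simp add: mult.assoc)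
  also have "\<dots> \<simeq>\<^bsub>N\<^esub> vt w * (vt w * ev C p)" by (intro Nlmult Nsym[OF ev_vt])
  also have "\<dots> = vt w * vt w * ev C p" by (simp add: mult.assoc)
  also have "\<dots> \<simeq>\<^bsub>N\<^esub> vt w * ev C p" by (intro Nrmult vt_idem w)
  finally show ?thesis .
qed

text \<open>
  Up to a power of \<open>c\<close>, the element \<open>f(c) a g(c)\<close> is \<open>f(c) h(c) g(c) = (f g)(c) h(c)\<close> modulo \<open>P\<close>, for every \<open>a\<close>. So the
  primeness of \<open>P\<close> in the noncommutative ring passes to polynomials.
\<close>

lemma corner_kernel_prime:
  assumes fg: "vt w * ev C (f * g) \<in> P"
  shows "vt w * ev C f \<in> P \<or> vt w * ev C g \<in> P"
proof (rule P_prime)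
  show "vt w * ev C f \<in> M" "vt w * ev C g \<in> M" using vt_M[OF w(1)] alg_ideal_rmult[OF M_ideal] by auto
next
  fix a
  have "a * vt w \<in> M" using vt_M[OF w(1)] alg_ideal_lmult[OF M_ideal] by blast
  then obtain n h where h: "vt w * (a * vt w) * C ^ n \<simeq>\<^bsub>P\<^esub> vt w * ev C h"
    using corner_polynomial by blast
  let ?t = "vt w * ev C f * a * (vt w * ev C g)"
  have "?t * C ^ n = vt w * ev C f * (a * vt w) * (ev C g * C ^ n)" by (simp add: mult.assoc)
  also have "ev C g * C ^ n = C ^ n * ev C g"
    by (metis ev_monom ev_mult mult.commute)
  also have "vt w * ev C f * (a * vt w) * (C ^ n * ev C g)
      \<simeq>\<^bsub>P\<^esub> vt w * ev C f * vt w * (a * vt w) * (C ^ n * ev C g)"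
    by (intro Prmult N_imp_P Nsym[OF vt_ev_vt])
  also have "\<dots> = vt w * ev C f * (vt w * (a * vt w) * C ^ n) * ev C g" by (simp add: mult.assoc)
  also have "\<dots> \<simeq>\<^bsub>P\<^esub> vt w * ev C f * (vt w * ev C h) * ev C g" by (intro Prmult Plmult h)
  also have "\<dots> = vt w * ev C f * vt w * ev C h * ev C g" by (simp add: mult.assoc)
  also have "\<dots> \<simeq>\<^bsub>P\<^esub> vt w * ev C f * ev C h * ev C g" by (intro Prmult N_imp_P vt_ev_vt)
  also have "\<dots> = vt w * ev C (f * g) * ev C h"
    by (metis ev_mult mult.assoc mult.commute)
  finally have "?t * C ^ n \<simeq>\<^bsub>P\<^esub> vt w * ev C (f * g) * ev C h" .
  then have "?t * C ^ n \<in> P" using Pmem alg_ideal_rmult[OF P_ideal fg] by blast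
  moreover have "?t * vt w \<simeq>\<^bsub>N\<^esub> ?t"
    using Nlmult[OF vt_ev_vt, of "vt w * ev C f * a"] by (simp add: mult.assoc)
  ultimately show "?t \<in> P" using power_cancel_P by blast
qed

lemma psum_polynomial:
  assumes "loops_at w ys"
  shows "\<exists>h. coeff h 0 = 0 \<and> vt w * ev C h \<simeq>\<^bsub>N\<^esub> psum w ys"
  using assms
proof (induction ys)
  case Nil
  then show ?case by (intro exI[of _ 0]) (simp add: Nrefl)
next
  case (Cons y ys)
  obtain l \<gamma> where y: "y = (l, \<gamma>)" by force
  then have \<gamma>: "\<gamma> \<noteq> []" "awalk w \<gamma> w" and ys: "loops_at w ys"
    using Cons.prems by (auto simp: loops_at_def)
  obtain n where n: "\<gamma> = concat (replicate n c)" using loop_power[OF \<gamma>(2)] by blast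
  then have "n \<noteq> 0" using \<gamma>(1) by (cases n) auto
  obtain h where h: "coeff h 0 = 0" "vt w * ev C h \<simeq>\<^bsub>N\<^esub> psum w ys" using Cons.IH ys by blast
  have "sc l * (vt w * C ^ n) + vt w * ev C h \<simeq>\<^bsub>N\<^esub> sc l * (pe \<gamma> * vt w) + psum w ys"
    unfolding n by (intro Nadd Nlmult Nsym[OF pe_power] h)
  then have "vt w * ev C (smult l (monom 1 n) + h) \<simeq>\<^bsub>N\<^esub> psum w (y # ys)"
    by (simp add: y ev_add ev_smult ev_monom distrib_left sc_left)
  moreover have "coeff (smult l (monom 1 n) + h) 0 = 0" using \<open>n \<noteq> 0\<close> h(1) by simp
  ultimately show ?case by blast
qed

text \<open>
  The given element \<open>k w + (closed paths)\<close> is the value at \<open>c\<close> of a polynomial with constant coefficient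
  \<open>k \<noteq> 0\<close>.
\<close>

lemma corner_kernel_nonzero: "\<exists>h. h \<noteq> 0 \<and> vt w * ev C h \<in> P"
proof -
  obtain h where h: "coeff h 0 = 0" "vt w * ev C h \<simeq>\<^bsub>N\<^esub> psum w ys0"
    using psum_polynomial[OF ys0(1)] by blast
  have "sc k0 * vt w + vt w * ev C h \<simeq>\<^bsub>N\<^esub> vertex_plus_loops w k0 ys0"
    unfolding vertex_plus_loops_def by (intro Nadd Nrefl h)
  then have "vt w * ev C ([:k0:] + h) \<in> P"
    using Pmem[OF N_imp_P] ys0(2) by (simp add: ev_add distrib_left sc_comm)
  moreover have "[:k0:] + h \<noteq> 0" using h(1) k0
    by (metis coeff_0 coeff_add coeff_pCons_0 add.right_neutral)
  ultimately show ?thesis by blast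
qed

text \<open>
  Primeness of \<open>P\<close>, applied twice, moves an element of \<open>Q\<close> outside \<open>P\<close> into the corner at \<open>w\<close>. There it is a polynomial
  in \<open>c\<close> up to a power of \<open>c\<close>, so the polynomials with value in \<open>Q\<close> strictly contain the maximal ideal
  of those with value in \<open>P\<close>.
\<close>

lemma corner_vertex_in_larger_ideal:
  assumes Q: "alg_ideal Q" "P \<subset> Q" "Q \<subseteq> M"
  shows "vt w \<in> Q"
proof -
  obtain y where y: "y \<in> Q" "y \<notin> P" "y \<in> M" using Q by blast
  obtain a where a: "vt w * a * y \<notin> P" using P_prime[of "vt w" y] vt_M[OF w(1)] y w(2) by blast
  moreover have "vt w * a * y \<in> M" using y(3) alg_ideal_lmult[OF M_ideal] by blast
  ultimately obtain b where b: "vt w * a * y * b * vt w \<notin> P"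
    using P_prime[of "vt w * a * y" "vt w"] vt_M[OF w(1)] w(2) by blast
  let ?x = "a * y * b * vt w"
  have xQ: "?x \<in> Q" by (intro alg_ideal_rmult[OF Q(1)] alg_ideal_lmult[OF Q(1) y(1)])
  then obtain n h where h: "vt w * ?x * C ^ n \<simeq>\<^bsub>P\<^esub> vt w * ev C h"
    using corner_polynomial Q(3) by blast
  let ?p = "{f. vt w * ev C f \<in> P}" and ?q = "{f. vt w * ev C f \<in> Q}"
  have "vt w * ?x * C ^ n \<in> Q" by (intro alg_ideal_rmult[OF Q(1)] alg_ideal_lmult[OF Q(1) xQ])
  then have hq: "h \<in> ?q" using cg_mem[OF Q(1) cg_mono[OF _ h]] Q(2) by blast
  have xw: "vt w * ?x * vt w \<simeq>\<^bsub>N\<^esub> vt w * ?x"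
    using Nlmult[OF vt_idem[OF w(1)], of "vt w * a * y * b"] by (simp add: mult.assoc)
  have "h \<notin> ?p"
  proof
    assume "h \<in> ?p"
    then have "vt w * ?x * C ^ n \<in> P" using Pmem[OF h] by blast
    from power_cancel_P[OF xw this] show False using b by (simp add: mult.assoc)
  qed
  with hq Q(2) have pq: "?p \<subset> ?q" by blast
  have ideal: "vt w * ev C (b * a) \<in> I" if "alg_ideal I" "vt w * ev C a \<in> I" for I a b
    using alg_ideal_rmult[OF that, of "ev C b"] by (metis ev_mult mult.assoc mult.commute)
  obtain f where "f \<noteq> 0" "f \<in> ?p" using corner_kernel_nonzero by blast
  then have "1 \<in> ?q"
    using prime_poly_ideal_maximal[of ?p ?q f] pq ideal[OF P_ideal] ideal[OF Q(1)] corner_kernel_prime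
      alg_ideal_add[OF Q(1)] by (simp add: ev_add distrib_left)
  then show ?thesis by simp
qed

end

context lpa_prime begin

theorem vertex_in_larger_ideal:
  assumes "w \<in> verts E" "k \<noteq> 0" "loops_at w ys" "vertex_plus_loops w k ys \<in> P"
    and Q: "alg_ideal Q" "P \<subset> Q" "Q \<subseteq> M"
  shows "vt w \<in> Q"
proof (cases "vt w \<in> P")
  case False
  let ?A = "\<lambda>(k, ys). k \<noteq> 0 \<and> loops_at w ys \<and> vertex_plus_loops w k ys \<in> P"
  obtain z where z: "?A z" "\<And>z'. ?A z' \<Longrightarrow> length (snd z) \<le> length (snd z')"
    using ex_has_least_nat[of ?A "(k, ys)" "\<lambda>z. length (snd z)"] assms by blast
  interpret exitless_corner E sc vt ed gh N M P w "fst z" "snd z"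
    using assms(1) False z by unfold_locales force+
  show ?thesis using corner_vertex_in_larger_ideal Q by blast
qed (use Q in blast)

text \<open>
  For \<open>Z\<close> the product of \<open>P\<close> and \<open>Q\<close> this is the inclusion \<open>P \<subseteq> P Q\<close>.
\<close>

theorem prime_subset_product:
  assumes Q: "alg_ideal Q" "P \<subset> Q" "Q \<subseteq> M"
    and Z: "alg_ideal Z" "N \<subseteq> Z" "Z \<subseteq> P" "\<And>x y. x \<in> P \<Longrightarrow> y \<in> Q \<Longrightarrow> x * y \<in> Z"
  shows "P \<subseteq> Z"
proof (rule subsetI, rule ccontr)
  fix x assume x: "x \<in> P" "x \<notin> Z"
  have NZ: "p \<in> Z \<longleftrightarrow> q \<in> Z" if "p \<simeq>\<^bsub>N\<^esub> q" for p q
    using cg_mem[OF Z(1) cg_mono[OF Z(2) that]] .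
  obtain n where "x \<in> gspan n" using M_gspan x P_M by blast
  then obtain a v xs where v: "v \<in> verts E" "paths_to v xs" and
    xa: "x * a \<simeq>\<^bsub>N\<^esub> psum v xs" "x * a \<notin> Z"
    using ghost_elimination[OF Z(1,2) P_ideal Z(3) _ _ x] Z(4) Q(2) by blast
  have P: "psum v xs \<in> P" using Pmem[OF N_imp_P[OF xa(1)]] x(1) P_ideal alg_ideal_rmult by blast
  have nZ: "psum v xs \<notin> Z" using NZ xa by blast
  then have "psum v xs \<notin> N" using Z(2) by blast
  then obtain b k ys where b: "k \<noteq> 0" "loops_at v ys" "b * psum v xs \<simeq>\<^bsub>N\<^esub> vertex_plus_loops v k ys"
    using psum_reduce[OF v(2,1)] by blast
  have "vertex_plus_loops v k ys \<in> P" using Pmem[OF N_imp_P[OF b(3)]] P P_ideal alg_ideal_lmult by blast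
  then have "vt v \<in> Q" using vertex_in_larger_ideal[OF v(1) b(1,2)] Q by blast
  then have "psum v xs * vt v \<in> Z" using Z(4) P by blast
  moreover have "psum v xs * vt v \<simeq>\<^bsub>N\<^esub> psum v xs"
  proof (induction xs)
    case (Cons x xs)
    obtain k \<alpha> where x: "x = (k, \<alpha>)" by force
    have "sc k * (pe \<alpha> * (vt v * vt v)) + psum v xs * vt v \<simeq>\<^bsub>N\<^esub> sc k * (pe \<alpha> * vt v) + psum v xs"
      by (intro Nadd Nlmult vt_idem v Cons.IH)
    then show ?case by (simp add: x distrib_right mult.assoc)
  qed (simp add: Nrefl)
  ultimately show False using NZ nZ by blast
qed

end

section \<open>Ideals of nonunital rings\<close>

locale nonunital_ring = abelian_group R for R (structure) +
  assumes m_closed: "x \<in> carrier R \<Longrightarrow> y \<in> carrier R \<Longrightarrow> x \<otimes> y \<in> carrier R"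
    and m_assoc: "x \<in> carrier R \<Longrightarrow> y \<in> carrier R \<Longrightarrow> z \<in> carrier R \<Longrightarrow> (x \<otimes> y) \<otimes> z = x \<otimes> (y \<otimes> z)"
    and l_distr: "x \<in> carrier R \<Longrightarrow> y \<in> carrier R \<Longrightarrow> z \<in> carrier R \<Longrightarrow> (x \<oplus> y) \<otimes> z = x \<otimes> z \<oplus> y \<otimes> z"
    and r_distr: "x \<in> carrier R \<Longrightarrow> y \<in> carrier R \<Longrightarrow> z \<in> carrier R \<Longrightarrow> z \<otimes> (x \<oplus> y) = z \<otimes> x \<oplus> z \<otimes> y"
begin

lemma l_zero_mult: "x \<in> carrier R \<Longrightarrow> \<zero> \<otimes> x = \<zero>"
  using l_distr[of \<zero> \<zero> x] m_closed[of \<zero> x] by (metis add.r_cancel_one' l_zero zero_closed)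

lemma r_zero_mult: "x \<in> carrier R \<Longrightarrow> x \<otimes> \<zero> = \<zero>"
  using r_distr[of \<zero> \<zero> x] m_closed[of x \<zero>] by (metis add.r_cancel_one' l_zero zero_closed)

lemma l_minus_mult:
  assumes "x \<in> carrier R" "y \<in> carrier R" shows "(\<ominus> x) \<otimes> y = \<ominus> (x \<otimes> y)"
proof -
  have "(\<ominus> x) \<otimes> y \<oplus> x \<otimes> y = \<zero>"
    using assms by (simp add: l_distr[symmetric] l_neg l_zero_mult)
  then show ?thesis using assms m_closed by (metis a_inv_closed minus_equality)
qed

lemma r_minus_mult:
  assumes "x \<in> carrier R" "y \<in> carrier R" shows "x \<otimes> (\<ominus> y) = \<ominus> (x \<otimes> y)"
proof -
  have "x \<otimes> (\<ominus> y) \<oplus> x \<otimes> y = \<zero>"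
    using assms by (simp add: r_distr[symmetric] l_neg r_zero_mult)
  then show ?thesis using assms m_closed by (metis a_inv_closed minus_equality)
qed

lemma two_sided_idealI:
  assumes "I \<subseteq> carrier R" "\<zero> \<in> I" "\<And>x y. x \<in> I \<Longrightarrow> y \<in> I \<Longrightarrow> x \<oplus> y \<in> I"
    and "\<And>x. x \<in> I \<Longrightarrow> \<ominus> x \<in> I"
    and "\<And>x a. x \<in> I \<Longrightarrow> a \<in> carrier R \<Longrightarrow> a \<otimes> x \<in> I"
    and "\<And>x a. x \<in> I \<Longrightarrow> a \<in> carrier R \<Longrightarrow> x \<otimes> a \<in> I"
  shows "two_sided_ideal R I"
proof -
  have "subgroup I (add_monoid R)"
    by (rule add.subgroupI) (use assms in \<open>auto simp: a_inv_def[symmetric]\<close>)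
  then show ?thesis
    unfolding two_sided_ideal_def using assms(5,6) by (auto intro: additive_subgroupI)
qed

lemma two_sided_idealD:
  assumes "two_sided_ideal R I"
  shows "I \<subseteq> carrier R" "\<zero> \<in> I" "x \<in> I \<Longrightarrow> y \<in> I \<Longrightarrow> x \<oplus> y \<in> I" "x \<in> I \<Longrightarrow> \<ominus> x \<in> I"
    "x \<in> I \<Longrightarrow> a \<in> carrier R \<Longrightarrow> a \<otimes> x \<in> I" "x \<in> I \<Longrightarrow> a \<in> carrier R \<Longrightarrow> x \<otimes> a \<in> I"
proof -
  have I: "additive_subgroup I R" using assms by (simp add: two_sided_ideal_def)
  show "I \<subseteq> carrier R" "\<zero> \<in> I" "x \<in> I \<Longrightarrow> y \<in> I \<Longrightarrow> x \<oplus> y \<in> I"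
    using additive_subgroup.a_subset[OF I] additive_subgroup.zero_closed[OF I]
      additive_subgroup.a_closed[OF I] by auto
  show "x \<in> I \<Longrightarrow> \<ominus> x \<in> I"
    using add.subgroupE(3)[OF additive_subgroup.a_subgroup[OF I]] by (simp add: a_inv_def)
  show "x \<in> I \<Longrightarrow> a \<in> carrier R \<Longrightarrow> a \<otimes> x \<in> I" "x \<in> I \<Longrightarrow> a \<in> carrier R \<Longrightarrow> x \<otimes> a \<in> I"
    using assms by (auto simp: two_sided_ideal_def)
qed

lemma two_sided_ideal_carrier: "two_sided_ideal R (carrier R)"
  by (rule two_sided_idealI) (auto simp: m_closed)

lemma two_sided_ideal_Inter:
  assumes "\<And>i. i \<in> X \<Longrightarrow> two_sided_ideal R (I i)"
  shows "two_sided_ideal R (carrier R \<inter> (\<Inter>i\<in>X. I i))"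
  by (rule two_sided_idealI) (use two_sided_idealD[OF assms] m_closed in auto)

lemma ideal_prod_subset:
  assumes "two_sided_ideal R I" "two_sided_ideal R J"
  shows "I \<cdot> J \<subseteq> I \<inter> J"
proof
  fix s assume "s \<in> I \<cdot> J"
  then show "s \<in> I \<inter> J"
    using two_sided_idealD[OF assms(1)] two_sided_idealD[OF assms(2)]
    by (induction rule: ideal_prod.induct) auto
qed

lemma ideal_prod_least:
  assumes "two_sided_ideal R K" "\<And>i j. i \<in> I \<Longrightarrow> j \<in> J \<Longrightarrow> i \<otimes> j \<in> K"
  shows "I \<cdot> J \<subseteq> K"
proof
  fix s assume "s \<in> I \<cdot> J"
  then show "s \<in> K" using assms two_sided_idealD[OF assms(1)]
    by (induction rule: ideal_prod.induct) auto
qed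

lemma ideal_prod_mono:
  assumes "I \<subseteq> I'" "J \<subseteq> J'" shows "I \<cdot> J \<subseteq> I' \<cdot> J'"
proof
  fix s assume "s \<in> I \<cdot> J"
  then show "s \<in> I' \<cdot> J'"
    using assms by (induction rule: ideal_prod.induct) (auto intro: ideal_prod.intros)
qed

lemma two_sided_ideal_prod:
  assumes I: "two_sided_ideal R I" and J: "two_sided_ideal R J"
  shows "two_sided_ideal R (I \<cdot> J)"
proof -
  note D = two_sided_idealD[OF I] two_sided_idealD[OF J]
  have car: "x \<in> carrier R" if "x \<in> I \<cdot> J" for x
    using ideal_prod_subset[OF I J] that D(1) by blast
  have carI: "x \<in> carrier R" if "x \<in> I" for x using D(1) that by blast
  have carJ: "x \<in> carrier R" if "x \<in> J" for x using D(7) that by blast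
  show ?thesis
  proof (rule two_sided_idealI)
    show "\<zero> \<in> I \<cdot> J"
      using ideal_prod.prod[of \<zero> I \<zero> J R] D(2,8) by (simp add: l_zero_mult)
    show "\<ominus> x \<in> I \<cdot> J" if "x \<in> I \<cdot> J" for x
      using that
    proof (induction rule: ideal_prod.induct)
      case (prod i j)
      then have "(\<ominus> i) \<otimes> j \<in> I \<cdot> J" using D(4) by (intro ideal_prod.prod)
      then show ?case using prod carI carJ by (simp add: l_minus_mult)
    next
      case (sum s t)
      then have "\<ominus> s \<oplus> \<ominus> t \<in> I \<cdot> J" by (intro ideal_prod.sum)
      then show ?case using sum car by (simp add: minus_add)
    qed
    show "a \<otimes> x \<in> I \<cdot> J" if "x \<in> I \<cdot> J" "a \<in> carrier R" for x a
      using that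
    proof (induction rule: ideal_prod.induct)
      case (prod i j)
      then have "(a \<otimes> i) \<otimes> j \<in> I \<cdot> J" using D(5) by (intro ideal_prod.prod)
      then show ?case using prod carI carJ by (simp add: m_assoc)
    next
      case (sum s t)
      then have "a \<otimes> s \<oplus> a \<otimes> t \<in> I \<cdot> J" by (intro ideal_prod.sum)
      then show ?case using sum car by (simp add: r_distr)
    qed
    show "x \<otimes> a \<in> I \<cdot> J" if "x \<in> I \<cdot> J" "a \<in> carrier R" for x a
      using that
    proof (induction rule: ideal_prod.induct)
      case (prod i j)
      then have "i \<otimes> (j \<otimes> a) \<in> I \<cdot> J" using D(12) by (intro ideal_prod.prod)
      then show ?case using prod carI carJ by (simp add: m_assoc)
    next
      case (sum s t)
      then have "s \<otimes> a \<oplus> t \<otimes> a \<in> I \<cdot> J" by (intro ideal_prod.sum)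
      then show ?case using sum car by (simp add: l_distr)
    qed
  qed (use car in \<open>auto intro: ideal_prod.sum\<close>)
qed

lemma ideal_prod_assoc:
  assumes I: "two_sided_ideal R I" and J: "two_sided_ideal R J" and K: "two_sided_ideal R K"
  shows "I \<cdot> (J \<cdot> K) \<subseteq> (I \<cdot> J) \<cdot> K"
proof (rule ideal_prod_least)
  show "two_sided_ideal R ((I \<cdot> J) \<cdot> K)" by (intro two_sided_ideal_prod I J K)
  fix i s assume i: "i \<in> I" and s: "s \<in> J \<cdot> K"
  have car: "i \<in> carrier R" "J \<subseteq> carrier R" "K \<subseteq> carrier R" "J \<cdot> K \<subseteq> carrier R"
    using i two_sided_idealD(1) I J K two_sided_ideal_prod by blast+
  from s show "i \<otimes> s \<in> (I \<cdot> J) \<cdot> K"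
  proof (induction rule: ideal_prod.induct)
    case (prod j k)
    then have "(i \<otimes> j) \<otimes> k \<in> (I \<cdot> J) \<cdot> K" using i by (intro ideal_prod.prod)
    moreover have "j \<in> carrier R" "k \<in> carrier R" using prod car by auto
    ultimately show ?case using car by (simp add: m_assoc)
  next
    case (sum s t)
    then have "i \<otimes> s \<oplus> i \<otimes> t \<in> (I \<cdot> J) \<cdot> K" by (intro ideal_prod.sum)
    moreover have "s \<in> carrier R" "t \<in> carrier R" using sum car by auto
    ultimately show ?case using car by (simp add: r_distr)
  qed
qed

lemma two_sided_ideal_set_add:
  assumes I: "two_sided_ideal R I" and J: "two_sided_ideal R J"
  shows "two_sided_ideal R (set_add R I J)" "I \<subseteq> set_add R I J" "J \<subseteq> set_add R I J"
proof -
  note D = two_sided_idealD[OF I] two_sided_idealD[OF J]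
  have mem: "x \<in> set_add R I J \<longleftrightarrow> (\<exists>i\<in>I. \<exists>j\<in>J. x = i \<oplus> j)" for x
    by (auto simp: set_add_def')
  have carI: "x \<in> carrier R" if "x \<in> I" for x using D(1) that by blast
  have carJ: "x \<in> carrier R" if "x \<in> J" for x using D(7) that by blast
  show "two_sided_ideal R (set_add R I J)"
  proof (rule two_sided_idealI)
    show "set_add R I J \<subseteq> carrier R" using carI carJ by (auto simp: mem)
    show "\<zero> \<in> set_add R I J" using D(2,8) mem by force
    show "x \<oplus> y \<in> set_add R I J" if "x \<in> set_add R I J" "y \<in> set_add R I J" for x y
    proof -
      obtain i j i' j' where ij: "i \<in> I" "j \<in> J" "x = i \<oplus> j" "i' \<in> I" "j' \<in> J" "y = i' \<oplus> j'"
        using \<open>x \<in> _\<close> \<open>y \<in> _\<close> mem by blast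
      then have "x \<oplus> y = (i \<oplus> i') \<oplus> (j \<oplus> j')" using carI carJ by (simp add: a_ac)
      then show ?thesis using mem D(3,9) ij by blast
    qed
    show "\<ominus> x \<in> set_add R I J" if "x \<in> set_add R I J" for x
      using that mem D(4,10) carI carJ minus_add by metis
    show "a \<otimes> x \<in> set_add R I J" if "x \<in> set_add R I J" "a \<in> carrier R" for x a
      using that mem D(5,11) carI carJ r_distr by metis
    show "x \<otimes> a \<in> set_add R I J" if "x \<in> set_add R I J" "a \<in> carrier R" for x a
      using that mem D(6,12) carI carJ l_distr by metis
  qed
  show "I \<subseteq> set_add R I J" using mem D(8) carI r_zero by (metis subsetI)
  show "J \<subseteq> set_add R I J" using mem D(2) carJ l_zero by (metis subsetI)
qed

text \<open>
  The elements \<open>z\<close> with \<open>z R y \<subseteq> P\<close> form an ideal \<open>I\<close>, and the elements \<open>j\<close> with \<open>I R j \<subseteq> P\<close> form an ideal \<open>J\<close>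
  containing \<open>y\<close>. Without a unit \<open>I J \<subseteq> P\<close> is not clear, but \<open>(I R) J \<subseteq> P\<close> holds, and primeness is used a
  second time to pass from \<open>I R \<subseteq> P\<close> to \<open>I \<subseteq> P\<close>.
\<close>

lemma prime_ideal_elementwise:
  assumes P: "prime_ideal R P" and xy: "x \<in> carrier R" "y \<in> carrier R"
    and xay: "\<And>a. a \<in> carrier R \<Longrightarrow> x \<otimes> (a \<otimes> y) \<in> P"
  shows "x \<in> P \<or> y \<in> P"
proof -
  have tP: "two_sided_ideal R P" and neq: "P \<noteq> carrier R"
    and prime: "\<And>I J. two_sided_ideal R I \<Longrightarrow> two_sided_ideal R J \<Longrightarrow> I \<cdot> J \<subseteq> P \<Longrightarrow> I \<subseteq> P \<or> J \<subseteq> P"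
    using P by (auto simp: prime_ideal_def)
  note D = two_sided_idealD[OF tP]
  define I where "I = {z \<in> carrier R. \<forall>a \<in> carrier R. z \<otimes> (a \<otimes> y) \<in> P}"
  define J where "J = {j \<in> carrier R. \<forall>z \<in> I. \<forall>a \<in> carrier R. z \<otimes> (a \<otimes> j) \<in> P}"
  have carI: "z \<in> carrier R" if "z \<in> I" for z using that by (simp add: I_def)
  have I: "two_sided_ideal R I"
  proof (rule two_sided_idealI)
    show "c \<otimes> z \<in> I" if "z \<in> I" "c \<in> carrier R" for z c
      using that xy D(5) by (auto simp: I_def m_assoc m_closed)
    show "z \<otimes> c \<in> I" if "z \<in> I" "c \<in> carrier R" for z c
      using that xy by (auto simp: I_def m_assoc m_closed) (metis m_assoc m_closed)
  qed (use xy D in \<open>auto simp: I_def m_closed l_zero_mult l_distr l_minus_mult\<close>)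
  have J: "two_sided_ideal R J"
  proof (rule two_sided_idealI)
    show "c \<otimes> z \<in> J" if "z \<in> J" "c \<in> carrier R" for z c
      using that by (auto simp: J_def m_closed) (metis m_assoc m_closed)
    show "z \<otimes> c \<in> J" if z: "z \<in> J" and c: "c \<in> carrier R" for z c
    proof -
      have "i \<otimes> (a \<otimes> (z \<otimes> c)) \<in> P" if "i \<in> I" "a \<in> carrier R" for i a
      proof -
        have "(i \<otimes> (a \<otimes> z)) \<otimes> c \<in> P" using that z c D(6) by (auto simp: J_def)
        then show ?thesis using that z c carI by (auto simp: J_def m_assoc m_closed)
      qed
      then show ?thesis using z c by (auto simp: J_def m_closed)
    qed
  qed (use carI D in \<open>auto simp: J_def m_closed r_zero_mult r_distr r_minus_mult\<close>)
  have IL: "two_sided_ideal R (I \<cdot> carrier R)"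
    by (intro two_sided_ideal_prod I two_sided_ideal_carrier)
  have "(I \<cdot> carrier R) \<cdot> J \<subseteq> P"
  proof (rule ideal_prod_least[OF tP])
    fix s j assume "s \<in> I \<cdot> carrier R" and j: "j \<in> J"
    then show "s \<otimes> j \<in> P"
    proof (induction rule: ideal_prod.induct)
      case (prod i a)
      then show ?case using carI by (auto simp: J_def m_assoc)
    next
      case (sum s t)
      then have "s \<in> carrier R" "t \<in> carrier R" using two_sided_idealD(1)[OF IL] by auto
      then show ?case using sum D(3) by (auto simp: J_def l_distr)
    qed
  qed
  then consider "I \<cdot> carrier R \<subseteq> P" | "J \<subseteq> P" using prime IL J by blast
  then show ?thesis
  proof cases
    case 1
    then have "I \<subseteq> P" using prime[OF I two_sided_ideal_carrier] neq D(1) by blast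
    then show ?thesis using xay xy by (auto simp: I_def)
  next
    case 2
    then show ?thesis using xy by (auto simp: J_def I_def)
  qed
qed

section \<open>Powers of primes\<close>

lemma ideal_power_Suc: "r \<ge> 1 \<Longrightarrow> ideal_power R P (Suc r) = ideal_power R P r \<cdot> P"
  by (cases r) auto

lemma two_sided_ideal_power:
  assumes "two_sided_ideal R P" "r \<ge> 1" shows "two_sided_ideal R (ideal_power R P r)"
  using assms(2)
proof (induction rule: dec_induct)
  case (step r)
  then show ?case using assms(1) by (simp add: ideal_power_Suc two_sided_ideal_prod del: ideal_power.simps(3))
qed (use assms in simp)

lemma ideal_power_antimono:
  assumes "two_sided_ideal R P" "1 \<le> r" "r \<le> s"
  shows "ideal_power R P s \<subseteq> ideal_power R P r"
  using assms(3)
proof (induction rule: dec_induct)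
  case (step s)
  then show ?case
    using ideal_prod_subset[OF two_sided_ideal_power[OF assms(1), of s] assms(1)] assms(2)
    by (auto simp: ideal_power_Suc simp del: ideal_power.simps(3))
qed simp

lemma prime_ideal_power:
  assumes Q: "prime_ideal R Q" and P: "two_sided_ideal R P" and "r \<ge> 1" "ideal_power R P r \<subseteq> Q"
  shows "P \<subseteq> Q"
  using assms(3,4)
proof (induction rule: dec_induct)
  case (step r)
  then show ?case using Q P two_sided_ideal_power[OF P, of r]
    by (auto simp: ideal_power_Suc prime_ideal_def simp del: ideal_power.simps(3))
qed simp

lemma prime_ideal_Inter:
  assumes Q: "prime_ideal R Q" and "finite X" and I: "\<And>i. i \<in> X \<Longrightarrow> two_sided_ideal R (I i)"
    and "carrier R \<inter> (\<Inter>i\<in>X. I i) \<subseteq> Q"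
  shows "\<exists>i \<in> X. I i \<subseteq> Q"
  using assms(2,3,4)
proof (induction rule: finite_induct)
  case empty
  then show ?case using Q two_sided_idealD(1) by (auto simp: prime_ideal_def)
next
  case (insert i X)
  let ?K = "carrier R \<inter> (\<Inter>i\<in>X. I i)"
  have K: "two_sided_ideal R ?K" using insert.prems(1) by (intro two_sided_ideal_Inter) auto
  have Ii: "two_sided_ideal R (I i)" using insert.prems(1) by auto
  have "I i \<inter> ?K \<subseteq> Q" using insert.prems(2) by auto
  then have "I i \<cdot> ?K \<subseteq> Q" using ideal_prod_subset[OF Ii K] by (rule order_trans[rotated])
  then have "I i \<subseteq> Q \<or> ?K \<subseteq> Q" using Q Ii K by (auto simp: prime_ideal_def)
  then show ?case using insert.IH insert.prems(1) by auto
qed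

end

lemma irredundant_not_subset:
  assumes "irredundant X I" "i \<in> X" "j \<in> X" "i \<noteq> j"
  shows "\<not> I i \<subseteq> I j"
proof
  assume sub: "I i \<subseteq> I j"
  have "card X \<noteq> 1" using assms by (auto simp: card_1_singleton_iff)
  then have "\<not> (\<Inter>k \<in> X - {j}. I k) \<subseteq> I j" using assms by (auto simp: irredundant_def)
  then show False using sub assms(2,4) by blast
qed

text \<open>
  In a Dedekind domain this holds because a nonzero prime is properly contained only in the whole ring.
\<close>

locale prime_absorbing_ring = nonunital_ring +
  assumes absorb: "prime_ideal R P \<Longrightarrow> two_sided_ideal R Q \<Longrightarrow> P \<subset> Q \<Longrightarrow> P \<subseteq> P \<cdot> Q"
begin

lemma prime_ideal_two_sided: "prime_ideal R P \<Longrightarrow> two_sided_ideal R P"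
  by (simp add: prime_ideal_def)

lemma power_absorb:
  assumes P: "prime_ideal R P" and Q: "two_sided_ideal R Q" "P \<subset> Q" and "r \<ge> 1"
  shows "ideal_power R P r \<subseteq> ideal_power R P r \<cdot> Q"
proof (cases "r = 1")
  case True
  then show ?thesis using absorb[OF P Q] by simp
next
  case False
  then obtain s where s: "r = Suc s" "s \<ge> 1" using assms(4) by (cases r) auto
  have tP: "two_sided_ideal R P" using P prime_ideal_two_sided by blast
  have "ideal_power R P s \<cdot> P \<subseteq> ideal_power R P s \<cdot> (P \<cdot> Q)"
    by (intro ideal_prod_mono absorb P Q order_refl)
  also have "\<dots> \<subseteq> (ideal_power R P s \<cdot> P) \<cdot> Q"
    by (intro ideal_prod_assoc two_sided_ideal_power tP Q s)
  finally show ?thesis using s by (simp add: ideal_power_Suc del: ideal_power.simps(3))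
qed

lemma prime_subset_power:
  assumes P: "prime_ideal R P" and Q: "two_sided_ideal R Q" "P \<subset> Q" and "r \<ge> 1"
  shows "P \<subseteq> ideal_power R Q r"
  using assms(4)
proof (induction rule: dec_induct)
  case (step r)
  have "P \<subseteq> P \<cdot> Q" by (rule absorb[OF P Q])
  also have "\<dots> \<subseteq> ideal_power R Q r \<cdot> Q" by (intro ideal_prod_mono step.IH order_refl)
  finally show ?case using step by (simp add: ideal_power_Suc del: ideal_power.simps(3))
qed (use Q in auto)

text \<open>
  With \<open>Q = P + Y\<close> one has \<open>P\<^sup>t = P\<^sup>t Q \<subseteq> P\<^sup>t\<^sup>+\<^sup>1 + P\<^sup>t Y\<close>, and for \<open>s \<le> t < r\<close> the second summand lies in \<open>P\<^sup>r\<close>.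
\<close>

lemma prime_power_primary:
  assumes P: "prime_ideal R P" and Y: "two_sided_ideal R Y" "\<not> Y \<subseteq> P"
    and rs: "r \<ge> 1" "s \<ge> 1" and sub: "ideal_power R P s \<cdot> Y \<subseteq> ideal_power R P r"
  shows "ideal_power R P s \<subseteq> ideal_power R P r"
proof (cases "r \<le> s")
  case True
  then show ?thesis using ideal_power_antimono prime_ideal_two_sided P rs by blast
next
  case False
  have tP: "two_sided_ideal R P" using P prime_ideal_two_sided by blast
  note pow = two_sided_ideal_power[OF tP]
  have step: "ideal_power R P t \<subseteq> ideal_power R P (Suc t)" if t: "s \<le> t" "t < r" for t
  proof -
    have t1: "1 \<le> t" using t rs by simp
    have "P \<subset> set_add R P Y" using two_sided_ideal_set_add[OF tP Y(1)] Y(2) by blast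
    then have "ideal_power R P t \<subseteq> ideal_power R P t \<cdot> (set_add R P Y)"
      using power_absorb[OF P _ _ t1] two_sided_ideal_set_add[OF tP Y(1)] by blast
    also have "\<dots> \<subseteq> ideal_power R P (Suc t)"
    proof (rule ideal_prod_least[OF pow])
      fix x q assume x: "x \<in> ideal_power R P t" and "q \<in> set_add R P Y"
      then obtain p y where q: "q = p \<oplus> y" "p \<in> P" "y \<in> Y" by (auto simp: set_add_def')
      have "x \<otimes> p \<in> ideal_power R P (Suc t)"
        using x q t1 by (simp add: ideal_power_Suc ideal_prod.prod del: ideal_power.simps(3))
      moreover have "x \<otimes> y \<in> ideal_power R P (Suc t)"
      proof -
        have "x \<in> ideal_power R P s" using x ideal_power_antimono[OF tP rs(2) t(1)] by blast
        then have "x \<otimes> y \<in> ideal_power R P r"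
          using subsetD[OF sub ideal_prod.prod] q(3) by simp
        then show ?thesis using ideal_power_antimono[OF tP, of "Suc t" r] t by auto
      qed
      moreover have "x \<in> carrier R" "p \<in> carrier R" "y \<in> carrier R"
        using x q two_sided_idealD(1) pow[OF t1] tP Y(1) by blast+
      ultimately show "x \<otimes> q \<in> ideal_power R P (Suc t)"
        using two_sided_idealD(3)[OF pow[of "Suc t"]] q by (simp add: r_distr)
    qed simp
    finally show ?thesis .
  qed
  have "t \<le> r \<Longrightarrow> ideal_power R P s \<subseteq> ideal_power R P t" if "s \<le> t" for t
    using that
  proof (induction rule: dec_induct)
    case (step t)
    then show ?case using \<open>\<And>t. s \<le> t \<Longrightarrow> t < r \<Longrightarrow> _\<close>[of t] by auto
  qed simp
  then show ?thesis using False by simp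
qed

section \<open>Uniqueness of irredundant intersections\<close>

text \<open>
  Of two powers of the same prime one contains the other, and a prime properly inside \<open>P j\<close> is inside every power of
  \<open>P j\<close>. Either way one of the two components would be redundant.
\<close>

lemma irredundant_primes_incomparable:
  assumes X: "irredundant X (\<lambda>i. ideal_power R (P i) (r i))"
    and P: "\<And>i. i \<in> X \<Longrightarrow> prime_ideal R (P i)" and r: "\<And>i. i \<in> X \<Longrightarrow> r i \<ge> 1"
    and ij: "i \<in> X" "j \<in> X" and sub: "P i \<subseteq> P j"
  shows "i = j"
proof (rule ccontr)
  assume "i \<noteq> j"
  then have n: "\<not> ideal_power R (P i) (r i) \<subseteq> ideal_power R (P j) (r j)"
    "\<not> ideal_power R (P j) (r j) \<subseteq> ideal_power R (P i) (r i)"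
    using irredundant_not_subset[OF X] ij by blast+
  have t: "two_sided_ideal R (P i)" "two_sided_ideal R (P j)" using P ij prime_ideal_two_sided by auto
  show False
  proof (cases "P i = P j")
    case True
    then show False using ideal_power_antimono[OF t(1)] r ij n by (metis nat_le_linear)
  next
    case False
    then have "P i \<subseteq> ideal_power R (P j) (r j)"
      using prime_subset_power[OF P[OF ij(1)] t(2)] sub r ij by blast
    moreover have "ideal_power R (P i) (r i) \<subseteq> P i"
      using ideal_power_antimono[OF t(1), of 1 "r i"] r ij by simp
    ultimately show False using n by blast
  qed
qed

lemma prime_contains_factor:
  assumes U: "prime_ideal R U" and "finite Y"
    and Q: "\<And>j. j \<in> Y \<Longrightarrow> prime_ideal R (Q j)" and s: "\<And>j. j \<in> Y \<Longrightarrow> s j \<ge> 1"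
    and "carrier R \<inter> (\<Inter>j\<in>Y. ideal_power R (Q j) (s j)) \<subseteq> U"
  shows "\<exists>j \<in> Y. Q j \<subseteq> U"
proof -
  have "two_sided_ideal R (ideal_power R (Q j) (s j))" if "j \<in> Y" for j
    using that two_sided_ideal_power prime_ideal_two_sided Q s by blast
  then obtain j where "j \<in> Y" "ideal_power R (Q j) (s j) \<subseteq> U"
    using prime_ideal_Inter[OF U assms(2), of "\<lambda>j. ideal_power R (Q j) (s j)"] assms(5) by blast
  then show ?thesis using prime_ideal_power[OF U] prime_ideal_two_sided Q s by blast
qed

text \<open>
  The intersection \<open>K\<close> of the other components is not inside \<open>Q j\<close>, because the primes are incomparable. As
  \<open>Q\<^sub>j\<^sup>s K\<close> lies in the common intersection, hence in the component at \<open>i\<close>, the factor \<open>K\<close> can be dropped.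
\<close>

lemma irredundant_power_subset:
  assumes X: "finite X" and Y: "finite Y"
    and P: "\<And>i. i \<in> X \<Longrightarrow> prime_ideal R (P i)" and r: "\<And>i. i \<in> X \<Longrightarrow> r i \<ge> 1"
    and Q: "\<And>j. j \<in> Y \<Longrightarrow> prime_ideal R (Q j)" and s: "\<And>j. j \<in> Y \<Longrightarrow> s j \<ge> 1"
    and irred: "irredundant Y (\<lambda>j. ideal_power R (Q j) (s j))"
    and eq: "(\<Inter>i\<in>X. ideal_power R (P i) (r i)) = (\<Inter>j\<in>Y. ideal_power R (Q j) (s j))"
    and ij: "i \<in> X" "j \<in> Y" "P i = Q j"
  shows "ideal_power R (Q j) (s j) \<subseteq> ideal_power R (P i) (r i)"
proof -
  let ?K = "carrier R \<inter> (\<Inter>l\<in>Y - {j}. ideal_power R (Q l) (s l))"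
  have t: "two_sided_ideal R (ideal_power R (Q l) (s l))" if "l \<in> Y" for l
    using that two_sided_ideal_power prime_ideal_two_sided Q s by blast
  have K: "two_sided_ideal R ?K" using t by (intro two_sided_ideal_Inter) auto
  have "\<not> ?K \<subseteq> Q j"
  proof
    assume "?K \<subseteq> Q j"
    then obtain l where l: "l \<in> Y" "l \<noteq> j" "Q l \<subseteq> Q j"
      using prime_contains_factor[OF Q[OF ij(2)], of "Y - {j}" Q s] Q s Y by auto
    then have "l = j"
      by (intro irredundant_primes_incomparable[OF irred Q s l(1) ij(2)])
    then show False using l by simp
  qed
  moreover have "ideal_power R (Q j) (s j) \<cdot> ?K \<subseteq> ideal_power R (Q j) (r i)"
  proof -
    have "ideal_power R (Q j) (s j) \<cdot> ?K \<subseteq> (\<Inter>i\<in>X. ideal_power R (P i) (r i))"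
      unfolding eq using ideal_prod_subset[OF t[OF ij(2)] K] ij(2) by blast
    also have "\<dots> \<subseteq> ideal_power R (Q j) (r i)"
      using INF_lower[OF ij(1), of "\<lambda>i. ideal_power R (P i) (r i)"] unfolding ij(3) .
    finally show ?thesis .
  qed
  ultimately show ?thesis
    using prime_power_primary[OF Q[OF ij(2)] K _ r[OF ij(1)] s[OF ij(2)]] ij(3) by simp
qed

text \<open>
  A prime that contains an intersection of prime powers contains one of the primes. Going from one family to the
  other and back ends at the starting prime, by incomparability, so the two families have the same primes.
\<close>

lemma irredundant_image_subset:
  assumes X: "finite X" and Y: "finite Y" "Y \<noteq> {}"
    and P: "\<And>i. i \<in> X \<Longrightarrow> prime_ideal R (P i)" and r: "\<And>i. i \<in> X \<Longrightarrow> r i \<ge> 1"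
    and Q: "\<And>j. j \<in> Y \<Longrightarrow> prime_ideal R (Q j)" and s: "\<And>j. j \<in> Y \<Longrightarrow> s j \<ge> 1"
    and irredX: "irredundant X (\<lambda>i. ideal_power R (P i) (r i))"
    and irredY: "irredundant Y (\<lambda>j. ideal_power R (Q j) (s j))"
    and eq: "(\<Inter>i\<in>X. ideal_power R (P i) (r i)) = (\<Inter>j\<in>Y. ideal_power R (Q j) (s j))"
    and i: "i \<in> X"
  shows "\<exists>j \<in> Y. ideal_power R (P i) (r i) = ideal_power R (Q j) (s j)"
proof -
  have sub: "ideal_power R U t \<subseteq> U" if "prime_ideal R U" "t \<ge> 1" for U t
    using ideal_power_antimono[OF prime_ideal_two_sided[OF that(1)], of 1 t] that(2) by simp
  have "carrier R \<inter> (\<Inter>j\<in>Y. ideal_power R (Q j) (s j)) \<subseteq> P i"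
    unfolding eq[symmetric] using sub[OF P[OF i] r[OF i]] i by blast
  then have "\<exists>j \<in> Y. Q j \<subseteq> P i"
    by (intro prime_contains_factor[of "P i" Y Q s] P Q s i Y)
  then obtain j where j: "j \<in> Y" "Q j \<subseteq> P i" by blast
  have "carrier R \<inter> (\<Inter>i\<in>X. ideal_power R (P i) (r i)) \<subseteq> Q j"
    unfolding eq using sub[OF Q[OF j(1)] s[OF j(1)]] j by blast
  then have "\<exists>k \<in> X. P k \<subseteq> Q j"
    by (intro prime_contains_factor[of "Q j" X P r] P r Q j(1) X)
  then obtain k where k: "k \<in> X" "P k \<subseteq> Q j" by blast
  then have "k = i"
    by (intro irredundant_primes_incomparable[OF irredX P r _ i]) (use j k in auto)
  then have PQ: "P i = Q j" using k j by blast
  have "ideal_power R (Q j) (s j) \<subseteq> ideal_power R (P i) (r i)"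
    by (rule irredundant_power_subset[OF X Y(1) P r Q s irredY eq i j(1) PQ])
  moreover have "ideal_power R (P i) (r i) \<subseteq> ideal_power R (Q j) (s j)"
    by (rule irredundant_power_subset[OF Y(1) X Q s P r irredX eq[symmetric] j(1) i PQ[symmetric]])
  ultimately show ?thesis using j by blast
qed

theorem irredundant_unique:
  assumes X: "finite X" "X \<noteq> {}" and Y: "finite Y" "Y \<noteq> {}"
    and I: "\<And>i. i \<in> X \<Longrightarrow> prime_power_ideal R (I i)"
    and J: "\<And>j. j \<in> Y \<Longrightarrow> prime_power_ideal R (J j)"
    and irred: "irredundant X I" "irredundant Y J"
    and eq: "(\<Inter>i\<in>X. I i) = (\<Inter>j\<in>Y. J j)"
  shows "\<exists>\<sigma>. bij_betw \<sigma> X Y \<and> (\<forall>i \<in> X. I i = J (\<sigma> i))"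
proof -
  obtain P r where P: "\<And>i. i \<in> X \<Longrightarrow> prime_ideal R (P i) \<and> r i \<ge> 1 \<and> I i = ideal_power R (P i) (r i)"
    using I unfolding prime_power_ideal_def by metis
  obtain Q s where Q: "\<And>j. j \<in> Y \<Longrightarrow> prime_ideal R (Q j) \<and> s j \<ge> 1 \<and> J j = ideal_power R (Q j) (s j)"
    using J unfolding prime_power_ideal_def by metis
  have irX: "irredundant X (\<lambda>i. ideal_power R (P i) (r i))"
    using irred(1) P unfolding irredundant_def by simp
  have irY: "irredundant Y (\<lambda>j. ideal_power R (Q j) (s j))"
    using irred(2) Q unfolding irredundant_def by simp
  have eq': "(\<Inter>i\<in>X. ideal_power R (P i) (r i)) = (\<Inter>j\<in>Y. ideal_power R (Q j) (s j))"
    using eq P Q by simp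
  note facts = conjunct1[OF P] conjunct1[OF conjunct2[OF P]] conjunct1[OF Q] conjunct1[OF conjunct2[OF Q]]
  have 1: "\<exists>j \<in> Y. I i = J j" if i: "i \<in> X" for i
  proof -
    have "\<exists>j \<in> Y. ideal_power R (P i) (r i) = ideal_power R (Q j) (s j)"
      by (rule irredundant_image_subset[OF X(1) Y facts irX irY eq' i])
    then show ?thesis using P[OF i] Q by auto
  qed
  have 2: "\<exists>i \<in> X. J j = I i" if j: "j \<in> Y" for j
  proof -
    have "\<exists>i \<in> X. ideal_power R (Q j) (s j) = ideal_power R (P i) (r i)"
      by (rule irredundant_image_subset[OF Y(1) X facts(3,4,1,2) irY irX eq'[symmetric] j])
    then show ?thesis using Q[OF j] P by auto
  qed
  obtain \<sigma> where \<sigma>: "\<And>i. i \<in> X \<Longrightarrow> \<sigma> i \<in> Y \<and> I i = J (\<sigma> i)" using 1 by metis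
  have "inj_on \<sigma> X"
    using irredundant_not_subset[OF irred(1)] \<sigma> by (metis inj_onI order_refl)
  moreover have "\<sigma> ` X = Y"
  proof
    show "Y \<subseteq> \<sigma> ` X"
    proof
      fix j assume j: "j \<in> Y"
      then obtain i where i: "i \<in> X" "J j = I i" using 2 by blast
      then have "\<sigma> i = j" using irredundant_not_subset[OF irred(2)] \<sigma> j by (metis order_refl)
      then show "j \<in> \<sigma> ` X" using i by blast
    qed
  qed (use \<sigma> in blast)
  ultimately show ?thesis using \<sigma> by (auto simp: bij_betw_def)
qed

end

section \<open>Ideals of a quotient as ideals of an ambient ring\<close>

locale ring_quotient =
  fixes R :: "'a::ring_1 ring" and N0 :: "'a set"
  assumes R: "monoid.mult R = (*)" "ring.zero R = 0" "ring.add R = (+)"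
    and F: "0 \<in> carrier R" "x \<in> carrier R \<Longrightarrow> y \<in> carrier R \<Longrightarrow> x + y \<in> carrier R"
      "x \<in> carrier R \<Longrightarrow> - x \<in> carrier R"
      "x \<in> carrier R \<Longrightarrow> y \<in> carrier R \<Longrightarrow> x * y \<in> carrier R"
    and N0: "N0 \<subseteq> carrier R" "0 \<in> N0" "p \<in> N0 \<Longrightarrow> q \<in> N0 \<Longrightarrow> p + q \<in> N0" "p \<in> N0 \<Longrightarrow> - p \<in> N0"
      "p \<in> N0 \<Longrightarrow> x \<in> carrier R \<Longrightarrow> x * p \<in> N0" "p \<in> N0 \<Longrightarrow> x \<in> carrier R \<Longrightarrow> p * x \<in> N0"
begin

abbreviation L :: "'a set ring" where "L \<equiv> R Quot N0"

definition cls :: "'a \<Rightarrow> 'a set" where "cls x = N0 +>\<^bsub>R\<^esub> x"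

lemma mem_cls: "y \<in> cls x \<longleftrightarrow> y - x \<in> N0"
proof
  assume "y \<in> cls x"
  then show "y - x \<in> N0" by (auto simp: cls_def a_r_coset_def' R)
next
  assume "y - x \<in> N0"
  then show "y \<in> cls x" by (auto simp: cls_def a_r_coset_def' R intro!: bexI[of _ "y - x"])
qed

lemma N0_diff: "p \<in> N0 \<Longrightarrow> q \<in> N0 \<Longrightarrow> p - q \<in> N0"
  using N0(3)[of p "- q"] N0(4) by simp

lemma cls_eq_iff: "cls x = cls y \<longleftrightarrow> x - y \<in> N0"
proof
  assume "cls x = cls y"
  moreover have "x \<in> cls x" by (simp add: mem_cls N0)
  ultimately show "x - y \<in> N0" by (simp add: mem_cls)
next
  assume xy: "x - y \<in> N0"
  have "z - x \<in> N0 \<longleftrightarrow> z - y \<in> N0" for z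
    using N0(3)[OF _ xy, of "z - x"] N0_diff[OF _ xy, of "z - y"] by auto
  then show "cls x = cls y" by (auto simp: mem_cls)
qed

lemma carrier_L: "carrier L = cls ` carrier R"
  by (auto simp: FactRing_def A_RCOSETS_def' cls_def)

lemma zero_L: "\<zero>\<^bsub>L\<^esub> = cls 0"
  by (auto simp: FactRing_def mem_cls)

lemma add_L:
  assumes "x \<in> carrier R" "y \<in> carrier R"
  shows "cls x \<oplus>\<^bsub>L\<^esub> cls y = cls (x + y)"
proof -
  have 1: "a + b \<in> cls (x + y)" if "a \<in> cls x" "b \<in> cls y" for a b
    using N0(3)[of "a - x" "b - y"] that by (simp add: mem_cls algebra_simps)
  have 2: "\<exists>a \<in> cls x. \<exists>b \<in> cls y. z = a + b" if "z \<in> cls (x + y)" for z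
    using that N0(2) by (intro bexI[of _ "z - y"] bexI[of _ y]) (auto simp: mem_cls algebra_simps)
  have "cls x \<oplus>\<^bsub>L\<^esub> cls y = {a + b | a b. a \<in> cls x \<and> b \<in> cls y}"
    by (auto simp: FactRing_def set_add_def' R)
  also have "\<dots> = cls (x + y)"
  proof (intro equalityI subsetI)
    fix z assume "z \<in> {a + b | a b. a \<in> cls x \<and> b \<in> cls y}"
    then obtain a b where "z = a + b" "a \<in> cls x" "b \<in> cls y" by blast
    then show "z \<in> cls (x + y)" using 1 by simp
  next
    fix z assume "z \<in> cls (x + y)"
    from 2[OF this] show "z \<in> {a + b | a b. a \<in> cls x \<and> b \<in> cls y}" by blast
  qed
  finally show ?thesis .
qed

lemma mult_L:
  assumes x: "x \<in> carrier R" and y: "y \<in> carrier R"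
  shows "cls x \<otimes>\<^bsub>L\<^esub> cls y = cls (x * y)"
proof -
  have 1: "cls (a * b) = cls (x * y)" if "a \<in> cls x" "b \<in> cls y" for a b
  proof -
    have ax: "a - x \<in> N0" and byN: "b - y \<in> N0" using that by (auto simp: mem_cls)
    have "b = (b - y) + y" by simp
    then have b: "b \<in> carrier R" using F(2) N0(1) byN y by (metis subsetD)
    have "a * b - x * y = (a - x) * b + x * (b - y)" by (simp add: algebra_simps)
    also have "\<dots> \<in> N0" by (rule N0(3)[OF N0(6)[OF ax b] N0(5)[OF byN x]])
    finally show ?thesis by (simp add: cls_eq_iff)
  qed
  have ne: "cls x \<noteq> {}" "cls y \<noteq> {}" using N0(2) mem_cls[of x x] mem_cls[of y y] by auto
  have "cls x \<otimes>\<^bsub>L\<^esub> cls y = (\<Union>a\<in>cls x. \<Union>b\<in>cls y. cls (a * b))"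
    by (simp add: FactRing_def rcoset_mult_def cls_def R)
  also have "\<dots> = (\<Union>a\<in>cls x. \<Union>b\<in>cls y. cls (x * y))"
    by (intro SUP_cong refl 1)
  finally show ?thesis using ne by simp
qed

lemma L_ops: "x \<in> carrier R \<Longrightarrow> cls x \<in> carrier L"
  by (simp add: carrier_L)

sublocale L: nonunital_ring L
proof (intro nonunital_ring.intro nonunital_ring_axioms.intro)
  show "abelian_group L"
  proof (rule abelian_groupI)
    fix x assume "x \<in> carrier L"
    then obtain y where y: "y \<in> carrier R" "x = cls y" by (auto simp: carrier_L)
    then have "cls (- y) \<in> carrier L" "cls (- y) \<oplus>\<^bsub>L\<^esub> x = \<zero>\<^bsub>L\<^esub>"
      by (simp_all add: L_ops F add_L zero_L)
    then show "\<exists>z \<in> carrier L. z \<oplus>\<^bsub>L\<^esub> x = \<zero>\<^bsub>L\<^esub>" by blast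
  qed (auto simp: carrier_L zero_L add_L F algebra_simps)
qed (auto simp: carrier_L add_L mult_L F algebra_simps)

end

text \<open>
  Here \<open>R\<close> is a subring without unit of \<open>'a\<close>, and \<open>B\<close> an ideal of \<open>'a\<close> such that \<open>'a\<close> is the sum of the scalars, \<open>R\<close>
  and \<open>B\<close>. In the application \<open>R\<close> is the free algebra on the generators, and \<open>B\<close> is spanned by the words that contain other
  letters. Local units in the quotient make its ideals closed under scalars.
\<close>

locale augmented_quotient = ring_quotient R N0
  for R :: "'a::ring_1 ring" and N0 :: "'a set" +
  fixes B :: "'a set" and sc :: "'k::field \<Rightarrow> 'a"
  assumes B: "alg_ideal B" and decomp: "\<exists>k x b. x \<in> carrier R \<and> b \<in> B \<and> a = sc k + x + b"
    and R_B: "x \<in> carrier R \<Longrightarrow> x \<in> B \<Longrightarrow> x = 0"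
    and sc_comm: "sc k * a = a * sc k"
    and sc_R: "x \<in> carrier R \<Longrightarrow> sc k * x \<in> carrier R"
    and sc_N0: "x \<in> N0 \<Longrightarrow> sc k * x \<in> N0"
    and local_unit: "x \<in> carrier R \<Longrightarrow> \<exists>u \<in> carrier R. x * u - x \<in> N0"
begin

text \<open>
  The ideal of the ambient ring that corresponds to an ideal \<open>I\<close> of the quotient: the preimage of \<open>I\<close> in \<open>R\<close>, enlarged
  by \<open>B\<close> so as to absorb the whole ambient ring.
\<close>

definition hat :: "'a set set \<Rightarrow> 'a set" where
  "hat I = {x + b | x b. x \<in> carrier R \<and> cls x \<in> I \<and> b \<in> B}"

lemma hatI: "x \<in> carrier R \<Longrightarrow> cls x \<in> I \<Longrightarrow> b \<in> B \<Longrightarrow> x + b \<in> hat I"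
  by (auto simp: hat_def)

lemma hatE:
  assumes "z \<in> hat I" obtains x b where "z = x + b" "x \<in> carrier R" "cls x \<in> I" "b \<in> B"
  using assms by (auto simp: hat_def)

lemma hat_mono: "I \<subseteq> J \<Longrightarrow> hat I \<subseteq> hat J"
  by (auto simp: hat_def)

lemma hat_iff: "x \<in> carrier R \<Longrightarrow> x \<in> hat I \<longleftrightarrow> cls x \<in> I"
proof
  assume x: "x \<in> carrier R" and "x \<in> hat I"
  then obtain y b where y: "x = y + b" "y \<in> carrier R" "cls y \<in> I" "b \<in> B" unfolding hat_def by blast
  then have "b = x + - y" by simp
  then have "b \<in> carrier R" using F(2,3) x y(2) by metis
  then have "b = 0" using R_B y(4) by blast
  then show "cls x \<in> I" using y by simp
next
  assume "x \<in> carrier R" "cls x \<in> I"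
  then show "x \<in> hat I" using hatI[of x I 0] alg_ideal_zero[OF B] by simp
qed

lemma hat_subset_cancel:
  assumes "hat I \<subseteq> hat J" "I \<subseteq> carrier L"
  shows "I \<subseteq> J"
proof
  fix c assume c: "c \<in> I"
  then obtain x where x: "x \<in> carrier R" "c = cls x" using assms(2) by (auto simp: carrier_L)
  then have "x \<in> hat I" using hat_iff c by blast
  then have "x \<in> hat J" using assms(1) by blast
  then show "c \<in> J" using hat_iff x by blast
qed

lemma alg_ideal_hat:
  assumes I: "two_sided_ideal L I"
  shows "alg_ideal (hat I)"
proof -
  note D = L.two_sided_idealD[OF I]
  \<comment> \<open>A scalar multiple of \<open>x\<close> is the product of \<open>x\<close> with the same multiple of a local unit.\<close>
  have scale: "cls (sc k * x) \<in> I" if x: "x \<in> carrier R" "cls x \<in> I" for k x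
  proof -
    obtain u where u: "u \<in> carrier R" "x * u - x \<in> N0" using local_unit x by blast
    have "x * (sc k * u) = sc k * (x * u)"
      by (simp only: mult.assoc[symmetric] sc_comm[of k x])
    then have "x * (sc k * u) - sc k * x = sc k * (x * u - x)"
      by (simp only: right_diff_distrib)
    then have "x * (sc k * u) - sc k * x \<in> N0" using sc_N0 u by simp
    then have "cls (sc k * x) = cls x \<otimes>\<^bsub>L\<^esub> cls (sc k * u)"
      using u x by (simp add: mult_L sc_R cls_eq_iff[symmetric])
    then show ?thesis using D(6)[OF x(2)] L_ops sc_R u by simp
  qed
  have add: "x + y \<in> hat I" if xy: "x \<in> hat I" "y \<in> hat I" for x y
  proof -
    obtain f b where x: "x = f + b" "f \<in> carrier R" "cls f \<in> I" "b \<in> B"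
      by (rule hatE[OF xy(1)])
    obtain g c where y: "y = g + c" "g \<in> carrier R" "cls g \<in> I" "c \<in> B"
      by (rule hatE[OF xy(2)])
    note 1 = x y
    have "cls (f + g) \<in> I" using D(3)[OF 1(3,7)] 1 by (simp add: add_L)
    then have "(f + g) + (b + c) \<in> hat I" by (intro hatI F(2) alg_ideal_add[OF B] 1)
    then show ?thesis using 1 by (simp add: algebra_simps)
  qed
  have B_hat: "b \<in> hat I" if "b \<in> B" for b
    using hatI[of 0 I b] that F(1) D(2) zero_L by simp
  have mult: "a * x \<in> hat I \<and> x * a \<in> hat I" if x: "x \<in> hat I" for a x
  proof -
    obtain f b where 1: "x = f + b" "f \<in> carrier R" "cls f \<in> I" "b \<in> B" by (rule hatE[OF x])
    obtain k g c where 2: "g \<in> carrier R" "c \<in> B" "a = sc k + g + c" using decomp by blast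
    have k: "sc k * f \<in> hat I" using scale sc_R hat_iff 1 by blast
    have gf: "g * f \<in> hat I" "f * g \<in> hat I"
      using D(5)[OF 1(3), of "cls g"] D(6)[OF 1(3), of "cls g"] hat_iff L_ops F(4) 1(2) 2(1)
      by (auto simp: mult_L)
    have "c * f + a * b \<in> hat I" "f * c + b * a \<in> hat I"
      by (intro B_hat alg_ideal_add[OF B] alg_ideal_lmult[OF B 1(4)] alg_ideal_rmult[OF B 2(2)]
          alg_ideal_lmult[OF B 2(2)] alg_ideal_rmult[OF B 1(4)])+
    moreover have "a * x = sc k * f + g * f + (c * f + a * b)"
      using 1 2 by (simp add: algebra_simps)
    moreover have "x * a = sc k * f + f * g + (f * c + b * a)"
      using 1 2 sc_comm[of k f] by (simp add: algebra_simps)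
    ultimately show ?thesis using add k gf by simp
  qed
  show ?thesis
    unfolding alg_ideal_def using add mult B_hat[OF alg_ideal_zero[OF B]] by simp
qed

lemma hat_prod:
  assumes x: "x \<in> hat I" and y: "y \<in> hat J" and IJ: "two_sided_ideal L (I \<cdot>\<^bsub>L\<^esub> J)"
  shows "x * y \<in> hat (I \<cdot>\<^bsub>L\<^esub> J)"
proof -
  obtain f b where x': "x = f + b" "f \<in> carrier R" "cls f \<in> I" "b \<in> B" by (rule hatE[OF x])
  obtain g c where y': "y = g + c" "g \<in> carrier R" "cls g \<in> J" "c \<in> B" by (rule hatE[OF y])
  note 1 = x' y'
  have "cls (f * g) \<in> I \<cdot>\<^bsub>L\<^esub> J" using ideal_prod.prod[of _ I _ J L, OF 1(3,7)] 1 by (simp add: mult_L)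
  moreover have "f * c + b * y \<in> B"     by (intro alg_ideal_add[OF B] alg_ideal_lmult[OF B 1(8)] alg_ideal_rmult[OF B 1(4)])
  ultimately have "f * g + (f * c + b * y) \<in> hat (I \<cdot>\<^bsub>L\<^esub> J)" using 1 by (intro hatI F(4))
  then show ?thesis using 1 by (simp add: algebra_simps)
qed

text \<open>
  The components of \<open>x\<close> and \<open>y\<close> in \<open>B\<close> may be ignored, because \<open>B\<close> lies in every \<open>hat I\<close>.
\<close>

lemma hat_prime:
  assumes P: "prime_ideal L P" and xy: "x \<in> hat (carrier L)" "y \<in> hat (carrier L)"
    and xay: "\<And>a. x * a * y \<in> hat P"
  shows "x \<in> hat P \<or> y \<in> hat P"
proof -
  have tP: "two_sided_ideal L P" using P by (simp add: prime_ideal_def)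
  note id = alg_ideal_hat[OF tP]
  have B_hat: "b \<in> hat P" if "b \<in> B" for b
    using hatI[of 0 P b] that F(1) L.two_sided_idealD(2)[OF tP] zero_L by simp
  obtain f b where x: "x = f + b" "f \<in> carrier R" "b \<in> B" by (rule hatE[OF xy(1)])
  obtain g c where y: "y = g + c" "g \<in> carrier R" "c \<in> B" by (rule hatE[OF xy(2)])
  note 1 = x y
  have "cls f \<otimes>\<^bsub>L\<^esub> (a \<otimes>\<^bsub>L\<^esub> cls g) \<in> P" if a: "a \<in> carrier L" for a
  proof -
    obtain h where h: "h \<in> carrier R" "a = cls h" using a by (auto simp: carrier_L)
    have "x * h * y - (f * (h * c) + b * (h * y)) \<in> hat P"
      using 1 by (intro alg_ideal_diff[OF id] xay alg_ideal_add[OF id] alg_ideal_lmult[OF id B_hat]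
          alg_ideal_lmult[OF id, of "h * c"] alg_ideal_rmult[OF id B_hat])
    moreover have "x * h * y - (f * (h * c) + b * (h * y)) = f * (h * g)"
      using 1 by (simp add: algebra_simps)
    ultimately have "cls (f * (h * g)) \<in> P" using hat_iff F(4) 1 h by metis
    then show ?thesis using h 1 F(4) by (simp add: mult_L)
  qed
  then have "cls f \<in> P \<or> cls g \<in> P"
    by (intro L.prime_ideal_elementwise[OF P]) (use L_ops 1 in auto)
  then show ?thesis using hatI 1 by blast
qed

end

section \<open>The Leavitt path algebra as a quotient of the free algebra\<close>

lemma zero_gen_word_iff: "w = 0 \<longleftrightarrow> letters w = []"
  by (cases w) (simp add: zero_gen_word_def)

lemma letters_plus [simp]: "letters (u + w) = letters u @ letters w"
  by (simp add: plus_gen_word_def)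

lemma keys_uminus [simp]: "Poly_Mapping.keys (- p) = Poly_Mapping.keys (p :: _ \<Rightarrow>\<^sub>0 'b::ab_group_add)"
  by (auto simp: in_keys_iff)

lemma sum_singles: "p = (\<Sum>w\<in>Poly_Mapping.keys p. Poly_Mapping.single w (Poly_Mapping.lookup p w))"
proof (rule poly_mapping_eqI)
  fix k
  have "(\<Sum>w\<in>Poly_Mapping.keys p. Poly_Mapping.lookup p w when w = k) = Poly_Mapping.lookup p k"
    by (simp add: when_def in_keys_iff)
  then show "Poly_Mapping.lookup p k =
      Poly_Mapping.lookup (\<Sum>w\<in>Poly_Mapping.keys p. Poly_Mapping.single w (Poly_Mapping.lookup p w)) k"
    by (simp add: lookup_sum lookup_single)
qed

abbreviation scalar :: "'k::field \<Rightarrow> 'g gen_word \<Rightarrow>\<^sub>0 'k" where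
  "scalar \<equiv> Poly_Mapping.single 0"

lemma scalar_comm: "scalar k * p = p * (scalar k :: 'g gen_word \<Rightarrow>\<^sub>0 'k::field)"
proof -
  have "scalar k * p = (\<Sum>w\<in>Poly_Mapping.keys p. scalar k * Poly_Mapping.single w (Poly_Mapping.lookup p w))"
    by (subst sum_singles) (simp add: sum_distrib_left)
  also have "\<dots> = (\<Sum>w\<in>Poly_Mapping.keys p. Poly_Mapping.single w (Poly_Mapping.lookup p w) * scalar k)"
    by (simp add: mult_single mult.commute)
  also have "\<dots> = p * scalar k"
    by (subst (3) sum_singles) (simp add: sum_distrib_right)
  finally show ?thesis .
qed

lemma single_word:
  fixes w :: "'g gen_word" and k :: "'k::field"
  shows "Poly_Mapping.single w k = scalar k * prod_list (map gen (letters w))"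
proof -
  have "prod_list (map gen xs) = Poly_Mapping.single (Word xs) (1::'k)" for xs :: "'g list"
  proof (induction xs)
    case Nil
    then show ?case by (simp add: zero_gen_word_def[symmetric])
  next
    case (Cons x xs)
    then show ?case by (simp add: gen_def mult_single plus_gen_word_def)
  qed
  then show ?thesis by (cases w) (simp add: mult_single)
qed

context
  fixes E :: "('v, 'e) pre_digraph" and N0 :: "(('v, 'e) lpa_gen gen_word \<Rightarrow>\<^sub>0 'k::field) set"
    and R :: "(('v, 'e) lpa_gen gen_word \<Rightarrow>\<^sub>0 'k) ring"
    and B :: "(('v, 'e) lpa_gen gen_word \<Rightarrow>\<^sub>0 'k) set"
  assumes wf: "wf_digraph E"
  defines "R \<equiv> free_algebra (lpa_gens E)"
    and "N0 \<equiv> free_algebra_ideal (lpa_gens E) (lpa_relators E)"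
    and "B \<equiv> {p. \<forall>w \<in> Poly_Mapping.keys p. \<not> set (letters w) \<subseteq> lpa_gens E}"
begin

lemma carrier_R: "carrier R = {p. \<forall>w \<in> Poly_Mapping.keys p. w \<noteq> 0 \<and> set (letters w) \<subseteq> lpa_gens E}"
  and R_ops: "monoid.mult R = (*)" "ring.zero R = 0" "ring.add R = (+)"
  by (simp_all add: R_def free_algebra_def)

lemma R_closed:
  "0 \<in> carrier R" "x \<in> carrier R \<Longrightarrow> y \<in> carrier R \<Longrightarrow> x + y \<in> carrier R"
  "x \<in> carrier R \<Longrightarrow> - x \<in> carrier R"
  "x \<in> carrier R \<Longrightarrow> y \<in> carrier R \<Longrightarrow> x * y \<in> carrier R"
  "x \<in> carrier R \<Longrightarrow> scalar k * x \<in> carrier R"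
proof -
  show "0 \<in> carrier R" "x \<in> carrier R \<Longrightarrow> - x \<in> carrier R" by (simp_all add: carrier_R)
  show "x + y \<in> carrier R" if "x \<in> carrier R" "y \<in> carrier R"
    using that keys_add[of x y] by (auto simp: carrier_R)
  show "x * y \<in> carrier R" if "x \<in> carrier R" "y \<in> carrier R"
    using that keys_mult[of x y] by (fastforce simp: carrier_R zero_gen_word_iff)
  show "scalar k * x \<in> carrier R" if "x \<in> carrier R"
    using that keys_mult[of "scalar k" x] by (fastforce simp: carrier_R zero_gen_word_iff split: if_splits)
qed

lemma R_diff: "x \<in> carrier R \<Longrightarrow> y \<in> carrier R \<Longrightarrow> x - y \<in> carrier R"
  using R_closed(2)[of x "- y"] R_closed(3) by simp

lemma R_sum: "(\<And>i. i \<in> A \<Longrightarrow> f i \<in> carrier R) \<Longrightarrow> sum f A \<in> carrier R"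
  by (induction A rule: infinite_finite_induct) (auto simp: R_closed)

lemma gen_R: "g \<in> lpa_gens E \<Longrightarrow> gen g \<in> carrier R"
  by (auto simp: carrier_R gen_def zero_gen_word_iff)

lemma gens:
  "v \<in> verts E \<Longrightarrow> Vert v \<in> lpa_gens E"
  "e \<in> arcs E \<Longrightarrow> Edge e \<in> lpa_gens E" "e \<in> arcs E \<Longrightarrow> Ghost e \<in> lpa_gens E"
  "e \<in> arcs E \<Longrightarrow> Vert (tail E e) \<in> lpa_gens E" "e \<in> arcs E \<Longrightarrow> Vert (head E e) \<in> lpa_gens E"
  using wf by (auto simp: lpa_gens_def wf_digraph_def)

lemma relators_R: "lpa_relators E \<subseteq> carrier R"
  unfolding lpa_relators_def
  by (auto intro!: R_diff R_closed gen_R gens R_sum simp: regular_vertex_def)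

lemma N0_R: "N0 \<subseteq> carrier R"
proof
  fix p assume "p \<in> N0"
  then show "p \<in> carrier R" unfolding N0_def
    by (induction rule: free_algebra_ideal.induct) (use relators_R R_closed in \<open>auto simp: R_def\<close>)
qed

lemma N0_closed:
  "0 \<in> N0" "p \<in> N0 \<Longrightarrow> q \<in> N0 \<Longrightarrow> p + q \<in> N0" "p \<in> N0 \<Longrightarrow> - p \<in> N0"
  "p \<in> N0 \<Longrightarrow> x \<in> carrier R \<Longrightarrow> x * p \<in> N0" "p \<in> N0 \<Longrightarrow> x \<in> carrier R \<Longrightarrow> p * x \<in> N0"
  "p \<in> N0 \<Longrightarrow> scalar k * p \<in> N0"
proof -
  show "- p \<in> N0" if "p \<in> N0"
    using free_algebra_ideal.scale[of p "lpa_gens E" "lpa_relators E" "- 1"] that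
    by (simp add: N0_def single_uminus)
qed (auto simp: N0_def R_def intro: free_algebra_ideal.intros)

lemma relations:
  "v \<in> verts E \<Longrightarrow> w \<in> verts E \<Longrightarrow>
    gen (Vert v) * gen (Vert w) - (if v = w then gen (Vert v) else 0) \<in> N0"
  "e \<in> arcs E \<Longrightarrow> gen (Vert (tail E e)) * gen (Edge e) - gen (Edge e) \<in> N0"
  "e \<in> arcs E \<Longrightarrow> gen (Edge e) * gen (Vert (head E e)) - gen (Edge e) \<in> N0"
  "e \<in> arcs E \<Longrightarrow> gen (Vert (head E e)) * gen (Ghost e) - gen (Ghost e) \<in> N0"
  "e \<in> arcs E \<Longrightarrow> gen (Ghost e) * gen (Vert (tail E e)) - gen (Ghost e) \<in> N0"
  "e \<in> arcs E \<Longrightarrow> f \<in> arcs E \<Longrightarrow>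
    gen (Ghost e) * gen (Edge f) - (if e = f then gen (Vert (head E e)) else 0) \<in> N0"
  \<comment> \<open>The relators form a union of seven families, nested to the left; the rules for unions select the family.\<close>
  unfolding N0_def
  subgoal by (rule free_algebra_ideal.base, unfold lpa_relators_def, rule UnI1, rule UnI1, rule UnI1, rule UnI1, rule UnI1, rule UnI1, rule CollectI, rule exI[of _ v], rule exI[of _ w]) simp
  subgoal by (rule free_algebra_ideal.base, unfold lpa_relators_def, rule UnI1, rule UnI1, rule UnI1, rule UnI1, rule UnI1, rule UnI2, rule CollectI, rule exI[of _ e]) simp
  subgoal by (rule free_algebra_ideal.base, unfold lpa_relators_def, rule UnI1, rule UnI1, rule UnI1, rule UnI1, rule UnI2, rule CollectI, rule exI[of _ e]) simp
  subgoal by (rule free_algebra_ideal.base, unfold lpa_relators_def, rule UnI1, rule UnI1, rule UnI1, rule UnI2, rule CollectI, rule exI[of _ e]) simp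
  subgoal by (rule free_algebra_ideal.base, unfold lpa_relators_def, rule UnI1, rule UnI1, rule UnI2, rule CollectI, rule exI[of _ e]) simp
  subgoal by (rule free_algebra_ideal.base, unfold lpa_relators_def, rule UnI1, rule UnI2, rule CollectI, rule exI[of _ e], rule exI[of _ f]) simp
  done

lemma N0_sum: "(\<And>i. i \<in> A \<Longrightarrow> f i \<in> N0) \<Longrightarrow> sum f A \<in> N0"
  by (induction A rule: infinite_finite_induct) (auto simp: N0_closed)

lemma single_R: "w \<noteq> 0 \<Longrightarrow> set (letters w) \<subseteq> lpa_gens E \<Longrightarrow> Poly_Mapping.single w k \<in> carrier R"
  by (auto simp: carrier_R)

lemma gen_right_unit:
  assumes "g \<in> lpa_gens E"
  shows "\<exists>r \<in> verts E. gen g * gen (Vert r) - gen g \<in> N0"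
proof -
  from assms consider v where "g = Vert v" "v \<in> verts E" | e where "g = Edge e" "e \<in> arcs E"
    | e where "g = Ghost e" "e \<in> arcs E"
    by (auto simp: lpa_gens_def)
  then show ?thesis
  proof cases
    case 1
    then show ?thesis using relations(1)[of v v] by auto
  next
    case 2
    then show ?thesis using relations(3)[of e] wf by (auto simp: wf_digraph_def)
  next
    case 3
    then show ?thesis using relations(5)[of e] wf by (auto simp: wf_digraph_def)
  qed
qed

lemma single_right_unit:
  assumes "w \<noteq> 0" "set (letters w) \<subseteq> lpa_gens E"
  shows "\<exists>r \<in> verts E. Poly_Mapping.single w k * gen (Vert r) - Poly_Mapping.single w k \<in> N0"
proof -
  have "letters w \<noteq> []" using assms(1) by (simp add: zero_gen_word_iff)
  then obtain xs g where xs: "letters w = xs @ [g]" by (metis rev_exhaust)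
  obtain r where r: "r \<in> verts E" "gen g * gen (Vert r) - gen g \<in> N0"
    using gen_right_unit[of g] assms xs by auto
  let ?p = "Poly_Mapping.single (Word xs) k"
  have w: "w = Word xs + Word [g]" using xs by (cases w) (simp add: plus_gen_word_def)
  have single: "Poly_Mapping.single w k = ?p * gen g" by (simp add: w gen_def mult_single)
  have "?p * (gen g * gen (Vert r) - gen g) \<in> N0"
  proof (cases "xs = []")
    case True
    then show ?thesis using N0_closed(6) r(2) by (simp add: zero_gen_word_def[symmetric])
  next
    case False
    then have "?p \<in> carrier R" using assms xs by (intro single_R) (auto simp: zero_gen_word_iff)
    then show ?thesis using N0_closed(4) r(2) by blast
  qed
  then show ?thesis using r(1) unfolding single by (auto simp: right_diff_distrib mult.assoc)
qed

text \<open>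
  The vertices at the right ends of the words in \<open>x\<close> add up to a local unit: a word is fixed by its own right end and
  killed by every other vertex.
\<close>

lemma right_unit:
  assumes x: "x \<in> carrier R"
  shows "\<exists>u \<in> carrier R. x * u - x \<in> N0"
proof -
  let ?s = "\<lambda>w. Poly_Mapping.single w (Poly_Mapping.lookup x w)"
  have "\<forall>w \<in> Poly_Mapping.keys x. \<exists>r. r \<in> verts E \<and> ?s w * gen (Vert r) - ?s w \<in> N0"
    using x single_right_unit by (fastforce simp: carrier_R)
  then obtain r where r: "\<And>w. w \<in> Poly_Mapping.keys x \<Longrightarrow> r w \<in> verts E \<and> ?s w * gen (Vert (r w)) - ?s w \<in> N0"
    by metis
  define V where "V = r ` Poly_Mapping.keys x"
  have V: "finite V" "V \<subseteq> verts E" using r by (auto simp: V_def)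
  define u where "u = (\<Sum>v\<in>V. gen (Vert v) :: (('v, 'e) lpa_gen gen_word \<Rightarrow>\<^sub>0 'k))"
  have u: "u \<in> carrier R" unfolding u_def using V by (intro R_sum gen_R gens) auto
  have "?s w * u - ?s w \<in> N0" if w: "w \<in> Poly_Mapping.keys x" for w
  proof -
    have sR: "?s w \<in> carrier R" using x w by (intro single_R) (auto simp: carrier_R)
    have other: "?s w * gen (Vert v) \<in> N0" if v: "v \<in> V - {r w}" for v
    proof -
      have vV: "v \<in> verts E" "v \<noteq> r w" using v V by auto
      have "gen (Vert (r w)) * gen (Vert v) \<in> N0" using relations(1)[of "r w" v] r[OF w] vV by simp
      then have 1: "?s w * (gen (Vert (r w)) * gen (Vert v)) \<in> N0" using sR N0_closed(4) by blast
      have 2: "- ((?s w * gen (Vert (r w)) - ?s w) * gen (Vert v)) \<in> N0"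
        using r[OF w] gen_R[OF gens(1)[OF vV(1)]] N0_closed(3,5) by blast
      have "?s w * gen (Vert v) = ?s w * (gen (Vert (r w)) * gen (Vert v))
          + - ((?s w * gen (Vert (r w)) - ?s w) * gen (Vert v))"
        by (simp add: left_diff_distrib mult.assoc)
      then show ?thesis using N0_closed(2)[OF 1 2] by simp
    qed
    have rV: "r w \<in> V" using w by (simp add: V_def)
    have u_split: "u = gen (Vert (r w)) + (\<Sum>v\<in>V - {r w}. gen (Vert v))"
      unfolding u_def by (rule sum.remove[OF V(1) rV])
    have eq: "?s w * u - ?s w = (?s w * gen (Vert (r w)) - ?s w) + (\<Sum>v\<in>V - {r w}. ?s w * gen (Vert v))"
      unfolding u_split by (simp add: sum_distrib_left distrib_left)
    show ?thesis
      unfolding eq using r[OF w] by (intro N0_closed(2) N0_sum other) auto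
  qed
  then have "(\<Sum>w\<in>Poly_Mapping.keys x. ?s w * u - ?s w) \<in> N0" by (rule N0_sum)
  moreover have "(\<Sum>w\<in>Poly_Mapping.keys x. ?s w * u - ?s w) = x * u - x"
    by (simp add: sum_subtractf sum_distrib_right[symmetric] sum_singles[symmetric])
  ultimately show ?thesis using u by auto
qed

lemma B_ideal: "alg_ideal B"
  unfolding alg_ideal_def
proof (intro conjI ballI allI)
  show "0 \<in> B" by (simp add: B_def)
  fix x assume x: "x \<in> B"
  show "x + y \<in> B" if "y \<in> B" for y using x that keys_add[of x y] by (auto simp: B_def)
  show "a * x \<in> B" "x * a \<in> B" for a
    using x keys_mult[of a x] keys_mult[of x a] by (fastforce simp: B_def)+
qed

lemma decompose: "\<exists>k x b. x \<in> carrier R \<and> b \<in> B \<and> a = scalar k + x + b"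
proof -
  let ?s = "\<lambda>w. Poly_Mapping.single w (Poly_Mapping.lookup a w)"
  let ?G = "{w \<in> Poly_Mapping.keys a. w \<noteq> 0 \<and> set (letters w) \<subseteq> lpa_gens E}"
  let ?H = "{w \<in> Poly_Mapping.keys a. \<not> set (letters w) \<subseteq> lpa_gens E}"
  let ?O = "{w \<in> Poly_Mapping.keys a. w = 0}"
  have K: "Poly_Mapping.keys a = ?O \<union> ?G \<union> ?H" by (auto simp: zero_gen_word_iff)
  have "a = sum ?s (Poly_Mapping.keys a)" by (rule sum_singles)
  also have "\<dots> = sum ?s (?O \<union> ?G) + sum ?s ?H"
    by (subst K, rule sum.union_disjoint) (auto simp: zero_gen_word_iff)
  also have "sum ?s (?O \<union> ?G) = sum ?s ?O + sum ?s ?G"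
    by (rule sum.union_disjoint) auto
  also have "sum ?s ?O = scalar (Poly_Mapping.lookup a 0)"
  proof (cases "0 \<in> Poly_Mapping.keys a")
    case True
    then have "?O = {0}" by auto
    then show ?thesis by simp
  next
    case False
    then have "?O = {}" by auto
    then show ?thesis using False by (simp add: in_keys_iff)
  qed
  finally have "a = scalar (Poly_Mapping.lookup a 0) + sum ?s ?G + sum ?s ?H" .
  moreover have "sum ?s ?G \<in> carrier R" by (intro R_sum single_R) auto
  moreover have "sum ?s ?H \<in> B" by (rule alg_ideal_sum[OF B_ideal]) (auto simp: B_def)
  ultimately show ?thesis by blast
qed

lemma augmented: "augmented_quotient R N0 B scalar"
proof unfold_locales
  show "x = 0" if "x \<in> carrier R" "x \<in> B" for x
  proof (rule poly_mapping_eqI)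
    fix w show "Poly_Mapping.lookup x w = Poly_Mapping.lookup 0 w"
      using that by (cases "w \<in> Poly_Mapping.keys x") (auto simp: carrier_R B_def in_keys_iff)
  qed
qed (use R_ops R_closed N0_R N0_closed B_ideal decompose right_unit in \<open>auto simp: scalar_comm[symmetric]\<close>)

interpretation augmented_quotient R N0 B scalar by (rule augmented)

lemma two_sided_zero: "two_sided_ideal L {\<zero>\<^bsub>L\<^esub>}"
  by (rule L.two_sided_idealI) (auto simp: L.l_zero_mult L.r_zero_mult)

lemma N0_hat: "p \<in> N0 \<Longrightarrow> p \<in> hat {\<zero>\<^bsub>L\<^esub>}"
  using hat_iff[of p "{\<zero>\<^bsub>L\<^esub>}"] N0_R by (auto simp: zero_L cls_eq_iff)

lemma B_hat: "b \<in> B \<Longrightarrow> b \<in> hat {\<zero>\<^bsub>L\<^esub>}"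
  using hatI[of 0 "{\<zero>\<^bsub>L\<^esub>}" b] by (simp add: R_closed zero_L)

lemma presentation:
  "lpa_presentation E scalar (\<lambda>v. gen (Vert v)) (\<lambda>e. gen (Edge e)) (\<lambda>e. gen (Ghost e))
    (hat {\<zero>\<^bsub>L\<^esub>}) (hat (carrier L))"
proof (intro lpa_presentation.intro lpa_presentation_axioms.intro wf)
  show "alg_ideal (hat {\<zero>\<^bsub>L\<^esub>})" "alg_ideal (hat (carrier L))"
    by (rule alg_ideal_hat, rule two_sided_zero L.two_sided_ideal_carrier)+
  show "gen (Vert v) \<in> hat (carrier L)" if "v \<in> verts E" for v
    using gen_R[OF gens(1)[OF that]] hat_iff L_ops by blast
  fix x assume "x \<in> hat (carrier L)"
  then obtain f b where f: "x = f + b" "f \<in> carrier R" "b \<in> B" by (rule hatE)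
  obtain ws where ws: "set ws = Poly_Mapping.keys f" "distinct ws"
    using finite_distinct_list[OF finite_keys[of f]] by (elim exE conjE)
  have gen: "case_lpa_gen (\<lambda>v. gen (Vert v)) (\<lambda>e. gen (Edge e)) (\<lambda>e. gen (Ghost e)) = gen"
    by (rule ext) (simp split: lpa_gen.split)
  let ?ls = "map (\<lambda>w. (Poly_Mapping.lookup f w, letters w)) ws"
  have "(\<Sum>(k, w)\<leftarrow>?ls. scalar k * prod_list (map gen w))
      = (\<Sum>w\<leftarrow>ws. Poly_Mapping.single w (Poly_Mapping.lookup f w))"
    by (simp add: o_def single_word[symmetric])
  also have "\<dots> = f"
    by (subst (2) sum_singles) (simp add: sum_list_distinct_conv_sum_set ws)
  finally have "x \<simeq>\<^bsub>hat {\<zero>\<^bsub>L\<^esub>}\<^esub> (\<Sum>(k, w)\<leftarrow>?ls. scalar k * prod_list (map gen w))"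
    using f B_hat by (simp add: cg_def)
  moreover have "\<forall>(k, w) \<in> set ?ls. w \<noteq> [] \<and> set w \<subseteq> lpa_gens E"
    using f(2) ws(1) by (auto simp: carrier_R zero_gen_word_iff)
  ultimately show "\<exists>ls. (\<forall>(k, w) \<in> set ls. w \<noteq> [] \<and> set w \<subseteq> lpa_gens E) \<and>
      x \<simeq>\<^bsub>hat {\<zero>\<^bsub>L\<^esub>}\<^esub> (\<Sum>(k, w)\<leftarrow>ls. scalar k *
        prod_list (map (case_lpa_gen (\<lambda>v. gen (Vert v)) (\<lambda>e. gen (Edge e)) (\<lambda>e. gen (Ghost e))) w))"
    unfolding gen by blast
qed (use relations N0_hat scalar_comm in \<open>auto simp: cg_def single_add mult_single\<close>)

text \<open>
  Under \<open>hat\<close> the ideals \<open>P \<subset> Q\<close> and their product become ideals of the polynomial ring to which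
  \<open>prime_subset_product\<close> applies.
\<close>

lemma prime_absorbing: "prime_absorbing_ring L"
proof (intro prime_absorbing_ring.intro prime_absorbing_ring_axioms.intro L.nonunital_ring_axioms)
  fix P Q assume P: "prime_ideal L P" and Q: "two_sided_ideal L Q" and PQ: "P \<subset> Q"
  have tP: "two_sided_ideal L P" using P by (simp add: prime_ideal_def)
  have prod: "two_sided_ideal L (P \<cdot>\<^bsub>L\<^esub> Q)" by (rule L.two_sided_ideal_prod[OF tP Q])
  have zero: "{\<zero>\<^bsub>L\<^esub>} \<subseteq> I" if "two_sided_ideal L I" for I using L.two_sided_idealD(2)[OF that] by simp
  interpret lpa_prime E scalar "\<lambda>v. gen (Vert v)" "\<lambda>e. gen (Edge e)" "\<lambda>e. gen (Ghost e)"
    "hat {\<zero>\<^bsub>L\<^esub>}" "hat (carrier L)" "hat P"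
    by (intro lpa_prime.intro lpa_prime_axioms.intro presentation alg_ideal_hat tP hat_mono zero
        L.two_sided_idealD(1) hat_prime P)
  have "hat P \<subseteq> hat (P \<cdot>\<^bsub>L\<^esub> Q)"
  proof (rule prime_subset_product)
    have "\<not> hat Q \<subseteq> hat P" using hat_subset_cancel L.two_sided_idealD(1)[OF Q] PQ by blast
    then show "hat P \<subset> hat Q" using hat_mono PQ by blast
    show "hat (P \<cdot>\<^bsub>L\<^esub> Q) \<subseteq> hat P" using L.ideal_prod_subset[OF tP Q] by (intro hat_mono) blast
    show "x * y \<in> hat (P \<cdot>\<^bsub>L\<^esub> Q)" if "x \<in> hat P" "y \<in> hat Q" for x y using hat_prod that prod by blast
  qed (intro alg_ideal_hat Q prod hat_mono zero L.two_sided_idealD(1))+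
  then show "P \<subseteq> P \<cdot>\<^bsub>L\<^esub> Q" using hat_subset_cancel L.two_sided_idealD(1)[OF tP] by blast
qed

end

lemma leavitt_path_algebra_prime_absorbing:
  "wf_digraph E \<Longrightarrow> prime_absorbing_ring (leavitt_path_algebra E)"
  unfolding leavitt_path_algebra_def by (rule prime_absorbing)

theorem theorem4p6:
  fixes E :: "('v, 'e) pre_digraph"
    and L :: "(('v, 'e) lpa_gen gen_word \<Rightarrow>\<^sub>0 'k::field) set ring"
    and A :: "(('v, 'e) lpa_gen gen_word \<Rightarrow>\<^sub>0 'k) set set"
    and I J :: "nat \<Rightarrow> (('v, 'e) lpa_gen gen_word \<Rightarrow>\<^sub>0 'k) set set"
    and m n :: nat
  assumes "wf_digraph E" and "verts E \<noteq> {}"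
    and "L = leavitt_path_algebra E"
    and "two_sided_ideal L A"
    and "m \<ge> 1" and "n \<ge> 1"
    and "\<And>i. i \<in> {1..m} \<Longrightarrow> prime_power_ideal L (I i)"
    and "\<And>j. j \<in> {1..n} \<Longrightarrow> prime_power_ideal L (J j)"
    and "A = (\<Inter>i \<in> {1..m}. I i)" and "A = (\<Inter>j \<in> {1..n}. J j)"
    and "irredundant {1..m} I" and "irredundant {1..n} J"
  shows "m = n \<and> (\<exists>\<sigma>. \<sigma> permutes {1..m} \<and> (\<forall>i \<in> {1..m}. I i = J (\<sigma> i)))"
proof -
  interpret prime_absorbing_ring L
    unfolding assms(3) by (rule leavitt_path_algebra_prime_absorbing[OF assms(1)])
  obtain \<sigma> where \<sigma>: "bij_betw \<sigma> {1..m} {1..n}" "\<forall>i \<in> {1..m}. I i = J (\<sigma> i)"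
    using irredundant_unique[of "{1..m}" "{1..n}" I J] assms by auto
  have mn: "m = n" using bij_betw_same_card[OF \<sigma>(1)] by simp
  let ?\<tau> = "\<lambda>i. if i \<in> {1..m} then \<sigma> i else i"
  have "bij_betw \<sigma> {1..m} {1..m}" using \<sigma>(1) mn by simp
  then have "bij_betw ?\<tau> {1..m} {1..m}" by (rule iffD1[OF bij_betw_cong, rotated]) simp
  then have "?\<tau> permutes {1..m}" by (rule bij_imp_permutes) auto
  then show ?thesis using mn \<sigma>(2) by (intro conjI exI[of _ ?\<tau>]) auto
qed

end
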